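(* Let $k$ be an algebraically closed field of characteristic $0$, let $G$ be a pro-algebraic group over $k$, and let $J$ be a Hopf $2$-cocycle for $\mathcal{O}(G)$ that is obtained by deformation of $1$. Then the square $S^2$ of the antipode of the twisted Hopf algebra $\mathcal{O}(G)^J$ is a unipotent operator on $\mathcal{O}(G)^J$.
   Context: $G$ is an affine pro-algebraic group over $k$, and $\mathcal{O}(G)$ is its commutative Hopf algebra of regular functions. Sweedler notation $\Delta(a)=\sum a_1\otimes a_2$ is used; linear forms on $B$ and $B\otimes B$ are multiplied by convolution, and inverses are convolution inverses. Hopf $2$-cocycle for a Hopf algebra $B$: a convolution-invertible linear form $J:B\otimes B\to k$ with $\sum J(a_1b_1,c)J(a_2,b_2)=\sum J(a,b_1c_1)J(b_2,c_2)$ and $J(a,1)=\varepsilon(a)=J(1,a)$ for all $a,b,c\in B$. The twisted Hopf algebra $B^J$ equals $B$ as a coalgebra (with the same unit), with multiplication $m^J(a\otimes b)=\sum J^{-1}(a_1,b_1)\,a_2b_2\,J(a_3,b_3)$ and antipode $S^J(a)=\sum J^{-1}(a_1,S(a_2))S(a_3)J(S(a_4),a_5)$. Deformation: let $\Sigma$ be an irreducible affine algebraic curve over $k$ with a marked smooth point $0$, and $\mathcal{O}(\Sigma)$ its ring of regular functions. A family of Hopf $2$-cocycles for $\mathcal{O}(G)$ parametrized by $\Sigma$ is a linear map $J:\mathcal{O}(G)^{\otimes 2}\to\mathcal{O}(\Sigma)$ whose evaluation $J(a):\mathcal{O}(G)^{\otimes 2}\to k$ at each point $a\in\Sigma$ is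 a Hopf $2$-cocycle for $\mathcal{O}(G)$. A Hopf $2$-cocycle is obtained by deformation of $1$ if it equals $J(a)$ for some such $\Sigma$, some such family with $J(0)=1$, and some $a\in\Sigma$; here $1=\varepsilon\otimes\varepsilon$ is the unit of the convolution algebra $(\mathcal{O}(G)\otimes\mathcal{O}(G))^*$. The operator $S^2$ preserves every subcoalgebra of $\mathcal{O}(G)^J$, so it is locally finite; it is unipotent if its restriction to every finite-dimensional subcoalgebra is unipotent, i.e. has all eigenvalues equal to $1$. *)

theory Defs
  imports
    "HOL-Computational_Algebra.Polynomial"
    "HOL-Library.Poly_Mapping"
    "HOL-Library.Function_Algebras"
begin

section \<open>Tensor powers of a vector space\<close>

text \<open>
  The library has no tensor product. For a vector space \<open>B\<close> with scalar multiplication \<open>s\<close>, the spaces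
  \<open>B \<otimes> B\<close> and \<open>B \<otimes> B \<otimes> B\<close> are the quotients of the free vector spaces on \<open>B \<times> B\<close> and
  \<open>B \<times> B \<times> B\<close> by the multilinearity relations; a tensor is a coset.  The parameter \<open>P\<close> below is
  the set of all maps that insert an argument into one of the slots while keeping the others fixed.
\<close>

definition free_scale :: "'k::field \<Rightarrow> ('i \<Rightarrow>\<^sub>0 'k) \<Rightarrow> ('i \<Rightarrow>\<^sub>0 'k)" where
  "free_scale c u = Poly_Mapping.map (\<lambda>x. c * x) u"

definition multilinear_relations ::
    "('k::field \<Rightarrow> 'b::ab_group_add \<Rightarrow> 'b) \<Rightarrow> ('b \<Rightarrow> 'i) set \<Rightarrow> ('i \<Rightarrow>\<^sub>0 'k) set" where
  "multilinear_relations s P =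
     {Poly_Mapping.single (p (a + b)) 1 - Poly_Mapping.single (p a) 1 - Poly_Mapping.single (p b) 1
        | p a b. p \<in> P} \<union>
     {Poly_Mapping.single (p (s c a)) 1 - Poly_Mapping.single (p a) c | p c a. p \<in> P}"

definition slots2 :: "('b \<Rightarrow> 'b \<times> 'b) set" where
  "slots2 = {\<lambda>a. (a, y) | y. True} \<union> {\<lambda>a. (x, a) | x. True}"

definition slots3 :: "('b \<Rightarrow> 'b \<times> 'b \<times> 'b) set" where
  "slots3 = {\<lambda>a. (a, y, z) | y z. True} \<union> {\<lambda>a. (x, a, z) | x z. True} \<union> {\<lambda>a. (x, y, a) | x y. True}"

definition null2 :: "('k::field \<Rightarrow> 'b::ab_group_add \<Rightarrow> 'b) \<Rightarrow> ('b \<times> 'b \<Rightarrow>\<^sub>0 'k) set" where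
  "null2 s = module.span free_scale (multilinear_relations s slots2)"

definition null3 :: "('k::field \<Rightarrow> 'b::ab_group_add \<Rightarrow> 'b) \<Rightarrow> ('b \<times> 'b \<times> 'b \<Rightarrow>\<^sub>0 'k) set" where
  "null3 s = module.span free_scale (multilinear_relations s slots3)"

type_synonym ('k, 'b) tensor2 = "('b \<times> 'b \<Rightarrow>\<^sub>0 'k) set"

definition tensor2_class ::
    "('k::field \<Rightarrow> 'b::ab_group_add \<Rightarrow> 'b) \<Rightarrow> ('b \<times> 'b \<Rightarrow>\<^sub>0 'k) \<Rightarrow> ('k, 'b) tensor2" where
  "tensor2_class s u = {v. v - u \<in> null2 s}"

definition tensor2_space :: "('k::field \<Rightarrow> 'b::ab_group_add \<Rightarrow> 'b) \<Rightarrow> ('k, 'b) tensor2 set" where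
  "tensor2_space s = range (tensor2_class s)"

definition bilinear_map ::
    "('k::field \<Rightarrow> 'b::ab_group_add \<Rightarrow> 'b) \<Rightarrow> ('k \<Rightarrow> 'v::ab_group_add \<Rightarrow> 'v) \<Rightarrow> ('b \<Rightarrow> 'b \<Rightarrow> 'v) \<Rightarrow> bool" where
  "bilinear_map s t f \<longleftrightarrow>
     (\<forall>y. Vector_Spaces.linear s t (\<lambda>x. f x y)) \<and> (\<forall>x. Vector_Spaces.linear s t (f x))"

text \<open>
  The linear map \<open>B \<otimes> B \<rightarrow> V\<close> induced by a bilinear map \<open>f\<close>; for bilinear \<open>f\<close> its value does not depend on the
  chosen representative of the coset.
\<close>

definition eval_formal ::
    "('k::field \<Rightarrow> 'v::ab_group_add \<Rightarrow> 'v) \<Rightarrow> ('b \<Rightarrow> 'b \<Rightarrow> 'v) \<Rightarrow> ('b \<times> 'b \<Rightarrow>\<^sub>0 'k) \<Rightarrow> 'v" where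
  "eval_formal t f u = (\<Sum>(x, y)\<in>Poly_Mapping.keys u. t (Poly_Mapping.lookup u (x, y)) (f x y))"

definition tensor2_lift ::
    "('k::field \<Rightarrow> 'v::ab_group_add \<Rightarrow> 'v) \<Rightarrow> ('b \<Rightarrow> 'b \<Rightarrow> 'v) \<Rightarrow> ('k, 'b) tensor2 \<Rightarrow> 'v" where
  "tensor2_lift t f X = eval_formal t f (SOME u. u \<in> X)"


section \<open>Hopf algebras\<close>

text \<open>
  The multiplication is a record field rather than a type class operation, because a Hopf algebra
  and its twists live on the same vector space.
\<close>

record (overloaded) ('k::zero, 'b) hopf =
  scal :: "'k \<Rightarrow> 'b \<Rightarrow> 'b"
  mul :: "'b \<Rightarrow> 'b \<Rightarrow> 'b"
  unit :: 'b
  comul :: "'b \<Rightarrow> ('k, 'b) tensor2"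
  counit :: "'b \<Rightarrow> 'k"
  antipode :: "'b \<Rightarrow> 'b"

text \<open>
  Sweedler sums with values in a vector space with scalar multiplication \<open>t\<close>:
  \<open>sweedler2 H t f a\<close> is the sum of \<open>f a\<^sub>1 a\<^sub>2\<close>, \<open>sweedler3 H t f a\<close> the sum of \<open>f a\<^sub>1 a\<^sub>2 a\<^sub>3\<close>, etc.
\<close>

definition sweedler2 ::
    "('k::field, 'b) hopf \<Rightarrow> ('k \<Rightarrow> 'v::ab_group_add \<Rightarrow> 'v) \<Rightarrow> ('b \<Rightarrow> 'b \<Rightarrow> 'v) \<Rightarrow> 'b \<Rightarrow> 'v" where
  "sweedler2 H t f a = tensor2_lift t f (comul H a)"

definition sweedler3 ::
    "('k::field, 'b) hopf \<Rightarrow> ('k \<Rightarrow> 'v::ab_group_add \<Rightarrow> 'v) \<Rightarrow> ('b \<Rightarrow> 'b \<Rightarrow> 'b \<Rightarrow> 'v) \<Rightarrow> 'b \<Rightarrow> 'v" where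
  "sweedler3 H t f = sweedler2 H t (\<lambda>x. sweedler2 H t (f x))"

definition sweedler4 ::
    "('k::field, 'b) hopf \<Rightarrow> ('k \<Rightarrow> 'v::ab_group_add \<Rightarrow> 'v) \<Rightarrow> ('b \<Rightarrow> 'b \<Rightarrow> 'b \<Rightarrow> 'b \<Rightarrow> 'v) \<Rightarrow> 'b \<Rightarrow> 'v" where
  "sweedler4 H t f = sweedler2 H t (\<lambda>x. sweedler3 H t (f x))"

definition sweedler5 ::
    "('k::field, 'b) hopf \<Rightarrow> ('k \<Rightarrow> 'v::ab_group_add \<Rightarrow> 'v) \<Rightarrow> ('b \<Rightarrow> 'b \<Rightarrow> 'b \<Rightarrow> 'b \<Rightarrow> 'b \<Rightarrow> 'v) \<Rightarrow> 'b \<Rightarrow> 'v" where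
  "sweedler5 H t f = sweedler2 H t (\<lambda>x. sweedler4 H t (f x))"

text \<open>
  Representatives of the images of (the class of) \<open>u\<close> under \<open>\<Delta> \<otimes> id\<close> and \<open>id \<otimes> \<Delta>\<close>, where \<open>d a\<close>
  is a representative of \<open>\<Delta>(a)\<close>.
\<close>

definition comul_left ::
    "('b \<Rightarrow> ('b \<times> 'b \<Rightarrow>\<^sub>0 'k::field)) \<Rightarrow> ('b \<times> 'b \<Rightarrow>\<^sub>0 'k) \<Rightarrow> ('b \<times> 'b \<times> 'b \<Rightarrow>\<^sub>0 'k)" where
  "comul_left d u = (\<Sum>(x, y)\<in>Poly_Mapping.keys u. \<Sum>(p, q)\<in>Poly_Mapping.keys (d x).
     Poly_Mapping.single (p, q, y) (Poly_Mapping.lookup u (x, y) * Poly_Mapping.lookup (d x) (p, q)))"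

definition comul_right ::
    "('b \<Rightarrow> ('b \<times> 'b \<Rightarrow>\<^sub>0 'k::field)) \<Rightarrow> ('b \<times> 'b \<Rightarrow>\<^sub>0 'k) \<Rightarrow> ('b \<times> 'b \<times> 'b \<Rightarrow>\<^sub>0 'k)" where
  "comul_right d u = (\<Sum>(x, y)\<in>Poly_Mapping.keys u. \<Sum>(p, q)\<in>Poly_Mapping.keys (d y).
     Poly_Mapping.single (x, p, q) (Poly_Mapping.lookup u (x, y) * Poly_Mapping.lookup (d y) (p, q)))"

definition formal_mul ::
    "('b \<Rightarrow> 'b \<Rightarrow> 'b) \<Rightarrow> ('b \<times> 'b \<Rightarrow>\<^sub>0 'k::field) \<Rightarrow> ('b \<times> 'b \<Rightarrow>\<^sub>0 'k) \<Rightarrow> ('b \<times> 'b \<Rightarrow>\<^sub>0 'k)" where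
  "formal_mul m u v = (\<Sum>(x, y)\<in>Poly_Mapping.keys u. \<Sum>(p, q)\<in>Poly_Mapping.keys v.
     Poly_Mapping.single (m x p, m y q) (Poly_Mapping.lookup u (x, y) * Poly_Mapping.lookup v (p, q)))"

locale coalgebra =
  fixes H :: "('k::field, 'b::ab_group_add) hopf"
  assumes vector_space: "vector_space (scal H)"
    and comul_tensor: "comul H a \<in> tensor2_space (scal H)"
    and comul_add: "\<lbrakk>u \<in> comul H a; v \<in> comul H b\<rbrakk> \<Longrightarrow> u + v \<in> comul H (a + b)"
    and comul_scale: "u \<in> comul H a \<Longrightarrow> free_scale c u \<in> comul H (scal H c a)"
    and counit_linear: "Vector_Spaces.linear (scal H) (*) (counit H)"
    and coassoc: "\<lbrakk>\<And>x. d x \<in> comul H x; u \<in> comul H a\<rbrakk>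
                    \<Longrightarrow> comul_left d u - comul_right d u \<in> null3 (scal H)"
    and counit_left: "sweedler2 H (scal H) (\<lambda>x y. scal H (counit H x) y) a = a"
    and counit_right: "sweedler2 H (scal H) (\<lambda>x y. scal H (counit H y) x) a = a"

locale hopf_algebra = coalgebra H for H :: "('k::field, 'b::ab_group_add) hopf" +
  assumes mul_bilinear: "bilinear_map (scal H) (scal H) (mul H)"
    and mul_assoc: "mul H (mul H a b) c = mul H a (mul H b c)"
    and unit_left: "mul H (unit H) a = a"
    and unit_right: "mul H a (unit H) = a"
    and comul_mul: "\<lbrakk>u \<in> comul H a; v \<in> comul H b\<rbrakk> \<Longrightarrow> formal_mul (mul H) u v \<in> comul H (mul H a b)"
    and comul_unit: "Poly_Mapping.single (unit H, unit H) 1 \<in> comul H (unit H)"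
    and counit_mul: "counit H (mul H a b) = counit H a * counit H b"
    and counit_unit: "counit H (unit H) = 1"
    and antipode_linear: "Vector_Spaces.linear (scal H) (scal H) (antipode H)"
    and antipode_left:
      "sweedler2 H (scal H) (\<lambda>x y. mul H (antipode H x) y) a = scal H (counit H a) (unit H)"
    and antipode_right:
      "sweedler2 H (scal H) (\<lambda>x y. mul H x (antipode H y)) a = scal H (counit H a) (unit H)"

text \<open>
  An affine pro-algebraic group \<open>G\<close> over \<open>k\<close> is given by its coordinate Hopf algebra \<open>\<O>(G)\<close>, which
  is an arbitrary commutative Hopf algebra over \<open>k\<close> (the opposite category of commutative Hopf
  algebras is that of affine group schemes, i.e. of inverse limits of affine algebraic groups).
\<close>

locale commutative_hopf_algebra = hopf_algebra H for H :: "('k::field, 'b::ab_group_add) hopf" +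
  assumes mul_commute: "mul H a b = mul H b a"


section \<open>Hopf 2-cocycles and twisting\<close>

text \<open>Linear forms on \<open>B \<otimes> B\<close> are represented by bilinear forms \<open>B \<times> B \<rightarrow> k\<close>.\<close>

definition bilinear_form :: "('k::field, 'b::ab_group_add) hopf \<Rightarrow> ('b \<Rightarrow> 'b \<Rightarrow> 'k) \<Rightarrow> bool" where
  "bilinear_form H f \<longleftrightarrow> bilinear_map (scal H) (*) f"

definition convolution ::
    "('k::field, 'b::ab_group_add) hopf \<Rightarrow> ('b \<Rightarrow> 'b \<Rightarrow> 'k) \<Rightarrow> ('b \<Rightarrow> 'b \<Rightarrow> 'k) \<Rightarrow> 'b \<Rightarrow> 'b \<Rightarrow> 'k" where
  "convolution H f g a b =
     sweedler2 H (*) (\<lambda>a1 a2. sweedler2 H (*) (\<lambda>b1 b2. f a1 b1 * g a2 b2) b) a"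

definition convolution_one :: "('k::field, 'b) hopf \<Rightarrow> 'b \<Rightarrow> 'b \<Rightarrow> 'k" where
  "convolution_one H a b = counit H a * counit H b"

definition is_convolution_inverse ::
    "('k::field, 'b::ab_group_add) hopf \<Rightarrow> ('b \<Rightarrow> 'b \<Rightarrow> 'k) \<Rightarrow> ('b \<Rightarrow> 'b \<Rightarrow> 'k) \<Rightarrow> bool" where
  "is_convolution_inverse H J K \<longleftrightarrow>
     bilinear_form H K \<and> convolution H J K = convolution_one H \<and> convolution H K J = convolution_one H"

definition convolution_inverse ::
    "('k::field, 'b::ab_group_add) hopf \<Rightarrow> ('b \<Rightarrow> 'b \<Rightarrow> 'k) \<Rightarrow> 'b \<Rightarrow> 'b \<Rightarrow> 'k" where
  "convolution_inverse H J = (THE K. is_convolution_inverse H J K)"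

definition hopf_2_cocycle ::
    "('k::field, 'b::ab_group_add) hopf \<Rightarrow> ('b \<Rightarrow> 'b \<Rightarrow> 'k) \<Rightarrow> bool" where
  "hopf_2_cocycle H J \<longleftrightarrow>
     bilinear_form H J \<and>
     (\<exists>K. is_convolution_inverse H J K) \<and>
     (\<forall>a b c.
        sweedler2 H (*) (\<lambda>a1 a2. sweedler2 H (*) (\<lambda>b1 b2. J (mul H a1 b1) c * J a2 b2) b) a =
        sweedler2 H (*) (\<lambda>b1 b2. sweedler2 H (*) (\<lambda>c1 c2. J a (mul H b1 c1) * J b2 c2) c) b) \<and>
     (\<forall>a. J a (unit H) = counit H a \<and> J (unit H) a = counit H a)"

definition twist ::
    "('k::field, 'b::ab_group_add) hopf \<Rightarrow> ('b \<Rightarrow> 'b \<Rightarrow> 'k) \<Rightarrow> ('k, 'b) hopf" where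
  "twist H J = H\<lparr>
     mul := (\<lambda>a b.
       sweedler3 H (scal H) (\<lambda>a1 a2 a3.
         sweedler3 H (scal H) (\<lambda>b1 b2 b3.
           scal H (convolution_inverse H J a1 b1 * J a3 b3) (mul H a2 b2)) b) a),
     antipode := (\<lambda>a.
       sweedler5 H (scal H) (\<lambda>a1 a2 a3 a4 a5.
         scal H (convolution_inverse H J a1 (antipode H a2) * J (antipode H a4) a5) (antipode H a3)) a)\<rparr>"


section \<open>Affine curves\<close>

text \<open>
  The points of affine \<open>n\<close>-space are the functions \<open>nat \<Rightarrow> 'k\<close> vanishing from index \<open>n\<close> on.
\<close>

definition affine_space :: "nat \<Rightarrow> (nat \<Rightarrow> 'k::field) set" where
  "affine_space n = {x. \<forall>i\<ge>n. x i = 0}"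

inductive_set polynomial_functions :: "nat \<Rightarrow> ((nat \<Rightarrow> 'k::field) \<Rightarrow> 'k) set" for n where
  const: "(\<lambda>x. c) \<in> polynomial_functions n"
| coord: "i < n \<Longrightarrow> (\<lambda>x. x i) \<in> polynomial_functions n"
| add: "\<lbrakk>f \<in> polynomial_functions n; g \<in> polynomial_functions n\<rbrakk>
          \<Longrightarrow> (\<lambda>x. f x + g x) \<in> polynomial_functions n"
| mult: "\<lbrakk>f \<in> polynomial_functions n; g \<in> polynomial_functions n\<rbrakk>
          \<Longrightarrow> (\<lambda>x. f x * g x) \<in> polynomial_functions n"

definition zariski_closed :: "nat \<Rightarrow> (nat \<Rightarrow> 'k::field) set \<Rightarrow> bool" where
  "zariski_closed n X \<longleftrightarrow>
     (\<exists>F \<subseteq> polynomial_functions n. X = {x \<in> affine_space n. \<forall>f\<in>F. f x = 0})"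

definition irreducible_closed :: "nat \<Rightarrow> (nat \<Rightarrow> 'k::field) set \<Rightarrow> bool" where
  "irreducible_closed n X \<longleftrightarrow>
     zariski_closed n X \<and> X \<noteq> {} \<and>
     (\<forall>A B. zariski_closed n A \<and> zariski_closed n B \<and> X = A \<union> B \<longrightarrow> X = A \<or> X = B)"

definition irreducible_chain ::
    "nat \<Rightarrow> (nat \<Rightarrow> 'k::field) set \<Rightarrow> nat \<Rightarrow> (nat \<Rightarrow> (nat \<Rightarrow> 'k) set) \<Rightarrow> bool" where
  "irreducible_chain n X d Z \<longleftrightarrow>
     (\<forall>i\<le>d. irreducible_closed n (Z i) \<and> Z i \<subseteq> X) \<and> (\<forall>i<d. Z i \<subset> Z (Suc i))"

definition has_dimension :: "nat \<Rightarrow> (nat \<Rightarrow> 'k::field) set \<Rightarrow> nat \<Rightarrow> bool" where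
  "has_dimension n X d \<longleftrightarrow>
     (\<exists>Z. irreducible_chain n X d Z) \<and> \<not> (\<exists>Z. irreducible_chain n X (Suc d) Z)"

definition irreducible_affine_curve :: "nat \<Rightarrow> (nat \<Rightarrow> 'k::field) set \<Rightarrow> bool" where
  "irreducible_affine_curve n X \<longleftrightarrow> irreducible_closed n X \<and> has_dimension n X 1"

text \<open>
  A regular function on \<open>X\<close> is the restriction to \<open>X\<close> of a polynomial function; it is set to \<open>0\<close>
  outside \<open>X\<close>, so that regular functions are equal iff they agree on \<open>X\<close>.
\<close>

definition regular_functions :: "nat \<Rightarrow> (nat \<Rightarrow> 'k::field) set \<Rightarrow> ((nat \<Rightarrow> 'k) \<Rightarrow> 'k) set" where
  "regular_functions n X = {\<lambda>x. if x \<in> X then f x else 0 | f. f \<in> polynomial_functions n}"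

definition fun_scale :: "'k::field \<Rightarrow> ('p \<Rightarrow> 'k) \<Rightarrow> ('p \<Rightarrow> 'k)" where
  "fun_scale c f = (\<lambda>x. c * f x)"

definition max_ideal :: "nat \<Rightarrow> (nat \<Rightarrow> 'k::field) set \<Rightarrow> (nat \<Rightarrow> 'k) \<Rightarrow> ((nat \<Rightarrow> 'k) \<Rightarrow> 'k) set" where
  "max_ideal n X p = {f \<in> regular_functions n X. f p = 0}"

definition max_ideal_square ::
    "nat \<Rightarrow> (nat \<Rightarrow> 'k::field) set \<Rightarrow> (nat \<Rightarrow> 'k) \<Rightarrow> ((nat \<Rightarrow> 'k) \<Rightarrow> 'k) set" where
  "max_ideal_square n X p =
     module.span fun_scale {f * g | f g. f \<in> max_ideal n X p \<and> g \<in> max_ideal n X p}"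

text \<open>
  A point \<open>p\<close> of a curve is smooth iff the Zariski cotangent space \<open>m\<^sub>p / m\<^sub>p\<^sup>2\<close> is one-dimensional,
  i.e. iff it is spanned by the class of some \<open>t \<in> m\<^sub>p\<close> that is not in \<open>m\<^sub>p\<^sup>2\<close>.
\<close>

definition smooth_point_of_curve :: "nat \<Rightarrow> (nat \<Rightarrow> 'k::field) set \<Rightarrow> (nat \<Rightarrow> 'k) \<Rightarrow> bool" where
  "smooth_point_of_curve n X p \<longleftrightarrow>
     p \<in> X \<and>
     (\<exists>t \<in> max_ideal n X p. t \<notin> max_ideal_square n X p \<and>
        (\<forall>f \<in> max_ideal n X p. \<exists>c. f - fun_scale c t \<in> max_ideal_square n X p))"


section \<open>Deformations of the trivial cocycle\<close>

definition cocycle_family ::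
    "('k::field, 'b::ab_group_add) hopf \<Rightarrow> nat \<Rightarrow> (nat \<Rightarrow> 'k) set \<Rightarrow>
     ('b \<Rightarrow> 'b \<Rightarrow> (nat \<Rightarrow> 'k) \<Rightarrow> 'k) \<Rightarrow> bool" where
  "cocycle_family H n X F \<longleftrightarrow>
     (\<forall>a b. F a b \<in> regular_functions n X) \<and>
     bilinear_map (scal H) fun_scale F \<and>
     (\<forall>x\<in>X. hopf_2_cocycle H (\<lambda>a b. F a b x))"

definition deformation_of_one ::
    "('k::field, 'b::ab_group_add) hopf \<Rightarrow> ('b \<Rightarrow> 'b \<Rightarrow> 'k) \<Rightarrow> bool" where
  "deformation_of_one H J \<longleftrightarrow>
     (\<exists>n X p F. irreducible_affine_curve n X \<and> smooth_point_of_curve n X p \<and>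
        cocycle_family H n X F \<and> (\<lambda>a b. F a b p) = convolution_one H \<and>
        (\<exists>x\<in>X. J = (\<lambda>a b. F a b x)))"


section \<open>Unipotent operators\<close>

definition subcoalgebra :: "('k::field, 'b::ab_group_add) hopf \<Rightarrow> 'b set \<Rightarrow> bool" where
  "subcoalgebra H C \<longleftrightarrow>
     module.subspace (scal H) C \<and> (\<forall>a\<in>C. \<exists>u \<in> comul H a. Poly_Mapping.keys u \<subseteq> C \<times> C)"

definition finite_dimensional :: "('k::field, 'b::ab_group_add) hopf \<Rightarrow> 'b set \<Rightarrow> bool" where
  "finite_dimensional H C \<longleftrightarrow> (\<exists>B. finite B \<and> module.span (scal H) B = C)"

text \<open>
  The condition that \<open>T\<close> maps \<open>C\<close> to itself makes the restriction of \<open>T\<close> to \<open>C\<close> an operator on \<open>C\<close>.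
\<close>

definition unipotent_operator :: "('k::field, 'b::ab_group_add) hopf \<Rightarrow> ('b \<Rightarrow> 'b) \<Rightarrow> bool" where
  "unipotent_operator H T \<longleftrightarrow>
     (\<forall>C. subcoalgebra H C \<and> finite_dimensional H C \<longrightarrow>
        T ` C \<subseteq> C \<and> (\<forall>c. \<forall>v\<in>C. v \<noteq> 0 \<and> T v = scal H c v \<longrightarrow> c = 1))"

end

theory Submission
  imports Defs "Jordan_Normal_Form.Determinant"
begin

text \<open>
  Let \<open>J\<close> be a Hopf 2-cocycle and \<open>K\<close> its convolution inverse.  The antipode of the twist is \<open>q' * S * q\<close> with
  \<open>q(a) = J(S(a\<^sub>1), a\<^sub>2)\<close> and \<open>q'(a) = K(a\<^sub>1, S(a\<^sub>2))\<close>, and \<open>S\<^sup>2 = 1\<close> in the commutative algebra \<open>\<O>(G)\<close>.  The square of the twisted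
  antipode is therefore the conjugation by \<open>u = q' * (q \<circ> S)\<close> in the dual algebra (\<open>twisted_antipode_square_matrix\<close>).
  On the coefficients of a comodule with coefficient matrix \<open>T\<close> it is unipotent as soon as the scalar matrix \<open>u(T)\<close> is,
  and in characteristic 0 this holds if \<open>u(T)\<^sup>m\<close> has the trace of the identity matrix for all \<open>m \<ge> 1\<close>.

  Two properties of \<open>u\<close> are true for every cocycle.  It satisfies \<open>\<Delta>(u) * J = J * (u \<otimes> u)\<close> (\<open>u_grouplike\<close>),
  and it acts with its ordinary trace: \<open>u(\<chi>) = \<epsilon>(\<chi>)\<close> for trace-like elements \<open>\<chi>\<close>,
  whose coproduct is cocommutative (\<open>u_trace\<close>).
  Apply the second property to the cyclic permutation \<open>P\<close> of the tensor power \<open>V\<^sup>\<otimes>\<^sup>m\<close> of the comodule \<open>V\<close>: the operator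
  \<open>D\<close> by which \<open>u\<close> acts on \<open>V\<^sup>\<otimes>\<^sup>m\<close> satisfies \<open>tr(P D) = tr(P) = dim V\<close>.  By the first property an iterate \<open>J\<^sub>m\<close> of the cocycle
  intertwines \<open>D\<close> with the tensor power \<open>U\<^sup>\<otimes>\<^sup>m\<close> of the matrix \<open>U = u(T)\<close>, and \<open>tr(P U\<^sup>\<otimes>\<^sup>m) = tr(U\<^sup>m)\<close>.  To
  compare the two traces the intertwiner has to commute with \<open>P\<close>.  Both \<open>D\<close> and \<open>U\<^sup>\<otimes>\<^sup>m\<close> commute with \<open>P\<close>, the former since
  \<open>\<O>(G)\<close> is commutative, so the average of \<open>J\<^sub>m\<close> over the cyclic group is an intertwiner that commutes with \<open>P\<close>.  If
  it is invertible, then \<open>tr(U\<^sup>m) = dim V\<close> (\<open>power_trace\<close>).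

  This is where the deformation enters: the average may be singular for a given cocycle, but along a family that starts
  at the trivial cocycle it is a matrix of regular functions that is the identity at the base point, up to a nonzero factor.  Hence
  it is invertible on a nonempty open set of parameters, and the identity \<open>tr(U\<^sup>m) = dim V\<close> extends from there to
  the irreducible parameter curve (\<open>power_traces_of_deformation\<close>).
\<close>


section \<open>Square matrices over a finite index set\<close>

text \<open>
  The matrices below are indexed by bases, by pairs and by lists, so they are plain functions
  rather than matrices with a fixed numerical dimension.  They are required to vanish outside the index set,
  which makes them a ring with unit \<open>idm I\<close>.
\<close>

definition matrices :: "'i set \<Rightarrow> ('i \<Rightarrow> 'i \<Rightarrow> 'k::zero) set" where
  "matrices I = {A. \<forall>i j. i \<notin> I \<or> j \<notin> I \<longrightarrow> A i j = 0}"

definition mm :: "'i set \<Rightarrow> ('i \<Rightarrow> 'i \<Rightarrow> 'k::comm_ring_1) \<Rightarrow> ('i \<Rightarrow> 'i \<Rightarrow> 'k) \<Rightarrow> 'i \<Rightarrow> 'i \<Rightarrow> 'k" where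
  "mm I A B = (\<lambda>i j. \<Sum>l\<in>I. A i l * B l j)"

definition idm :: "'i set \<Rightarrow> 'i \<Rightarrow> 'i \<Rightarrow> 'k::comm_ring_1" where
  "idm I = (\<lambda>i j. if i = j \<and> i \<in> I then 1 else 0)"

definition restrict_mat :: "'i set \<Rightarrow> ('i \<Rightarrow> 'i \<Rightarrow> 'k::comm_ring_1) \<Rightarrow> 'i \<Rightarrow> 'i \<Rightarrow> 'k" where
  "restrict_mat I A = (\<lambda>i j. if i \<in> I \<and> j \<in> I then A i j else 0)"

primrec mpow :: "'i set \<Rightarrow> ('i \<Rightarrow> 'i \<Rightarrow> 'k::comm_ring_1) \<Rightarrow> nat \<Rightarrow> 'i \<Rightarrow> 'i \<Rightarrow> 'k" where
  "mpow I A 0 = idm I"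
| "mpow I A (Suc n) = mm I A (mpow I A n)"

definition tr :: "'i set \<Rightarrow> ('i \<Rightarrow> 'i \<Rightarrow> 'k::comm_ring_1) \<Rightarrow> 'k" where
  "tr I A = (\<Sum>i\<in>I. A i i)"

definition smat :: "'k::comm_ring_1 \<Rightarrow> ('i \<Rightarrow> 'i \<Rightarrow> 'k) \<Rightarrow> 'i \<Rightarrow> 'i \<Rightarrow> 'k" where
  "smat c A = (\<lambda>i j. c * A i j)"

lemma matricesI: "(\<And>i j. i \<notin> I \<or> j \<notin> I \<Longrightarrow> A i j = 0) \<Longrightarrow> A \<in> matrices I"
  by (auto simp: matrices_def)

lemma mm_assoc: "mm I (mm I A B) C = mm I A (mm I B C)"
proof (intro ext)
  fix i j
  have "mm I (mm I A B) C i j = (\<Sum>l\<in>I. \<Sum>m\<in>I. A i m * B m l * C l j)"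
    by (simp add: mm_def sum_distrib_right)
  also have "\<dots> = (\<Sum>m\<in>I. \<Sum>l\<in>I. A i m * B m l * C l j)" by (rule sum.swap)
  also have "\<dots> = mm I A (mm I B C) i j" by (simp add: mm_def sum_distrib_left mult.assoc)
  finally show "mm I (mm I A B) C i j = mm I A (mm I B C) i j" .
qed

lemma mm_matrices: "A \<in> matrices I \<Longrightarrow> B \<in> matrices I \<Longrightarrow> mm I A B \<in> matrices I"
  by (rule matricesI) (auto simp: matrices_def mm_def intro!: sum.neutral)

lemma idm_matrices: "idm I \<in> matrices I"
  by (auto simp: matrices_def idm_def)

lemma restrict_mat_matrices: "restrict_mat I A \<in> matrices I"
  by (auto simp: matrices_def restrict_mat_def)

lemma mm_idm_left: "finite I \<Longrightarrow> A \<in> matrices I \<Longrightarrow> mm I (idm I) A = A"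
proof (intro ext)
  fix i j assume f: "finite I" and A: "A \<in> matrices I"
  have "mm I (idm I) A i j = (\<Sum>l\<in>I. if l = i then A i j else 0)"
    unfolding mm_def idm_def by (rule sum.cong) auto
  then show "mm I (idm I) A i j = A i j" using f A by (auto simp: matrices_def)
qed

lemma mm_idm_right: "finite I \<Longrightarrow> A \<in> matrices I \<Longrightarrow> mm I A (idm I) = A"
proof (intro ext)
  fix i j assume f: "finite I" and A: "A \<in> matrices I"
  have "mm I A (idm I) i j = (\<Sum>l\<in>I. if l = j then A i j else 0)"
    unfolding mm_def idm_def by (rule sum.cong) auto
  then show "mm I A (idm I) i j = A i j" using f A by (auto simp: matrices_def)
qed

lemma mpow_matrices: "A \<in> matrices I \<Longrightarrow> mpow I A n \<in> matrices I"
  by (induction n) (auto simp: idm_matrices mm_matrices)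

lemma mpow_add: "finite I \<Longrightarrow> A \<in> matrices I \<Longrightarrow> mpow I A (m + n) = mm I (mpow I A m) (mpow I A n)"
  by (induction m) (auto simp: mm_idm_left mpow_matrices mm_assoc)

lemma mm_smat_left: "mm I (smat c A) B = smat c (mm I A B)"
  by (intro ext) (simp add: mm_def smat_def sum_distrib_left mult.assoc)

lemma mm_smat_right: "mm I A (smat c B) = smat c (mm I A B)"
  by (intro ext) (simp add: mm_def smat_def sum_distrib_left mult.left_commute)

lemma mm_add_left: "mm I (A + B) C = mm I A C + mm I B C"
  by (intro ext) (simp add: mm_def sum.distrib distrib_right)

lemma mm_add_right: "mm I C (A + B) = mm I C A + mm I C B"
  by (intro ext) (simp add: mm_def sum.distrib distrib_left)

lemma mm_zero_left: "mm I 0 C = 0"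
  by (intro ext) (simp add: mm_def)

lemma mm_zero_right: "mm I C 0 = 0"
  by (intro ext) (simp add: mm_def)

lemma sum_fun_apply: "(\<Sum>x\<in>F. g x) a = (\<Sum>x\<in>F. g x a)"
  by (induction F rule: infinite_finite_induct) simp_all

lemma mm_sum_right: "mm I C (\<Sum>x\<in>F. g x) = (\<Sum>x\<in>F. mm I C (g x))"
  by (induction F rule: infinite_finite_induct) (simp_all only: sum.infinite sum.empty sum.insert mm_zero_right mm_add_right not_False_eq_True)

lemma tr_diff: "tr I (A - B) = tr I A - tr I B"
  by (simp add: tr_def sum_subtractf)

lemma tr_smat: "tr I (smat c A) = c * tr I A"
  by (simp add: tr_def smat_def sum_distrib_left)

lemma tr_mm_commute: "tr I (mm I A B) = tr I (mm I B A)"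
  unfolding tr_def mm_def by (subst sum.swap) (simp add: mult.commute)

lemma vector_space_smat: "vector_space (smat :: 'k::field \<Rightarrow> ('i \<Rightarrow> 'i \<Rightarrow> 'k) \<Rightarrow> _)"
  by unfold_locales (auto simp: smat_def fun_eq_iff algebra_simps)

lemma vector_space_fun_scale: "vector_space (fun_scale :: 'k::field \<Rightarrow> ('p \<Rightarrow> 'k) \<Rightarrow> ('p \<Rightarrow> 'k))"
  by unfold_locales (auto simp: fun_scale_def fun_eq_iff algebra_simps)

section \<open>Power traces and unipotent matrices\<close>

text \<open>
  The trace of an idempotent is its rank: expand the columns of \<open>E\<close> in a basis of the column space, on
  which \<open>E\<close> acts as the identity.
\<close>

lemma idempotent_trace_zero:
  fixes E :: "'i \<Rightarrow> 'i \<Rightarrow> 'k::field_char_0"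
  assumes fin: "finite I" and E: "E \<in> matrices I" and idem: "mm I E E = E" and tr0: "tr I E = 0"
  shows "E = 0"
proof -
  interpret V: vector_space "fun_scale :: 'k \<Rightarrow> ('i \<Rightarrow> 'k) \<Rightarrow> ('i \<Rightarrow> 'k)" by (rule vector_space_fun_scale)
  define col where "col j = (\<lambda>i. E i j)" for j
  define W where "W = V.span (col ` I)"
  obtain B where B: "B \<subseteq> col ` I" "V.independent B" "V.span B = W"
    using V.maximal_independent_subset[of "col ` I"] unfolding W_def
    by (metis V.span_mono V.span_span subset_antisym)
  have finB: "finite B" using B(1) fin finite_surj by blast
  define r where "r = V.representation B"
  have colW: "col j \<in> V.span B" if "j \<in> I" for j using that B(3) W_def V.span_base by auto
  have col_exp: "col j i = (\<Sum>b\<in>B. r (col j) b * b i)" if "j \<in> I" for i j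
  proof -
    have "(\<Sum>b\<in>B. fun_scale (r (col j) b) b) = col j"
      unfolding r_def by (rule V.sum_representation_eq[OF B(2) colW[OF that] finB]) simp
    then have "col j i = (\<Sum>b\<in>B. fun_scale (r (col j) b) b) i" by simp
    also have "\<dots> = (\<Sum>b\<in>B. r (col j) b * b i)" by (simp add: fun_scale_def sum_fun_apply)
    finally show ?thesis .
  qed
  have Eb: "(\<Sum>i\<in>I. fun_scale (b i) (col i)) = b" if "b \<in> B" for b
  proof -
    from that B(1) obtain j where j: "j \<in> I" "b = col j" by auto
    have "(\<Sum>i\<in>I. fun_scale (b i) (col i)) = (\<lambda>l. mm I E E l j)"
      by (intro ext) (simp add: sum_fun_apply fun_scale_def mm_def j col_def mult.commute)
    then show ?thesis using idem j by (simp add: col_def)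
  qed
  have lin: "r (\<Sum>i\<in>I. fun_scale (c i) (col i)) b = (\<Sum>i\<in>I. c i * r (col i) b)" for c b
    unfolding r_def
    by (subst V.representation_sum[OF B(2)])
       (auto intro!: V.span_scale sum.cong simp: colW V.representation_scale[OF B(2)])
  have "tr I E = (\<Sum>i\<in>I. \<Sum>b\<in>B. r (col i) b * b i)"
    unfolding tr_def by (rule sum.cong[OF refl]) (metis col_def col_exp)
  also have "\<dots> = (\<Sum>b\<in>B. \<Sum>i\<in>I. b i * r (col i) b)"
    by (subst sum.swap) (simp add: mult.commute)
  also have "\<dots> = (\<Sum>b\<in>B. r b b)" by (intro sum.cong refl) (simp add: lin[symmetric] Eb)
  also have "\<dots> = (\<Sum>b\<in>B. 1)" unfolding r_def
    by (intro sum.cong refl) (simp add: V.representation_basis[OF B(2)])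
  finally have "of_nat (card B) = (0::'k)" using tr0 by simp
  then have "B = {}" using finB by simp
  then have "col j = 0" if "j \<in> I" for j using colW[OF that] by auto
  then have "E i j = 0" if "j \<in> I" for i j using that by (metis col_def zero_fun_apply)
  then show ?thesis using E by (auto simp: matrices_def fun_eq_iff)
qed

text \<open>
  A linear relation between the powers of \<open>A\<close> with lowest exponent \<open>m\<close> reads \<open>A ^ m = A ^ m * C\<close>, where \<open>C\<close> is a
  combination of positive powers of \<open>A\<close>.  A high power of \<open>C\<close> is then an idempotent, and it is traceless.
\<close>

lemma nilpotent_if_power_traces_vanish:
  fixes A :: "'i \<Rightarrow> 'i \<Rightarrow> 'k::field_char_0"
  assumes fin: "finite I" and A: "A \<in> matrices I" and tr0: "\<And>n. n \<ge> 1 \<Longrightarrow> tr I (mpow I A n) = 0"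
  shows "\<exists>m. mpow I A m = 0"
proof -
  interpret V: vector_space "smat :: 'k \<Rightarrow> ('i \<Rightarrow> 'i \<Rightarrow> 'k) \<Rightarrow> _" by (rule vector_space_smat)
  note pm = mpow_matrices[OF A]
  define el where "el p = (\<lambda>i j. if (i, j) = p then (1::'k) else 0)" for p :: "'i \<times> 'i"
  have span_el: "X \<in> V.span (el ` (I \<times> I))" if X: "X \<in> matrices I" for X
  proof -
    have "X = (\<Sum>p\<in>I \<times> I. smat (X (fst p) (snd p)) (el p))"
    proof (intro ext)
      fix i j
      have "(\<Sum>p\<in>I \<times> I. smat (X (fst p) (snd p)) (el p)) i j = (\<Sum>p\<in>I \<times> I. if p = (i,j) then X i j else 0)"
        unfolding sum_fun_apply smat_def el_def by (intro sum.cong) auto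
      then show "X i j = (\<Sum>p\<in>I \<times> I. smat (X (fst p) (snd p)) (el p)) i j"
        using X fin by (auto simp: matrices_def)
    qed
    also have "\<dots> \<in> V.span (el ` (I \<times> I))"
      by (rule V.span_sum, rule V.span_scale, rule V.span_base, rule imageI)
    finally show ?thesis .
  qed
  obtain F q i0 where F: "finite F" "i0 \<in> F" "q i0 \<noteq> (0::'k)" "(\<Sum>i\<in>F. smat (q i) (mpow I A i)) = 0"
  proof (cases "inj (mpow I A)")
    case False
    then obtain a b where ab: "a \<noteq> b" "mpow I A a = mpow I A b" by (auto simp: inj_def)
    then show ?thesis
      by (intro that[of "{a, b}" a "\<lambda>i. if i = a then 1 else - 1"]) (auto simp: smat_def fun_eq_iff)
  next
    case True
    have "V.dependent (range (mpow I A))"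
    proof (rule ccontr)
      assume "\<not> V.dependent (range (mpow I A))"
      then have "finite (range (mpow I A))"
        using V.independent_span_bound[of "el ` (I \<times> I)" "range (mpow I A)"] fin span_el pm by auto
      then show False using True finite_imageD infinite_UNIV_nat by blast
    qed
    then obtain T u v where T: "finite T" "T \<subseteq> range (mpow I A)" "v \<in> T" "u v \<noteq> 0" "(\<Sum>v\<in>T. smat (u v) v) = 0"
      unfolding V.dependent_explicit by blast
    define F where "F = mpow I A -` T"
    have img: "mpow I A ` F = T" using T(2) by (auto simp: F_def)
    have "finite F" unfolding F_def using T(1) True by (simp add: finite_vimageI)
    moreover obtain i0 where "i0 \<in> F" "v = mpow I A i0" using img T(3) by auto
    moreover have "(\<Sum>i\<in>F. smat (u (mpow I A i)) (mpow I A i)) = (\<Sum>v\<in>T. smat (u v) v)"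
      using True by (subst img[symmetric], subst sum.reindex) (auto simp: inj_on_def inj_def)
    ultimately show ?thesis using T that[of F i0 "\<lambda>i. u (mpow I A i)"] by auto
  qed
  define m where "m = (LEAST i. i \<in> F \<and> q i \<noteq> 0)"
  have m: "m \<in> F" "q m \<noteq> 0" unfolding m_def by (rule LeastI2[of _ i0]; use F in auto)+
  have mle: "q i = 0" if "i \<in> F" "i < m" for i using that not_less_Least unfolding m_def by blast
  define G where "G = {i\<in>F. m < i}"
  define D where "D = (\<Sum>i\<in>G. smat (- q i / q m) (mpow I A (i - m - 1)))"
  define C where "C = mm I A D"
  have finG: "finite G" using F by (simp add: G_def)
  have AC: "mm I (mpow I A m) C = mpow I A m"
  proof -
    have eq: "(\<Sum>i\<in>F. smat (q i) (mpow I A i)) = smat (q m) (mpow I A m) + (\<Sum>i\<in>G. smat (q i) (mpow I A i))"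
    proof -
      have "(\<Sum>i\<in>F. smat (q i) (mpow I A i)) = (\<Sum>i\<in>insert m G. smat (q i) (mpow I A i))"
        using F(1) m mle
        by (intro sum.mono_neutral_right) (auto simp: G_def smat_def fun_eq_iff, metis linorder_neqE_nat)
      then show ?thesis using finG by (simp add: G_def)
    qed
    have "mm I (mpow I A m) C = (\<Sum>i\<in>G. smat (- q i / q m) (mm I (mpow I A m) (mm I A (mpow I A (i - m - 1)))))"
      unfolding C_def D_def by (simp only: mm_sum_right mm_smat_right)
    also have "\<dots> = (\<Sum>i\<in>G. smat (- q i / q m) (mpow I A i))"
    proof (intro sum.cong refl)
      fix i assume "i \<in> G"
      then have "i = m + Suc (i - m - 1)" by (auto simp: G_def)
      then have "mpow I A i = mm I (mpow I A m) (mpow I A (Suc (i - m - 1)))" by (metis mpow_add[OF fin A])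
      then show "smat (- q i / q m) (mm I (mpow I A m) (mm I A (mpow I A (i - m - 1)))) = smat (- q i / q m) (mpow I A i)"
        by simp
    qed
    also have "\<dots> = smat (- 1 / q m) (\<Sum>i\<in>G. smat (q i) (mpow I A i))"
      unfolding V.scale_sum_right by (intro sum.cong refl) (simp add: smat_def)
    also have "\<dots> = smat (- 1 / q m) (- smat (q m) (mpow I A m))"
      using F(4) unfolding eq by (metis add.inverse_unique)
    also have "\<dots> = mpow I A m" using m(2) by (auto simp: smat_def fun_eq_iff)
    finally show ?thesis .
  qed
  define S0 where "S0 = V.span (range (mpow I A))"
  define S where "S = V.span (mpow I A ` {1..})"
  have D: "D \<in> S0" unfolding D_def S0_def
    by (rule V.span_sum, rule V.span_scale, rule V.span_base, rule rangeI)
  have S0M: "X \<in> matrices I" if "X \<in> S0" for X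
    using that[unfolded S0_def]
    by (rule V.span_induct_alt) (use pm in \<open>auto simp: matrices_def smat_def\<close>)
  have CA: "mm I A X = mm I X A" if "X \<in> S0" for X
    using that[unfolded S0_def]
  proof (rule V.span_induct_alt)
    show "mm I A 0 = mm I 0 A" by (simp add: mm_zero_left mm_zero_right)
    fix c x y assume "x \<in> range (mpow I A)" "mm I A y = mm I y A"
    moreover have "mm I A (mpow I A n) = mm I (mpow I A n) A" for n
      by (induction n) (simp_all add: mm_idm_left mm_idm_right fin A, metis mm_assoc)
    ultimately show "mm I A (smat c x + y) = mm I (smat c x + y) A"
      by (auto simp: mm_smat_left mm_smat_right mm_add_left mm_add_right)
  qed
  have S0S: "mm I X Y \<in> S" if "X \<in> S0" "Y \<in> S" for X Y
  proof -
    have 1: "mm I (mpow I A n) Y \<in> S" for n using that(2)[unfolded S_def]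
    proof (rule V.span_induct_alt)
      show "mm I (mpow I A n) 0 \<in> S" by (simp add: mm_zero_right S_def V.span_zero)
      fix c x y assume x: "x \<in> mpow I A ` {1..}" and y: "mm I (mpow I A n) y \<in> S"
      have "mm I (mpow I A n) x \<in> S"
        using x by (auto simp: mpow_add[OF fin A, symmetric] S_def intro!: V.span_base)
      then show "mm I (mpow I A n) (smat c x + y) \<in> S" using y
        by (auto simp: mm_add_right mm_smat_right S_def intro: V.span_add V.span_scale)
    qed
    show ?thesis using that(1)[unfolded S0_def]
    proof (rule V.span_induct_alt)
      show "mm I 0 Y \<in> S" by (simp add: mm_zero_left S_def V.span_zero)
      fix c x y assume "x \<in> range (mpow I A)" "mm I y Y \<in> S"
      then show "mm I (smat c x + y) Y \<in> S" using 1
        by (auto simp: mm_add_left mm_smat_left S_def intro: V.span_add V.span_scale)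
    qed
  qed
  have SS0: "S \<subseteq> S0" unfolding S_def S0_def by (rule V.span_mono) auto
  have AS: "A \<in> S" using mm_idm_right[OF fin A] unfolding S_def
    by (intro V.span_base image_eqI[of _ _ 1]) auto
  have CS: "C \<in> S" unfolding C_def using S0S[OF D AS] CA[OF D] by simp
  have CM: "C \<in> matrices I" using CS SS0 S0M by auto
  have trS: "tr I X = 0" if "X \<in> S" for X
    using that[unfolded S_def]
  proof (rule V.span_induct_alt)
    show "tr I 0 = 0" by (simp add: tr_def)
    fix c and x y :: "'i \<Rightarrow> 'i \<Rightarrow> 'k" assume "x \<in> mpow I A ` {1..}" "tr I y = 0"
    then show "tr I (smat c x + y) = 0" using tr0 by (auto simp: tr_def smat_def sum.distrib sum_distrib_left[symmetric])
  qed
  have CpS: "mpow I C (Suc n) \<in> S" for n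
    by (induction n) (use CS SS0 S0S mm_idm_right[OF fin CM] in auto)
  have Cpow: "mm I (mpow I A m) (mpow I C n) = mpow I A m" for n
    by (induction n) (auto simp: mm_idm_right[OF fin pm] mm_assoc[symmetric] AC)
  have CD: "mpow I C n = mm I (mpow I D n) (mpow I A n)" for n
  proof (induction n)
    case (Suc n)
    have comm: "mm I A (mpow I D n) = mm I (mpow I D n) A"
    proof (induction n)
      case (Suc n)
      then show ?case using CA[OF D] by (metis mm_assoc mpow.simps(2))
    qed (simp add: mm_idm_left mm_idm_right fin A)
    have "mpow I C (Suc n) = mm I (mm I D A) (mm I (mpow I D n) (mpow I A n))"
      using Suc CA[OF D] by (simp add: C_def)
    also have "\<dots> = mm I D (mm I (mm I A (mpow I D n)) (mpow I A n))" by (simp add: mm_assoc)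
    also have "\<dots> = mm I (mpow I D (Suc n)) (mpow I A (Suc n))" by (simp add: comm mm_assoc)
    finally show ?case .
  qed (simp add: mm_idm_left fin idm_matrices)
  \<comment> \<open>\<open>C\<^sup>m\<close> has a factor \<open>A\<^sup>m\<close>, which absorbs \<open>C\<close>\<close>
  have stable: "mm I (mpow I C m) (mpow I C n) = mpow I C m" for n
    by (simp add: CD[of m] mm_assoc Cpow)
  define E where "E = mpow I C (Suc m)"
  have "mm I E E = E"
  proof -
    have "mm I E E = mm I C (mm I (mpow I C m) (mpow I C (Suc m)))" unfolding E_def by (simp add: mm_assoc)
    also have "\<dots> = E" using stable[of "Suc m"] by (simp add: E_def)
    finally show ?thesis .
  qed
  then have "E = 0"
    using idempotent_trace_zero[OF fin] trS CpS mpow_matrices[OF CM] unfolding E_def by blast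
  then have "mpow I A m = 0" using Cpow[of "Suc m"] by (simp add: E_def mm_zero_right del: mpow.simps)
  then show ?thesis ..
qed

text \<open>
  If all power traces of \<open>U\<close> are those of the identity matrix, then those of \<open>U - 1\<close> vanish, because
  \<open>tr((U - 1)\<^sup>n U\<^sup>j)\<close> is an \<open>n\<close>-th difference of a constant sequence.
\<close>

lemma unipotent_if_power_traces_trivial:
  fixes U :: "'i \<Rightarrow> 'i \<Rightarrow> 'k::field_char_0"
  assumes fin: "finite I" and U: "U \<in> matrices I"
    and trU: "\<And>n. n \<ge> 1 \<Longrightarrow> tr I (mpow I U n) = of_nat (card I)"
  shows "\<exists>m. mpow I (U - idm I) m = 0"
proof (rule nilpotent_if_power_traces_vanish[OF fin])
  let ?A = "U - idm I"
  show AM: "?A \<in> matrices I" using U by (auto simp: matrices_def idm_def)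
  have tr1: "tr I (idm I) = (of_nat (card I) :: 'k)" by (simp add: tr_def idm_def)
  have trU': "tr I (mpow I U n) = of_nat (card I)" for n
    using trU[of n] tr1 by (cases n) auto
  have key: "tr I (mm I (mpow I ?A (Suc n)) (mpow I U j)) = 0" for n j
  proof (induction n arbitrary: j)
    case 0
    have "mm I (mpow I ?A (Suc 0)) (mpow I U j) = mpow I U (Suc j) - mpow I U j"
    proof -
      have "mm I (mpow I ?A (Suc 0)) (mpow I U j) = mm I ?A (mpow I U j)" using mm_idm_right[OF fin AM] by simp
      also have "\<dots> = mm I U (mpow I U j) - mm I (idm I) (mpow I U j)"
        by (auto simp: mm_def fun_eq_iff left_diff_distrib sum_subtractf)
      finally show ?thesis by (simp add: mm_idm_left fin mpow_matrices U)
    qed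
    then show ?case unfolding tr_def using trU'[unfolded tr_def]
      by (simp only: minus_apply sum_subtractf diff_self)
  next
    case (Suc n)
    let ?P = "mpow I ?A (Suc n)"
    have comm: "mm I ?A ?P = mm I ?P ?A"
      by (metis (no_types) AM add.commute fin mm_idm_right mpow.simps mpow_add)
    have "mm I (mpow I ?A (Suc (Suc n))) (mpow I U j) = mm I ?P (mm I ?A (mpow I U j))"
      using comm by (simp add: mm_assoc del: mpow.simps(1))
    also have "mm I ?A (mpow I U j) = mpow I U (Suc j) - mpow I U j"
      using mm_idm_left[OF fin mpow_matrices[OF U]]
      by (auto simp: mm_def fun_eq_iff left_diff_distrib sum_subtractf)
    also have "mm I ?P (mpow I U (Suc j) - mpow I U j) = mm I ?P (mpow I U (Suc j)) - mm I ?P (mpow I U j)"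
      by (auto simp: mm_def fun_eq_iff right_diff_distrib sum_subtractf)
    finally have "tr I (mm I (mpow I ?A (Suc (Suc n))) (mpow I U j)) =
        tr I (mm I ?P (mpow I U (Suc j))) - tr I (mm I ?P (mpow I U j))"
      by (simp only: tr_diff)
    then show ?case using Suc by (simp only: diff_self)
  qed
  fix n :: nat assume "n \<ge> 1"
  then obtain n' where "n = Suc n'" by (cases n) auto
  then show "tr I (mpow I ?A n) = 0"
    using key[of n' 0] mm_idm_right[OF fin mpow_matrices[OF AM]] by (simp del: mpow.simps(2))
qed

lemma matrices_eqI:
  "A \<in> matrices I \<Longrightarrow> B \<in> matrices I \<Longrightarrow> (\<And>i j. i \<in> I \<Longrightarrow> j \<in> I \<Longrightarrow> A i j = B i j) \<Longrightarrow> A = B"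
proof (intro ext)
  fix i j
  assume "A \<in> matrices I" "B \<in> matrices I" and eq: "\<And>i j. i \<in> I \<Longrightarrow> j \<in> I \<Longrightarrow> A i j = B i j"
  then show "A i j = B i j" by (cases "i \<in> I \<and> j \<in> I") (auto simp: matrices_def)
qed

lemma mm_restrict:
  "i \<in> I \<Longrightarrow> j \<in> I \<Longrightarrow> mm I (restrict_mat I A) (restrict_mat I B) i j = (\<Sum>l\<in>I. A i l * B l j)"
  by (simp add: mm_def restrict_mat_def)

lemma restrict_mat_in: "i \<in> I \<Longrightarrow> j \<in> I \<Longrightarrow> restrict_mat I A i j = A i j"
  by (simp add: restrict_mat_def)

text \<open>A one-sided inverse is two-sided, because \<open>1 - B A\<close> is an idempotent of trace zero.\<close>

lemma left_inverse_of_right_inverse: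
  fixes A B :: "'i \<Rightarrow> 'i \<Rightarrow> 'k::field_char_0"
  assumes fin: "finite I" and A: "A \<in> matrices I" and B: "B \<in> matrices I" and AB: "mm I A B = idm I"
  shows "mm I B A = idm I"
proof -
  let ?E = "idm I - mm I B A"
  have BA: "mm I B A \<in> matrices I" by (rule mm_matrices[OF B A])
  have E: "?E \<in> matrices I" using BA idm_matrices[of I] by (auto simp: matrices_def)
  have d: "mm I X (Y - Z) = mm I X Y - mm I X Z" "mm I (Y - Z) X = mm I Y X - mm I Z X"
    for X Y Z :: "'i \<Rightarrow> 'i \<Rightarrow> 'k"
    by (auto simp: mm_def fun_eq_iff algebra_simps sum_subtractf)
  have "mm I (mm I B A) (mm I B A) = mm I B (mm I (mm I A B) A)" by (simp only: mm_assoc)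
  also have "\<dots> = mm I B A" unfolding AB mm_idm_left[OF fin A] ..
  finally have idem: "mm I (mm I B A) (mm I B A) = mm I B A" .
  have "mm I ?E ?E = ?E"
    unfolding d idem mm_idm_left[OF fin BA] mm_idm_right[OF fin BA] mm_idm_left[OF fin idm_matrices] by simp
  moreover have "tr I ?E = 0" unfolding tr_diff tr_mm_commute[of I B A] AB by simp
  ultimately have "?E = 0" by (rule idempotent_trace_zero[OF fin E])
  then show ?thesis by simp
qed

lemma sum_delta_left:
  "finite I \<Longrightarrow> i \<in> I \<Longrightarrow> (\<Sum>l\<in>I. (if i = l then 1 else 0) * f l) = (f i :: 'a::semiring_1)"
  "finite I \<Longrightarrow> i \<in> I \<Longrightarrow> (\<Sum>l\<in>I. (if l = i then 1 else 0) * f l) = (f i :: 'a::semiring_1)"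
  "finite I \<Longrightarrow> i \<in> I \<Longrightarrow> (\<Sum>l\<in>I. f l * (if i = l then 1 else 0)) = (f i :: 'a::semiring_1)"
  "finite I \<Longrightarrow> i \<in> I \<Longrightarrow> (\<Sum>l\<in>I. f l * (if l = i then 1 else 0)) = (f i :: 'a::semiring_1)"
  by (simp_all add: if_distrib[of "\<lambda>x. x * _"] if_distrib[of "\<lambda>x. _ * x"] cong: if_cong)

lemma sum_times_swap:
  "(\<Sum>p\<in>A \<times> B. f (fst p) (snd p)) = (\<Sum>p\<in>B \<times> A. f (snd p) (fst p))"
  by (rule sum.reindex_bij_witness[of _ "\<lambda>p. (snd p, fst p)" "\<lambda>p. (snd p, fst p)"]) auto

lemma sum_times: "(\<Sum>p\<in>A \<times> B. f p) = (\<Sum>a\<in>A. \<Sum>b\<in>B. f (a, b))"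
  by (simp add: sum.cartesian_product)

section \<open>Polynomial functions on an irreducible variety\<close>

lemma polynomial_functions_sum:
  "(\<And>l. l \<in> F \<Longrightarrow> f l \<in> polynomial_functions n) \<Longrightarrow> (\<lambda>x. \<Sum>l\<in>F. f l x) \<in> polynomial_functions n"
  by (induction F rule: infinite_finite_induct)
     (auto intro: polynomial_functions.const polynomial_functions.add)

lemma polynomial_functions_prod:
  "(\<And>l. l \<in> F \<Longrightarrow> f l \<in> polynomial_functions n) \<Longrightarrow> (\<lambda>x. \<Prod>l\<in>F. f l x) \<in> polynomial_functions n"
  by (induction F rule: infinite_finite_induct)
     (auto intro: polynomial_functions.const polynomial_functions.mult)

lemma polynomial_functions_diff:
  assumes "f \<in> polynomial_functions n" "g \<in> polynomial_functions n"
  shows "(\<lambda>x. f x - g x) \<in> polynomial_functions n"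
  using polynomial_functions.add[OF assms(1) polynomial_functions.mult[OF polynomial_functions.const[of "- 1"] assms(2)]]
  by simp

lemma polynomial_functions_power:
  "f \<in> polynomial_functions n \<Longrightarrow> (\<lambda>x. f x ^ m) \<in> polynomial_functions n"
  by (induction m) (auto intro: polynomial_functions.const polynomial_functions.mult)

lemma irreducible_no_zero_divisors:
  assumes X: "irreducible_closed n X"
    and f: "f \<in> polynomial_functions n" and g: "g \<in> polynomial_functions n"
    and fg: "\<And>x. x \<in> X \<Longrightarrow> f x * g x = 0"
  shows "(\<forall>x\<in>X. f x = 0) \<or> (\<forall>x\<in>X. g x = 0)"
proof -
  obtain F where F: "F \<subseteq> polynomial_functions n" "X = {x \<in> affine_space n. \<forall>f\<in>F. f x = 0}"
    using X by (auto simp: irreducible_closed_def zariski_closed_def)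
  have "zariski_closed n {x \<in> X. h x = 0}" if "h \<in> polynomial_functions n" for h
    unfolding zariski_closed_def by (rule exI[of _ "insert h F"]) (use F that in auto)
  moreover have "X = {x \<in> X. f x = 0} \<union> {x \<in> X. g x = 0}" using fg by auto
  ultimately have "X = {x \<in> X. f x = 0} \<or> X = {x \<in> X. g x = 0}"
    using X f g unfolding irreducible_closed_def by blast
  then show ?thesis by auto
qed

lemma det_polynomial:
  assumes "\<And>i j. i < N \<Longrightarrow> j < N \<Longrightarrow> A i j \<in> polynomial_functions n"
  shows "(\<lambda>x. det (Matrix.mat N N (\<lambda>(i, j). A i j x))) \<in> polynomial_functions n"
proof -
  have pN: "p i < N" if "p permutes {0..<N}" "i < N" for p i
    using permutes_in_image[OF that(1), of i] that(2) by simp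
  have "(\<lambda>x. \<Sum>p\<in>{p. p permutes {0..<N}}. signof p * (\<Prod>i = 0..<N. A i (p i) x)) \<in> polynomial_functions n"
    by (intro polynomial_functions_sum polynomial_functions.mult polynomial_functions.const polynomial_functions_prod assms)
       (simp_all add: pN)
  moreover have "det (Matrix.mat N N (\<lambda>(i, j). A i j x)) =
      (\<Sum>p\<in>{p. p permutes {0..<N}}. signof p * (\<Prod>i = 0..<N. A i (p i) x))" for x
  proof -
    have "Matrix.mat N N (\<lambda>(i, j). A i j x) $$ (i, p i) = A i (p i) x" if "p permutes {0..<N}" "i \<in> {0..<N}" for p i
      using permutes_in_image[OF that(1), of i] that(2) by simp
    then show ?thesis by (subst det_def'[of _ N]) (auto intro!: sum.cong prod.cong)
  qed
  ultimately show ?thesis by (simp only:)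
qed

text \<open>
  \<open>d\<close> plays the role of the determinant of \<open>A\<close> and \<open>B\<close> that of its adjugate, for an arbitrary finite index set.
\<close>

definition cramer_inverse ::
    "nat \<Rightarrow> 'i set \<Rightarrow> ('i \<Rightarrow> 'i \<Rightarrow> (nat \<Rightarrow> 'k::field) \<Rightarrow> 'k) \<Rightarrow> ((nat \<Rightarrow> 'k) \<Rightarrow> 'k) \<Rightarrow>
     ('i \<Rightarrow> 'i \<Rightarrow> (nat \<Rightarrow> 'k) \<Rightarrow> 'k) \<Rightarrow> bool" where
  "cramer_inverse n I A d B \<longleftrightarrow>
     d \<in> polynomial_functions n \<and> (\<forall>i\<in>I. \<forall>j\<in>I. B i j \<in> polynomial_functions n) \<and>
     (\<forall>x. \<forall>i\<in>I. \<forall>j\<in>I. (\<Sum>l\<in>I. A i l x * B l j x) = (if i = j then d x else 0) \<and>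
        (\<Sum>l\<in>I. B i l x * A l j x) = (if i = j then d x else 0)) \<and>
     (\<forall>x C. (\<forall>i\<in>I. \<forall>j\<in>I. (\<Sum>l\<in>I. A i l x * C l j) = (if i = j then 1 else 0)) \<longrightarrow> d x \<noteq> 0)"

lemma cramer_inverseD:
  assumes "cramer_inverse n I A d B"
  shows "d \<in> polynomial_functions n"
    and "i \<in> I \<Longrightarrow> j \<in> I \<Longrightarrow> B i j \<in> polynomial_functions n"
    and "i \<in> I \<Longrightarrow> j \<in> I \<Longrightarrow> (\<Sum>l\<in>I. A i l x * B l j x) = (if i = j then d x else 0)"
    and "i \<in> I \<Longrightarrow> j \<in> I \<Longrightarrow> (\<Sum>l\<in>I. B i l x * A l j x) = (if i = j then d x else 0)"
    and "(\<And>i j. i \<in> I \<Longrightarrow> j \<in> I \<Longrightarrow> (\<Sum>l\<in>I. A i l x * C l j) = (if i = j then 1 else 0)) \<Longrightarrow> d x \<noteq> 0"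
  using assms unfolding cramer_inverse_def by blast+

text \<open>
  Cramer's rule: a square matrix of polynomial functions has an inverse with polynomial entries up to the common
  denominator \<open>d = det A\<close>, which does not vanish at a point where the matrix is invertible.
\<close>

lemma cramer_inverse_exists:
  fixes A :: "'i \<Rightarrow> 'i \<Rightarrow> (nat \<Rightarrow> 'k::field) \<Rightarrow> 'k"
  assumes fin: "finite I" and A: "\<And>i j. i \<in> I \<Longrightarrow> j \<in> I \<Longrightarrow> A i j \<in> polynomial_functions n"
  shows "\<exists>d B. cramer_inverse n I A d B"
proof -
  define N where "N = card I"
  obtain e where e: "bij_betw e {0..<N} I" using ex_bij_betw_nat_finite[OF fin] by (auto simp: N_def)
  define e' where "e' = the_inv_into {0..<N} e"
  have e'I: "e' i < N" "e (e' i) = i" if "i \<in> I" for i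
    using bij_betw_the_inv_into[OF e] f_the_inv_into_f_bij_betw[OF e, of i] that
    by (auto simp: e'_def bij_betw_def)
  have e'e: "e' (e a) = a" if "a < N" for a
    using the_inv_into_f_f[of e "{0..<N}" a] e that by (auto simp: e'_def bij_betw_def)
  have eI: "e a \<in> I" if "a < N" for a using e that by (auto simp: bij_betw_def)
  have e'inj: "e' i = e' j \<longleftrightarrow> i = j" if "i \<in> I" "j \<in> I" for i j using e'I that by metis
  have reindex: "(\<Sum>l\<in>I. f l) = (\<Sum>a = 0..<N. f (e a))" for f :: "'i \<Rightarrow> 'k"
    by (rule sum.reindex_bij_betw[OF e, symmetric])
  define Am where "Am x = Matrix.mat N N (\<lambda>(a, b). A (e a) (e b) x)" for x
  define d where "d x = det (Am x)" for x
  define B where "B i j x = adj_mat (Am x) $$ (e' i, e' j)" for i j x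
  have Am: "Am x \<in> carrier_mat N N" for x by (simp add: Am_def)
  note adj = adj_mat[OF Am]
  have d: "d \<in> polynomial_functions n"
    unfolding d_def Am_def by (rule det_polynomial) (intro A eI)
  have Bpoly: "B i j \<in> polynomial_functions n" if ij: "i \<in> I" "j \<in> I" for i j
  proof -
    have "mat_delete (Am x) (e' j) (e' i) = Matrix.mat (N - 1) (N - 1) (\<lambda>(a, b).
        A (e (if a < e' j then a else Suc a)) (e (if b < e' i then b else Suc b)) x)" for x
      by (rule eq_matI) (auto simp: mat_delete_def Am_def)
    then have Bx: "B i j x = (- 1) ^ (e' j + e' i) * det (Matrix.mat (N - 1) (N - 1) (\<lambda>(a, b).
        A (e (if a < e' j then a else Suc a)) (e (if b < e' i then b else Suc b)) x))" for x
      using e'I ij by (simp add: B_def adj_mat_def cofactor_def Am_def)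
    have "(\<lambda>x. (- 1) ^ (e' j + e' i) * det (Matrix.mat (N - 1) (N - 1) (\<lambda>(a, b).
        A (e (if a < e' j then a else Suc a)) (e (if b < e' i then b else Suc b)) x))) \<in> polynomial_functions n"
      by (intro polynomial_functions.mult polynomial_functions.const det_polynomial A eI) auto
    then show ?thesis unfolding Bx[symmetric] .
  qed
  have AB: "(\<Sum>l\<in>I. A i l x * B l j x) = (if i = j then d x else 0)" if ij: "i \<in> I" "j \<in> I" for i j x
  proof -
    have "(\<Sum>l\<in>I. A i l x * B l j x) = (Am x * adj_mat (Am x)) $$ (e' i, e' j)"
      using e'I ij adj(1)[of x] by (simp add: reindex scalar_prod_def B_def Am_def e'e)
    also have "\<dots> = (if i = j then d x else 0)"
      unfolding adj(2) d_def using e'I ij by (simp add: e'inj)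
    finally show ?thesis .
  qed
  have BA: "(\<Sum>l\<in>I. B i l x * A l j x) = (if i = j then d x else 0)" if ij: "i \<in> I" "j \<in> I" for i j x
  proof -
    have "(\<Sum>l\<in>I. B i l x * A l j x) = (adj_mat (Am x) * Am x) $$ (e' i, e' j)"
      using e'I ij adj(1)[of x] by (simp add: reindex scalar_prod_def B_def Am_def e'e)
    also have "\<dots> = (if i = j then d x else 0)"
      unfolding adj(3) d_def using e'I ij by (simp add: e'inj)
    finally show ?thesis .
  qed
  have nz: "d x \<noteq> 0"
    if C: "\<And>i j. i \<in> I \<Longrightarrow> j \<in> I \<Longrightarrow> (\<Sum>l\<in>I. A i l x * C l j) = (if i = j then 1 else 0)" for x C
  proof -
    define Cm where "Cm = Matrix.mat N N (\<lambda>(a, b). C (e a) (e b))"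
    have Cm: "Cm \<in> carrier_mat N N" by (simp add: Cm_def)
    have "Am x * Cm = 1\<^sub>m N"
    proof (rule eq_matI)
      fix a b assume "a < dim_row (1\<^sub>m N)" "b < dim_col (1\<^sub>m N)"
      then have ab: "a < N" "b < N" by auto
      then have "(Am x * Cm) $$ (a, b) = (\<Sum>l\<in>I. A (e a) l x * C l (e b))"
        by (simp add: reindex scalar_prod_def Am_def Cm_def)
      also have "\<dots> = (1\<^sub>m N) $$ (a, b)" using C eI ab e'e by (metis index_one_mat(1))
      finally show "(Am x * Cm) $$ (a, b) = (1\<^sub>m N) $$ (a, b)" .
    qed (simp_all add: Am_def Cm_def)
    then have "det (Am x) * det Cm = 1" using det_mult[OF Am Cm, of x] by simp
    then show ?thesis by (auto simp: d_def)
  qed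
  have "cramer_inverse n I A d B"
    unfolding cramer_inverse_def using d Bpoly AB BA nz by (intro conjI allI ballI impI) blast+
  then show ?thesis by blast
qed

section \<open>Sweedler calculus for forms on a coalgebra\<close>

text \<open>The linear extension of \<open>f\<close> to the free vector space.\<close>

definition formal_sum :: "('k::field \<Rightarrow> 'v::ab_group_add \<Rightarrow> 'v) \<Rightarrow> ('i \<Rightarrow> 'v) \<Rightarrow> ('i \<Rightarrow>\<^sub>0 'k) \<Rightarrow> 'v" where
  "formal_sum t f u = (\<Sum>p\<in>Poly_Mapping.keys u. t (Poly_Mapping.lookup u p) (f p))"

lemma lookup_free_scale: "Poly_Mapping.lookup (free_scale c u) p = c * Poly_Mapping.lookup u p"
  by (simp add: free_scale_def map.rep_eq when_def)

lemma vector_space_free: "vector_space (free_scale :: 'k::field \<Rightarrow> ('i \<Rightarrow>\<^sub>0 'k) \<Rightarrow> _)"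
  by unfold_locales (auto intro!: poly_mapping_eqI simp: lookup_free_scale lookup_add algebra_simps)

lemma vector_space_mult: "vector_space ((*) :: 'k::field \<Rightarrow> 'k \<Rightarrow> 'k)"
  by unfold_locales (auto simp: algebra_simps)

lemma vlinear_iff:
  "Vector_Spaces.linear s t f \<longleftrightarrow> vector_space s \<and> vector_space t \<and>
     (\<forall>x y. f (x + y) = f x + f y) \<and> (\<forall>c x. f (s c x) = t c (f x))"
  by (auto simp: Vector_Spaces.linear_def module_hom_def module_hom_axioms_def module_iff_vector_space)

context vector_space
begin

lemma formal_sum_superset:
  assumes "finite A" "Poly_Mapping.keys u \<subseteq> A"
  shows "formal_sum scale f u = (\<Sum>p\<in>A. scale (Poly_Mapping.lookup u p) (f p))"
  unfolding formal_sum_def using assms by (intro sum.mono_neutral_left) (auto simp: in_keys_iff)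

lemma formal_sum_add: "formal_sum scale f (u + v) = formal_sum scale f u + formal_sum scale f v"
proof -
  let ?A = "Poly_Mapping.keys u \<union> Poly_Mapping.keys v"
  have "formal_sum scale f w = (\<Sum>p\<in>?A. scale (Poly_Mapping.lookup w p) (f p))" if "Poly_Mapping.keys w \<subseteq> ?A" for w
    by (rule formal_sum_superset) (use that in auto)
  then show ?thesis using keys_add[of u v]
    by (simp add: lookup_add scale_left_distrib sum.distrib)
qed

lemma formal_sum_scale: "formal_sum scale f (free_scale c u) = scale c (formal_sum scale f u)"
proof -
  have "formal_sum scale f (free_scale c u) =
      (\<Sum>p\<in>Poly_Mapping.keys u. scale (Poly_Mapping.lookup (free_scale c u) p) (f p))"
    by (rule formal_sum_superset) (auto simp: in_keys_iff lookup_free_scale)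
  then show ?thesis by (simp add: formal_sum_def lookup_free_scale scale_sum_right)
qed

lemma formal_sum_single: "formal_sum scale f (Poly_Mapping.single p c) = scale c (f p)"
  by (subst formal_sum_superset[of "{p}"]) (auto simp: in_keys_iff lookup_single when_def)

lemma formal_sum_zero: "formal_sum scale f 0 = 0"
  by (simp add: formal_sum_def)

lemma formal_sum_diff: "formal_sum scale f (u - v) = formal_sum scale f u - formal_sum scale f v"
  using formal_sum_add[of f "u - v" v] by (simp add: algebra_simps)

lemma formal_sum_sum: "formal_sum scale f (\<Sum>x\<in>F. g x) = (\<Sum>x\<in>F. formal_sum scale f (g x))"
  by (induction F rule: infinite_finite_induct) (simp_all add: formal_sum_zero formal_sum_add)

lemma formal_sum_null:
  fixes u :: "'i \<Rightarrow>\<^sub>0 'a"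
  assumes f: "\<And>p. p \<in> P \<Longrightarrow> Vector_Spaces.linear s scale (\<lambda>a. f (p a))"
    and u: "u \<in> Modules.module.span free_scale (multilinear_relations s P)"
  shows "formal_sum scale f u = 0"
proof -
  interpret F: vector_space "free_scale :: 'a \<Rightarrow> ('i \<Rightarrow>\<^sub>0 'a) \<Rightarrow> _" by (rule vector_space_free)
  show ?thesis using u
  proof (rule F.span_induct_alt)
    fix c x y assume x: "x \<in> multilinear_relations s P" and y: "formal_sum scale f y = 0"
    have "formal_sum scale f x = 0"
      using x unfolding multilinear_relations_def
    proof
      assume "x \<in> {Poly_Mapping.single (p (a + b)) 1 - Poly_Mapping.single (p a) 1 - Poly_Mapping.single (p b) 1
        | p a b. p \<in> P}"
      then obtain p a b where "p \<in> P"
        "x = Poly_Mapping.single (p (a + b)) 1 - Poly_Mapping.single (p a) 1 - Poly_Mapping.single (p b) 1"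
        by auto
      then show ?thesis using f[of p] by (simp add: formal_sum_diff formal_sum_single vlinear_iff)
    next
      assume "x \<in> {Poly_Mapping.single (p (s c a)) 1 - Poly_Mapping.single (p a) c | p c a. p \<in> P}"
      then obtain p a c where "p \<in> P" "x = Poly_Mapping.single (p (s c a)) 1 - Poly_Mapping.single (p a) c"
        by auto
      then show ?thesis using f[of p] by (simp add: formal_sum_diff formal_sum_single vlinear_iff)
    qed
    then show "formal_sum scale f (free_scale c x + y) = 0"
      using y by (simp add: formal_sum_add formal_sum_scale)
  qed (rule formal_sum_zero)
qed

end

definition trilinear_form :: "('k::field, 'b::ab_group_add) hopf \<Rightarrow> ('b \<Rightarrow> 'b \<Rightarrow> 'b \<Rightarrow> 'k) \<Rightarrow> bool" where
  "trilinear_form H g \<longleftrightarrow>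
     (\<forall>y z. Vector_Spaces.linear (scal H) (*) (\<lambda>x. g x y z)) \<and>
     (\<forall>x z. Vector_Spaces.linear (scal H) (*) (\<lambda>y. g x y z)) \<and>
     (\<forall>x y. Vector_Spaces.linear (scal H) (*) (\<lambda>z. g x y z))"

text \<open>
  The representative of \<open>\<Delta>(a)\<close> that the Sweedler sums are evaluated on.  Since it is the same for all forms, Sweedler
  sums over different elements commute with each other and are linear in the form.
\<close>

definition comul_rep :: "('k::field, 'b) hopf \<Rightarrow> 'b \<Rightarrow> ('b \<times> 'b \<Rightarrow>\<^sub>0 'k)" where
  "comul_rep H a = (SOME u. u \<in> comul H a)"

lemma sweedler2_sum:
  "sweedler2 H t f a =
     (\<Sum>p\<in>Poly_Mapping.keys (comul_rep H a). t (Poly_Mapping.lookup (comul_rep H a) p) (f (fst p) (snd p)))"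
  by (simp add: sweedler2_def tensor2_lift_def eval_formal_def comul_rep_def case_prod_beta)

lemma sweedler2_formal_sum:
  "sweedler2 H t f a = formal_sum t (\<lambda>p. f (fst p) (snd p)) (comul_rep H a)"
  by (simp add: sweedler2_sum formal_sum_def)

lemma sweedler2_swap:
  "sweedler2 H (*) (\<lambda>x y. sweedler2 H' (*) (\<lambda>z w. f x y z w) b) a =
   sweedler2 H' (*) (\<lambda>z w. sweedler2 H (*) (\<lambda>x y. f x y z w) a) b"
  unfolding sweedler2_sum sum_distrib_left by (subst sum.swap) (simp add: mult.left_commute)

lemma sweedler2_mult_left: "sweedler2 H (*) (\<lambda>x y. c * f x y) a = c * sweedler2 H (*) f a"
  by (simp add: sweedler2_sum sum_distrib_left mult.left_commute)

lemma sweedler2_mult_right: "sweedler2 H (*) (\<lambda>x y. f x y * c) a = sweedler2 H (*) f a * c"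
  by (simp add: sweedler2_sum sum_distrib_right mult.assoc)

lemma sweedler2_sum_form:
  "sweedler2 H (*) (\<lambda>x y. \<Sum>l\<in>F. f l x y) a = (\<Sum>l\<in>F. sweedler2 H (*) (f l) a)"
  unfolding sweedler2_sum sum_distrib_left by (rule sum.swap)

lemma sweedler2_image:
  assumes "Vector_Spaces.linear s t \<phi>"
  shows "\<phi> (sweedler2 H s f a) = sweedler2 H t (\<lambda>x y. \<phi> (f x y)) a"
proof -
  interpret Vector_Spaces.linear s t \<phi> by (rule assms)
  show ?thesis by (simp add: sweedler2_sum sum scale)
qed

abbreviation linear_form :: "('k::field, 'b::ab_group_add) hopf \<Rightarrow> ('b \<Rightarrow> 'k) \<Rightarrow> bool" where
  "linear_form H \<equiv> Vector_Spaces.linear (scal H) (*)"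

abbreviation linear_operator :: "('k::field, 'b::ab_group_add) hopf \<Rightarrow> ('b \<Rightarrow> 'b) \<Rightarrow> bool" where
  "linear_operator H \<equiv> Vector_Spaces.linear (scal H) (scal H)"

lemma bilinear_form_iff:
  "bilinear_form H f \<longleftrightarrow> (\<forall>y. linear_form H (\<lambda>x. f x y)) \<and> (\<forall>x. linear_form H (\<lambda>y. f x y))"
  by (simp add: bilinear_form_def bilinear_map_def)

lemma bilinear_formD:
  assumes "bilinear_form H f"
  shows "linear_form H (\<lambda>x. f x y)" "linear_form H (\<lambda>y. f x y)" "linear_form H (f x)"
  using assms by (simp_all add: bilinear_form_iff)

context coalgebra
begin

sublocale V: vector_space "scal H" by (rule vector_space)

lemma null2_vector: "Modules.module.subspace free_scale (null2 (scal H))"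
proof -
  interpret F: vector_space "free_scale :: 'k \<Rightarrow> ('b \<times> 'b \<Rightarrow>\<^sub>0 'k) \<Rightarrow> _" by (rule vector_space_free)
  show ?thesis unfolding null2_def by (rule F.subspace_span)
qed

lemma comul_diff: "u \<in> comul H a \<Longrightarrow> v \<in> comul H a \<Longrightarrow> u - v \<in> null2 (scal H)"
proof -
  interpret F: vector_space "free_scale :: 'k \<Rightarrow> ('b \<times> 'b \<Rightarrow>\<^sub>0 'k) \<Rightarrow> _" by (rule vector_space_free)
  assume uv: "u \<in> comul H a" "v \<in> comul H a"
  obtain w where "comul H a = tensor2_class (scal H) w"
    using comul_tensor[of a] by (auto simp: tensor2_space_def)
  then have "u - w \<in> null2 (scal H)" "v - w \<in> null2 (scal H)" using uv by (auto simp: tensor2_class_def)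
  then have "(u - w) - (v - w) \<in> null2 (scal H)" using null2_vector by (rule F.subspace_diff[rotated])
  then show ?thesis by simp
qed

lemma comul_rep_in: "comul_rep H a \<in> comul H a"
proof -
  obtain w where w: "comul H a = tensor2_class (scal H) w"
    using comul_tensor[of a] by (auto simp: tensor2_space_def)
  interpret F: vector_space "free_scale :: 'k \<Rightarrow> ('b \<times> 'b \<Rightarrow>\<^sub>0 'k) \<Rightarrow> _" by (rule vector_space_free)
  have "w \<in> comul H a" using F.subspace_0[OF null2_vector] by (simp add: w tensor2_class_def)
  then show ?thesis unfolding comul_rep_def by (rule someI)
qed

text \<open>Two representatives differ by multilinearity relations, and bilinear maps annihilate these.\<close>

lemma sweedler2_rep:
  assumes f: "bilinear_map (scal H) t f" and u: "u \<in> comul H a"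
  shows "sweedler2 H t f a = formal_sum t (\<lambda>p. f (fst p) (snd p)) u"
proof -
  have "vector_space t" using f by (auto simp: bilinear_map_def vlinear_iff)
  then interpret T: vector_space t .
  have "formal_sum t (\<lambda>p. f (fst p) (snd p)) (comul_rep H a - u) = 0"
  proof (rule T.formal_sum_null)
    show "comul_rep H a - u \<in> Modules.module.span free_scale (multilinear_relations (scal H) slots2)"
      using comul_diff[OF comul_rep_in u] by (simp add: null2_def)
  qed (use f in \<open>auto simp: slots2_def bilinear_map_def\<close>)
  then show ?thesis by (simp add: sweedler2_formal_sum T.formal_sum_diff)
qed

lemma sweedler2_linear:
  assumes f: "bilinear_map (scal H) t f"
  shows "Vector_Spaces.linear (scal H) t (sweedler2 H t f)"
proof -
  have "vector_space t" using f by (auto simp: bilinear_map_def vlinear_iff)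
  then interpret T: vector_space t .
  show ?thesis unfolding vlinear_iff
    using sweedler2_rep[OF f comul_add[OF comul_rep_in comul_rep_in]]
      sweedler2_rep[OF f comul_scale[OF comul_rep_in]]
    by (auto simp: sweedler2_formal_sum T.formal_sum_add T.formal_sum_scale vector_space T.vector_space_axioms)
qed

lemma linear_sweedler2: "bilinear_form H f \<Longrightarrow> linear_form H (\<lambda>a. sweedler2 H (*) f a)"
  unfolding bilinear_form_def by (drule sweedler2_linear) simp

lemma linear_mult_left: "linear_form H f \<Longrightarrow> linear_form H (\<lambda>x. c * f x)"
  by (auto simp: vlinear_iff algebra_simps)

lemma linear_mult_right: "linear_form H f \<Longrightarrow> linear_form H (\<lambda>x. f x * c)"
  by (auto simp: vlinear_iff algebra_simps)

lemma linear_sum_form: "(\<And>l. l \<in> F \<Longrightarrow> linear_form H (f l)) \<Longrightarrow> linear_form H (\<lambda>x. \<Sum>l\<in>F. f l x)"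
  by (auto simp: vlinear_iff sum.distrib sum_distrib_left vector_space vector_space_mult)

lemma linear_sweedler2_param:
  "(\<And>x y. linear_form H (f x y)) \<Longrightarrow> linear_form H (\<lambda>z. sweedler2 H (*) (\<lambda>x y. f x y z) a)"
  unfolding sweedler2_sum by (intro linear_sum_form linear_mult_left)

lemma linear_form_scal:
  "linear_form H f \<Longrightarrow> f (scal H c x) = c * f x" "linear_form H f \<Longrightarrow> f (x + y) = f x + f y"
  by (auto simp: vlinear_iff)

lemma linear_form_sum: "linear_form H f \<Longrightarrow> f (\<Sum>l\<in>F. g l) = (\<Sum>l\<in>F. f (g l))"
  by (rule module_hom.sum[of "scal H" "(*)"]) (simp add: Vector_Spaces.linear_def)

text \<open>Reduces Sweedler sums with values in the coalgebra to scalar-valued ones.\<close>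

lemma linear_forms_separate:
  assumes "\<And>\<phi>. linear_form H \<phi> \<Longrightarrow> \<phi> x = \<phi> y"
  shows "x = y"
proof (rule ccontr)
  assume "x \<noteq> y"
  interpret P: vector_space_pair "scal H" "(*) :: 'k \<Rightarrow> _"
    by (intro vector_space_pair.intro vector_space vector_space_mult)
  \<comment> \<open>a linear form with value 1 at \<open>x - y\<close>\<close>
  have "V.independent {x - y}" using \<open>x \<noteq> y\<close> by (simp add: V.dependent_single)
  then obtain g where g: "linear_form H g" "g (x - y) = 1"
    using P.linear_independent_extend[of "{x - y}" "\<lambda>_. 1"] by auto
  then have "g (x - y) = g x - g y" using linear_form_scal(2)[OF g(1), of "x - y" y] by simp
  then show False using g assms[OF g(1)] by simp
qed

text \<open>Trilinear forms annihilate the relations modulo which the comultiplication is coassociative.\<close>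

lemma sweedler2_coassoc:
  assumes g: "trilinear_form H g"
  shows "sweedler2 H (*) (\<lambda>x z. sweedler2 H (*) (\<lambda>p q. g p q z) x) a =
    sweedler2 H (*) (\<lambda>x y. sweedler2 H (*) (\<lambda>p q. g x p q) y) a"
proof -
  let ?d = "comul_rep H" and ?u = "comul_rep H a"
  let ?g = "\<lambda>(x, y, z). g x y z"
  interpret T: vector_space "(*) :: 'k \<Rightarrow> _" by (rule vector_space_mult)
  have "formal_sum (*) ?g (comul_left ?d ?u - comul_right ?d ?u) = 0"
  proof (rule T.formal_sum_null)
    show "comul_left ?d ?u - comul_right ?d ?u \<in> Modules.module.span free_scale (multilinear_relations (scal H) slots3)"
      using coassoc[of ?d ?u a] comul_rep_in by (simp add: null3_def)
  qed (use g in \<open>auto simp: slots3_def trilinear_form_def\<close>)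
  then have eq: "formal_sum (*) ?g (comul_left ?d ?u) = formal_sum (*) ?g (comul_right ?d ?u)"
    unfolding T.formal_sum_diff by (simp only: right_minus_eq)
  have "formal_sum (*) ?g (comul_left ?d ?u) = sweedler2 H (*) (\<lambda>x z. sweedler2 H (*) (\<lambda>p q. g p q z) x) a"
    unfolding comul_left_def sweedler2_sum case_prod_beta T.formal_sum_sum T.formal_sum_single sum_distrib_left
    by (intro sum.cong refl) (simp only: mult.assoc fst_conv snd_conv prod.collapse)
  moreover have "formal_sum (*) ?g (comul_right ?d ?u) = sweedler2 H (*) (\<lambda>x y. sweedler2 H (*) (\<lambda>p q. g x p q) y) a"
    unfolding comul_right_def sweedler2_sum case_prod_beta T.formal_sum_sum T.formal_sum_single sum_distrib_left
    by (intro sum.cong refl) (simp only: mult.assoc fst_conv snd_conv prod.collapse)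
  ultimately show ?thesis using eq by simp
qed

lemma sweedler2_counit_left:
  assumes "linear_form H \<phi>"
  shows "sweedler2 H (*) (\<lambda>x y. counit H x * \<phi> y) a = \<phi> a"
  using arg_cong[OF counit_left[of a], of \<phi>] unfolding sweedler2_image[OF assms]
  by (simp add: linear_form_scal[OF assms])

lemma sweedler2_counit_right:
  assumes "linear_form H \<phi>"
  shows "sweedler2 H (*) (\<lambda>x y. \<phi> x * counit H y) a = \<phi> a"
  using arg_cong[OF counit_right[of a], of \<phi>] unfolding sweedler2_image[OF assms]
  by (simp add: linear_form_scal[OF assms] mult.commute)

text \<open>
  Coassociativity in both arguments; \<open>L\<close> collects the Sweedler sums over the second one.
\<close>

lemma convolution_assoc:
  assumes f: "bilinear_form H f" and g: "bilinear_form H g" and h: "bilinear_form H h"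
  shows "convolution H (convolution H f g) h = convolution H f (convolution H g h)"
proof (intro ext)
  fix a b
  note l = bilinear_formD[OF f] bilinear_formD[OF g] bilinear_formD[OF h]
  let ?sw = "sweedler2 H (*)"
  define L where "L a1 a2 a3 = ?sw (\<lambda>y b3. ?sw (\<lambda>b1 b2. f a1 b1 * g a2 b2 * h a3 b3) y) b" for a1 a2 a3
  have L: "L a1 a2 a3 = ?sw (\<lambda>b1 y. ?sw (\<lambda>b2 b3. f a1 b1 * g a2 b2 * h a3 b3) y) b" for a1 a2 a3
    unfolding L_def
    by (rule sweedler2_coassoc) (auto simp: trilinear_form_def intro!: linear_mult_left linear_mult_right l)
  have "convolution H (convolution H f g) h a b = ?sw (\<lambda>x a3. ?sw (\<lambda>y b3.
      ?sw (\<lambda>a1 a2. ?sw (\<lambda>b1 b2. f a1 b1 * g a2 b2 * h a3 b3) y) x) b) a"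
    by (simp add: convolution_def sweedler2_mult_right)
  also have "\<dots> = ?sw (\<lambda>x a3. ?sw (\<lambda>a1 a2. L a1 a2 a3) x) a"
    unfolding L_def by (subst (2) sweedler2_swap) simp
  also have "\<dots> = ?sw (\<lambda>a1 x. ?sw (\<lambda>a2 a3. L a1 a2 a3) x) a"
    by (rule sweedler2_coassoc)
       (auto simp: trilinear_form_def L_def intro!: linear_sweedler2_param linear_mult_left linear_mult_right l)
  also have "\<dots> = ?sw (\<lambda>a1 x. ?sw (\<lambda>b1 y. ?sw (\<lambda>a2 a3. ?sw (\<lambda>b2 b3. f a1 b1 * g a2 b2 * h a3 b3) y) x) b) a"
    unfolding L by (subst (2) sweedler2_swap) simp
  also have "\<dots> = convolution H f (convolution H g h) a b"
    by (simp add: convolution_def sweedler2_mult_left mult.assoc)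
  finally show "convolution H (convolution H f g) h a b = convolution H f (convolution H g h) a b" .
qed

lemma convolution_one_right:
  assumes "bilinear_form H f"
  shows "convolution H f (convolution_one H) = f"
proof (intro ext)
  fix a b
  have "convolution H f (convolution_one H) a b =
      sweedler2 H (*) (\<lambda>a1 a2. sweedler2 H (*) (\<lambda>b1 b2. counit H a2 * (f a1 b1 * counit H b2)) b) a"
  proof -
    have "f a1 b1 * (counit H a2 * counit H b2) = counit H a2 * (f a1 b1 * counit H b2)" for a1 a2 b1 b2
      by (rule mult.left_commute)
    then show ?thesis by (simp only: convolution_def convolution_one_def)
  qed
  also have "\<dots> = sweedler2 H (*) (\<lambda>a1 a2. counit H a2 * f a1 b) a"
    by (simp only: sweedler2_mult_left sweedler2_counit_right bilinear_formD[OF assms])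
  also have "\<dots> = sweedler2 H (*) (\<lambda>a1 a2. f a1 b * counit H a2) a"
    by (rule arg_cong[where f = "\<lambda>g. sweedler2 H (*) g a"]) (intro ext mult.commute)
  also have "\<dots> = f a b" by (simp only: sweedler2_counit_right bilinear_formD[OF assms])
  finally show "convolution H f (convolution_one H) a b = f a b" .
qed

lemma convolution_one_left: "bilinear_form H f \<Longrightarrow> convolution H (convolution_one H) f = f"
  by (intro ext)
     (simp add: convolution_def convolution_one_def mult.assoc sweedler2_mult_left
        sweedler2_counit_left bilinear_formD)

lemma convolution_inverse_unique:
  assumes J: "bilinear_form H J" and K: "is_convolution_inverse H J K" and K': "is_convolution_inverse H J K'"
  shows "K = K'"
proof -
  have bil: "bilinear_form H K" "bilinear_form H K'"
    and KJ: "convolution H K J = convolution_one H" and JK': "convolution H J K' = convolution_one H"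
    using K K' by (simp_all add: is_convolution_inverse_def)
  have "K = convolution H K (convolution H J K')"
    unfolding JK' by (rule convolution_one_right[OF bil(1), symmetric])
  also have "\<dots> = convolution H (convolution H K J) K'"
    by (rule convolution_assoc[OF bil(1) J bil(2), symmetric])
  also have "\<dots> = K'" unfolding KJ by (rule convolution_one_left[OF bil(2)])
  finally show ?thesis .
qed

lemma convolution_inverse:
  assumes "hopf_2_cocycle H J"
  shows "is_convolution_inverse H J (convolution_inverse H J)"
proof -
  obtain K where K: "is_convolution_inverse H J K" and J: "bilinear_form H J"
    using assms by (auto simp: hopf_2_cocycle_def)
  show ?thesis unfolding convolution_inverse_def
  proof (rule theI[where P = "is_convolution_inverse H J"])
    show "is_convolution_inverse H J K" by (rule K)
    show "L = K" if "is_convolution_inverse H J L" for L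
      by (rule convolution_inverse_unique[OF J that K])
  qed
qed

end

section \<open>Multiplicative matrices\<close>

text \<open>
  A multiplicative matrix is the matrix of coefficients of a finite-dimensional comodule, \<open>\<Delta>(T i j) = \<Sum>l. T i l \<otimes> T l j\<close>.
  It turns Sweedler notation into matrix multiplication.
\<close>

definition mult_matrix ::
    "('k::field, 'b::ab_group_add) hopf \<Rightarrow> 'i set \<Rightarrow> ('i \<Rightarrow> 'i \<Rightarrow> 'b) \<Rightarrow> bool" where
  "mult_matrix H I T \<longleftrightarrow> finite I \<and>
     (\<forall>i\<in>I. \<forall>j\<in>I. counit H (T i j) = (if i = j then 1 else 0) \<and>
        (\<forall>g. bilinear_form H g \<longrightarrow> sweedler2 H (*) g (T i j) = (\<Sum>l\<in>I. g (T i l) (T l j))))"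

lemma mult_matrix_finite: "mult_matrix H I T \<Longrightarrow> finite I"
  by (simp add: mult_matrix_def)

lemma mult_matrix_counit:
  "mult_matrix H I T \<Longrightarrow> i \<in> I \<Longrightarrow> j \<in> I \<Longrightarrow> counit H (T i j) = (if i = j then 1 else 0)"
  by (simp add: mult_matrix_def)

lemma mult_matrix_sweedler:
  "mult_matrix H I T \<Longrightarrow> bilinear_form H g \<Longrightarrow> i \<in> I \<Longrightarrow> j \<in> I \<Longrightarrow>
     sweedler2 H (*) g (T i j) = (\<Sum>l\<in>I. g (T i l) (T l j))"
  by (simp add: mult_matrix_def)

lemma mult_matrix_reindex:
  assumes T: "mult_matrix H I T" and f: "bij_betw f I' I"
  shows "mult_matrix H I' (\<lambda>i j. T (f i) (f j))"
proof -
  have fin: "finite I'" using T f bij_betw_finite mult_matrix_finite by blast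
  have inj: "f i = f j \<longleftrightarrow> i = j" if "i \<in> I'" "j \<in> I'" for i j
    using f that by (auto simp: bij_betw_def inj_on_def)
  have mem: "f i \<in> I" if "i \<in> I'" for i using f that by (auto simp: bij_betw_def)
  have "(\<Sum>l\<in>I. g (T a l) (T l b)) = (\<Sum>l\<in>I'. g (T a (f l)) (T (f l) b))" for g :: "_ \<Rightarrow> _ \<Rightarrow> 'a" and a b
    by (rule sum.reindex_bij_betw[OF f, symmetric])
  then show ?thesis using T fin inj mem by (simp add: mult_matrix_def)
qed

context coalgebra
begin

lemma linear_form_zero: "linear_form H f \<Longrightarrow> f 0 = 0"
  using linear_form_scal(1)[of f 0 0] by simp

lemma linear_counit: "linear_form H (counit H)"
  by (rule counit_linear)

text \<open>Scalar-valued forms determine Sweedler sums with values in the coalgebra.\<close>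

lemma mult_matrix_sweedler_vector:
  assumes T: "mult_matrix H I T" and f: "bilinear_map (scal H) (scal H) f" and ij: "i \<in> I" "j \<in> I"
  shows "sweedler2 H (scal H) f (T i j) = (\<Sum>l\<in>I. f (T i l) (T l j))"
proof (rule linear_forms_separate)
  fix \<phi> assume \<phi>: "linear_form H \<phi>"
  have "bilinear_form H (\<lambda>x y. \<phi> (f x y))"
    using f \<phi> by (auto simp: bilinear_form_iff bilinear_map_def vlinear_iff)
  then show "\<phi> (sweedler2 H (scal H) f (T i j)) = \<phi> (\<Sum>l\<in>I. f (T i l) (T l j))"
    by (simp add: sweedler2_image[OF \<phi>] mult_matrix_sweedler[OF T] ij linear_form_sum[OF \<phi>])
qed

text \<open>
  With a basis \<open>E\<close> of the subcoalgebra, \<open>T\<close> is defined by \<open>\<Delta>(j) = (\<Sum>i\<in>E. i \<otimes> T i j)\<close>.  Coassociativity and the right counit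
  law, compared at the basis elements, give the comatrix relations; the left counit law writes \<open>j\<close> as
  \<open>\<Sum>i\<in>E. \<epsilon>(i) T i j\<close>.
\<close>

lemma subcoalgebra_mult_matrix:
  assumes C: "subcoalgebra H C" and fd: "finite_dimensional H C"
  shows "\<exists>(E :: 'b set) T. mult_matrix H E T \<and> (\<forall>i\<in>E. \<forall>j\<in>E. T i j \<in> C) \<and>
    C \<subseteq> V.span ((\<lambda>p. T (fst p) (snd p)) ` (E \<times> E))"
proof -
  have subC: "V.subspace C" using C by (simp add: subcoalgebra_def)
  obtain B0 where B0: "finite B0" "V.span B0 = C" using fd by (auto simp: finite_dimensional_def)
  obtain E where E: "E \<subseteq> B0" "V.independent E" "V.span E = C"
    using V.maximal_independent_subset[of B0] B0(2) by (metis V.span_mono V.span_span subset_antisym)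
  have finE: "finite E" using E(1) B0(1) finite_subset by blast
  have EC: "E \<subseteq> C" using E(3) V.span_superset by auto
  interpret P: vector_space_pair "scal H" "(*) :: 'k \<Rightarrow> _"
    by (intro vector_space_pair.intro vector_space vector_space_mult)
  have "\<exists>g. linear_form H g \<and> (\<forall>x\<in>E. g x = (if x = i then 1 else 0))" for i
    using P.linear_independent_extend[OF E(2), of "\<lambda>x. if x = i then 1 else 0"] by auto
  then obtain e where e: "\<And>i. linear_form H (e i)" and ed: "\<And>i x. x \<in> E \<Longrightarrow> e i x = (if x = i then 1 else 0)"
    by metis
  have expand: "x = (\<Sum>i\<in>E. scal H (e i x) i)" if "x \<in> C" for x
  proof -
    have "x \<in> V.span E" using that E(3) by simp
    then show ?thesis
    proof (rule V.span_induct_alt)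
      show "0 = (\<Sum>i\<in>E. scal H (e i 0) i)"
        using linear_form_scal(1)[OF e, of _ 0 0] by (simp add: vlinear_iff)
      fix c x y assume x: "x \<in> E" and y: "y = (\<Sum>i\<in>E. scal H (e i y) i)"
      have "(\<Sum>i\<in>E. scal H (e i (scal H c x + y)) i) =
          (\<Sum>i\<in>E. if x = i then scal H c i else 0) + (\<Sum>i\<in>E. scal H (e i y) i)"
        unfolding sum.distrib[symmetric]
        by (intro sum.cong refl) (auto simp: linear_form_scal[OF e] ed x V.scale_left_distrib)
      then show "scal H c x + y = (\<Sum>i\<in>E. scal H (e i (scal H c x + y)) i)"
        using finE x y[symmetric] by simp
    qed
  qed
  have "\<forall>j\<in>E. \<exists>u. u \<in> comul H j \<and> Poly_Mapping.keys u \<subseteq> C \<times> C"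
    using C EC unfolding subcoalgebra_def by blast
  then obtain u where u: "\<And>j. j \<in> E \<Longrightarrow> u j \<in> comul H j"
    and uC: "\<And>j. j \<in> E \<Longrightarrow> Poly_Mapping.keys (u j) \<subseteq> C \<times> C" by metis
  define T where "T i j = (\<Sum>p\<in>Poly_Mapping.keys (u j).
      scal H (Poly_Mapping.lookup (u j) p * e i (fst p)) (snd p))" for i j
  have TC: "T i j \<in> C" if "j \<in> E" for i j
    unfolding T_def using uC[OF that] by (intro V.subspace_sum[OF subC] V.subspace_scale[OF subC]) auto
  have coact: "sweedler2 H (*) g j = (\<Sum>i\<in>E. g i (T i j))" if j: "j \<in> E" and g: "bilinear_form H g" for g j
  proof -
    note l = bilinear_formD[OF g]
    have "sweedler2 H (*) g j = (\<Sum>p\<in>Poly_Mapping.keys (u j). Poly_Mapping.lookup (u j) p * g (fst p) (snd p))"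
      using sweedler2_rep[OF g[unfolded bilinear_form_def] u[OF j]] by (simp add: formal_sum_def)
    also have "\<dots> = (\<Sum>p\<in>Poly_Mapping.keys (u j). \<Sum>i\<in>E.
        Poly_Mapping.lookup (u j) p * (e i (fst p) * g i (snd p)))"
    proof (intro sum.cong refl)
      fix p assume "p \<in> Poly_Mapping.keys (u j)"
      then have "fst p \<in> C" using uC[OF j] by auto
      from expand[OF this] have "g (fst p) (snd p) = g (\<Sum>i\<in>E. scal H (e i (fst p)) i) (snd p)" by (rule arg_cong)
      then show "Poly_Mapping.lookup (u j) p * g (fst p) (snd p) =
          (\<Sum>i\<in>E. Poly_Mapping.lookup (u j) p * (e i (fst p) * g i (snd p)))"
        by (simp only: linear_form_sum[OF l(1)] linear_form_scal(1)[OF l(1)] sum_distrib_left)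
    qed
    also have "\<dots> = (\<Sum>i\<in>E. g i (T i j))"
      unfolding T_def linear_form_sum[OF l(2)] linear_form_scal(1)[OF l(2)]
      by (subst sum.swap) (simp only: mult.assoc)
    finally show ?thesis .
  qed
  have counit_T: "counit H (T i j) = (if i = j then 1 else 0)" if "i \<in> E" "j \<in> E" for i j
  proof -
    have bil: "bilinear_form H (\<lambda>x y. e i x * counit H y)"
      unfolding bilinear_form_iff by (intro conjI allI linear_mult_left linear_mult_right e linear_counit)
    have "e i j = (\<Sum>l\<in>E. e i l * counit H (T l j))"
      using coact[OF that(2) bil] sweedler2_counit_right[OF e, of i j] by simp
    also have "\<dots> = (\<Sum>l\<in>E. (if l = i then 1 else 0) * counit H (T l j))"
      by (intro sum.cong refl) (simp add: ed)
    also have "\<dots> = counit H (T i j)" by (rule sum_delta_left(2)[OF finE that(1)])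
    finally show ?thesis using ed[OF that(2), of i] by auto
  qed
  have sweedler_T: "sweedler2 H (*) g (T i j) = (\<Sum>l\<in>E. g (T i l) (T l j))"
    if i: "i \<in> E" and j: "j \<in> E" and g: "bilinear_form H g" for i j g
  proof -
    note l = bilinear_formD[OF g]
    let ?sw = "sweedler2 H (*)"
    have bil: "bilinear_form H (\<lambda>p q. e i p * g q z)" for z
      unfolding bilinear_form_iff by (intro conjI allI linear_mult_left linear_mult_right e l)
    have bil2: "bilinear_form H (\<lambda>x z. ?sw (\<lambda>p q. e i p * g q z) x)"
      unfolding bilinear_form_iff
      by (intro conjI allI linear_sweedler2 linear_sweedler2_param bil linear_mult_left l)
    have bil3: "bilinear_form H (\<lambda>x y. e i x * ?sw g y)"
      unfolding bilinear_form_iff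
      by (intro conjI allI linear_mult_left linear_mult_right e linear_sweedler2 g)
    have tri: "trilinear_form H (\<lambda>p q z. e i p * g q z)"
      unfolding trilinear_form_def by (intro conjI allI linear_mult_left linear_mult_right e l)
    have delta: "(\<Sum>l\<in>E. e i l * f l) = f i" for f
    proof -
      have "(\<Sum>l\<in>E. e i l * f l) = (\<Sum>l\<in>E. (if l = i then 1 else 0) * f l)"
        by (intro sum.cong refl) (simp add: ed)
      then show ?thesis using sum_delta_left(2)[OF finE i] by simp
    qed
    have "?sw g (T i j) = ?sw (\<lambda>x y. e i x * ?sw g y) j"
      using coact[OF j bil3] delta by simp
    also have "\<dots> = ?sw (\<lambda>x z. ?sw (\<lambda>p q. e i p * g q z) x) j"
      by (simp only: sweedler2_coassoc[OF tri] sweedler2_mult_left)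
    also have "\<dots> = (\<Sum>l\<in>E. \<Sum>m\<in>E. e i m * g (T m l) (T l j))"
      by (simp add: coact[OF j bil2] coact[OF _ bil])
    also have "\<dots> = (\<Sum>l\<in>E. g (T i l) (T l j))" by (simp only: delta)
    finally show ?thesis .
  qed
  have spanT: "C \<subseteq> V.span ((\<lambda>p. T (fst p) (snd p)) ` (E \<times> E))"
  proof -
    have "j \<in> V.span ((\<lambda>p. T (fst p) (snd p)) ` (E \<times> E))" if j: "j \<in> E" for j
    proof -
      have "j = (\<Sum>i\<in>E. scal H (counit H i) (T i j))"
      proof (rule linear_forms_separate)
        fix \<phi> assume \<phi>: "linear_form H \<phi>"
        have bil: "bilinear_form H (\<lambda>x y. counit H x * \<phi> y)"
          unfolding bilinear_form_iff by (intro conjI allI linear_mult_left linear_mult_right \<phi> linear_counit)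
        show "\<phi> j = \<phi> (\<Sum>i\<in>E. scal H (counit H i) (T i j))"
          using coact[OF j bil] sweedler2_counit_left[OF \<phi>, of j]
          by (simp add: linear_form_sum[OF \<phi>] linear_form_scal(1)[OF \<phi>])
      qed
      also have "\<dots> \<in> V.span ((\<lambda>p. T (fst p) (snd p)) ` (E \<times> E))"
        using j by (intro V.span_sum V.span_scale V.span_base) force
      finally show ?thesis .
    qed
    then show ?thesis using V.span_minimal[OF _ V.subspace_span] E(3) by blast
  qed
  show ?thesis using finE counit_T sweedler_T TC spanT
    by (intro exI[of _ E] exI[of _ T]) (auto simp: mult_matrix_def)
qed

end

section \<open>The antipode on multiplicative matrices\<close>

definition dual_matrix :: "('k::field, 'b) hopf \<Rightarrow> ('i \<Rightarrow> 'i \<Rightarrow> 'b) \<Rightarrow> 'i \<Rightarrow> 'i \<Rightarrow> 'b" where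
  "dual_matrix H T i j = antipode H (T j i)"

definition tensor_matrix ::
    "('k::field, 'b) hopf \<Rightarrow> ('i \<Rightarrow> 'i \<Rightarrow> 'b) \<Rightarrow> ('j \<Rightarrow> 'j \<Rightarrow> 'b) \<Rightarrow> 'i \<times> 'j \<Rightarrow> 'i \<times> 'j \<Rightarrow> 'b" where
  "tensor_matrix H T T' p q = mul H (T (fst p) (fst q)) (T' (snd p) (snd q))"

context commutative_hopf_algebra
begin

abbreviation "M \<equiv> mul H"
abbreviation "S \<equiv> antipode H"
abbreviation "\<epsilon> \<equiv> counit H"
abbreviation "sw \<equiv> sweedler2 H (*)"

lemma mul_add: "M (x + y) z = M x z + M y z" "M z (x + y) = M z x + M z y"
  and mul_scal: "M (scal H c x) z = scal H c (M x z)" "M z (scal H c x) = scal H c (M z x)"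
  using mul_bilinear by (auto simp: bilinear_map_def vlinear_iff)

lemma mul_zero: "M 0 x = 0" "M x 0 = 0"
  using mul_scal(1)[where c = 0 and z = x] mul_scal(2)[where c = 0 and z = x] by simp_all

lemma mul_sum: "M (\<Sum>l\<in>F. g l) x = (\<Sum>l\<in>F. M (g l) x)" "M x (\<Sum>l\<in>F. g l) = (\<Sum>l\<in>F. M x (g l))"
  by (induction F rule: infinite_finite_induct) (simp_all add: mul_add mul_zero)

lemma S_add: "S (x + y) = S x + S y" and S_scal: "S (scal H c x) = scal H c (S x)"
  using antipode_linear by (auto simp: vlinear_iff)

lemma mul_left_commute: "M x (M y z) = M y (M x z)"
  by (metis mul_assoc mul_commute)

lemma linear_mul:
  "linear_form H f \<Longrightarrow> linear_form H (\<lambda>x. f (M x y))"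
  "linear_form H f \<Longrightarrow> linear_form H (\<lambda>x. f (M y x))"
  by (auto simp: vlinear_iff mul_add mul_scal)

lemma linear_antipode: "linear_form H f \<Longrightarrow> linear_form H (\<lambda>x. f (S x))"
  by (auto simp: vlinear_iff S_add S_scal)

lemma sweedler2_mul:
  assumes g: "bilinear_form H g"
  shows "sw g (M a b) = sw (\<lambda>a1 a2. sw (\<lambda>b1 b2. g (M a1 b1) (M a2 b2)) b) a"
proof -
  interpret K: vector_space "(*) :: 'k \<Rightarrow> _" by (rule vector_space_mult)
  have "sw g (M a b) = formal_sum (*) (\<lambda>p. g (fst p) (snd p)) (formal_mul M (comul_rep H a) (comul_rep H b))"
    by (rule sweedler2_rep[OF g[unfolded bilinear_form_def] comul_mul[OF comul_rep_in comul_rep_in]])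
  then show ?thesis
    unfolding formal_mul_def case_prod_beta K.formal_sum_sum K.formal_sum_single
    by (simp only: sweedler2_sum sum_distrib_left mult.assoc fst_conv snd_conv prod.collapse)
qed

lemma sweedler2_unit:
  assumes g: "bilinear_form H g"
  shows "sw g (unit H) = g (unit H) (unit H)"
proof -
  interpret K: vector_space "(*) :: 'k \<Rightarrow> _" by (rule vector_space_mult)
  show ?thesis
    unfolding sweedler2_rep[OF g[unfolded bilinear_form_def] comul_unit] K.formal_sum_single by simp
qed

lemma mult_matrix_antipode:
  assumes T: "mult_matrix H I T" and ij: "i \<in> I" "j \<in> I"
  shows "(\<Sum>l\<in>I. M (S (T i l)) (T l j)) = (if i = j then unit H else 0)"
    and "(\<Sum>l\<in>I. M (T i l) (S (T l j))) = (if i = j then unit H else 0)"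
proof -
  have bil: "bilinear_map (scal H) (scal H) (\<lambda>x y. M (S x) y)" "bilinear_map (scal H) (scal H) (\<lambda>x y. M x (S y))"
    by (auto simp: bilinear_map_def vlinear_iff mul_add mul_scal S_add S_scal vector_space)
  show "(\<Sum>l\<in>I. M (S (T i l)) (T l j)) = (if i = j then unit H else 0)"
    using mult_matrix_sweedler_vector[OF T bil(1) ij] unfolding antipode_left mult_matrix_counit[OF T ij]
    by (cases "i = j") simp_all
  show "(\<Sum>l\<in>I. M (T i l) (S (T l j))) = (if i = j then unit H else 0)"
    using mult_matrix_sweedler_vector[OF T bil(2) ij] unfolding antipode_right mult_matrix_counit[OF T ij]
    by (cases "i = j") simp_all
qed

lemma sum_unit_delta:
  assumes "finite I" "i \<in> I"
  shows "(\<Sum>l\<in>I. M (if i = l then unit H else 0) (f l)) = f i"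
    "(\<Sum>l\<in>I. M (if l = i then unit H else 0) (f l)) = f i"
    "(\<Sum>l\<in>I. M (f l) (if l = i then unit H else 0)) = f i"
  using assms
  by (simp_all add: if_distrib[of "\<lambda>x. M x _"] if_distrib[of "M _"] unit_left unit_right mul_zero cong: if_cong)

text \<open>Inverse matrices over the commutative ring \<open>H\<close> are unique, and \<open>S(T)\<close> is the inverse of \<open>T\<close>.\<close>

lemma antipode_unique:
  assumes T: "mult_matrix H I T"
    and X: "\<And>i j. i \<in> I \<Longrightarrow> j \<in> I \<Longrightarrow> (\<Sum>l\<in>I. M (X i l) (T l j)) = (if i = j then unit H else 0)"
    and ij: "i \<in> I" "j \<in> I"
  shows "S (T i j) = X i j"
proof -
  have fin: "finite I" by (rule mult_matrix_finite[OF T])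
  have "X i j = (\<Sum>l\<in>I. M (X i l) (if l = j then unit H else 0))"
    by (rule sum_unit_delta(3)[symmetric, OF fin ij(2)])
  also have "\<dots> = (\<Sum>l\<in>I. M (X i l) (\<Sum>m\<in>I. M (T l m) (S (T m j))))"
    by (intro sum.cong refl) (simp add: mult_matrix_antipode[OF T] ij)
  also have "\<dots> = (\<Sum>m\<in>I. M (\<Sum>l\<in>I. M (X i l) (T l m)) (S (T m j)))"
    unfolding mul_sum by (subst sum.swap) (simp only: mul_assoc)
  also have "\<dots> = (\<Sum>m\<in>I. M (if i = m then unit H else 0) (S (T m j)))"
    by (intro sum.cong refl) (simp add: X ij)
  also have "\<dots> = S (T i j)" by (rule sum_unit_delta(1)[OF fin ij(1)])
  finally show ?thesis by simp
qed

text \<open>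
  In the algebra of matrices over \<open>H \<otimes> H\<close> the matrix \<open>\<Delta>(S(T))\<close> is a right inverse of \<open>\<Delta>(T)\<close>, and the matrix with
  entries \<open>\<Sum>p. S(T p j) \<otimes> S(T i p)\<close> is a left inverse.  The proof evaluates a form \<open>g\<close> on the triple product.
\<close>

lemma sweedler2_antipode:
  assumes T: "mult_matrix H I T" and g: "bilinear_form H g" and ij: "i \<in> I" "j \<in> I"
  shows "sw g (S (T i j)) = (\<Sum>p\<in>I. g (S (T p j)) (S (T i p)))"
proof -
  have fin: "finite I" by (rule mult_matrix_finite[OF T])
  note l = bilinear_formD[OF g]
  note ant = mult_matrix_antipode[OF T]
  define g' where "g' k p x y = g (M (S (T p k)) x) (M (S (T i p)) y)" for k p x y
  have g': "bilinear_form H (g' k p)" for k p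
    unfolding bilinear_form_iff g'_def by (intro conjI allI linear_mul l)
  \<comment> \<open>the form \<open>g\<close> on the triple product; summing over \<open>k\<close> and \<open>p\<close> contracts the first two factors, over \<open>l\<close> and \<open>q\<close> the last two\<close>
  define Z where "Z = (\<Sum>l\<in>I. \<Sum>k\<in>I. \<Sum>p\<in>I. \<Sum>q\<in>I.
      sw (\<lambda>z1 z2. g' k p (M (T k q) z1) (M (T q l) z2)) (S (T l j)))"
  have "Z = (\<Sum>l\<in>I. sw (\<lambda>z1 z2. if i = l then g z1 z2 else 0) (S (T l j)))"
  proof -
    have inner: "(\<Sum>k\<in>I. \<Sum>p\<in>I. \<Sum>q\<in>I. g' k p (M (T k q) z1) (M (T q l) z2)) = (if i = l then g z1 z2 else 0)"
      if "l \<in> I" for l z1 z2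
    proof -
      have "(\<Sum>k\<in>I. \<Sum>p\<in>I. \<Sum>q\<in>I. g' k p (M (T k q) z1) (M (T q l) z2)) =
          (\<Sum>p\<in>I. \<Sum>q\<in>I. \<Sum>k\<in>I. g' k p (M (T k q) z1) (M (T q l) z2))"
        by (rule trans[OF sum.swap], rule sum.cong[OF refl], rule sum.swap)
      also have "\<dots> = (\<Sum>p\<in>I. \<Sum>q\<in>I. g (M (\<Sum>k\<in>I. M (S (T p k)) (T k q)) z1) (M (M (S (T i p)) (T q l)) z2))"
        by (simp add: g'_def mul_assoc mul_sum linear_form_sum[OF l(1)])
      also have "\<dots> = (\<Sum>p\<in>I. \<Sum>q\<in>I. if q = p then g z1 (M (M (S (T i p)) (T p l)) z2) else 0)"
        by (intro sum.cong refl) (auto simp: ant unit_left mul_zero linear_form_zero[OF l(1)])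
      also have "\<dots> = (\<Sum>p\<in>I. g z1 (M (M (S (T i p)) (T p l)) z2))" using fin by simp
      also have "\<dots> = g z1 (M (\<Sum>p\<in>I. M (S (T i p)) (T p l)) z2)"
        by (simp add: mul_sum linear_form_sum[OF l(2)])
      also have "\<dots> = (if i = l then g z1 z2 else 0)"
        by (auto simp: ant ij that unit_left mul_zero linear_form_zero[OF l(2)])
      finally show ?thesis .
    qed
    show ?thesis unfolding Z_def
      by (intro sum.cong refl) (simp add: sweedler2_sum_form[symmetric] inner)
  qed
  also have "\<dots> = (\<Sum>l\<in>I. if i = l then sw g (S (T l j)) else 0)"
    by (intro sum.cong refl) (auto simp: sweedler2_sum)
  also have "\<dots> = sw g (S (T i j))" using fin ij by simp
  finally have 1: "Z = sw g (S (T i j))" .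
  have "Z = (\<Sum>k\<in>I. \<Sum>p\<in>I. \<Sum>l\<in>I. \<Sum>q\<in>I. sw (\<lambda>z1 z2. g' k p (M (T k q) z1) (M (T q l) z2)) (S (T l j)))"
    unfolding Z_def by (rule trans[OF sum.swap], rule sum.cong[OF refl], rule sum.swap)
  also have "\<dots> = (\<Sum>k\<in>I. \<Sum>p\<in>I. if k = j then g' k p (unit H) (unit H) else 0)"
  proof (intro sum.cong refl)
    fix k p assume k: "k \<in> I" and "p \<in> I"
    have bil: "bilinear_form H (\<lambda>a1 a2. sw (\<lambda>b1 b2. g' k p (M a1 b1) (M a2 b2)) z)" for z
      unfolding bilinear_form_iff
      by (intro conjI allI linear_sweedler2_param linear_mul bilinear_formD[OF g'])
    have "(\<Sum>l\<in>I. \<Sum>q\<in>I. sw (\<lambda>z1 z2. g' k p (M (T k q) z1) (M (T q l) z2)) (S (T l j))) =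
        (\<Sum>l\<in>I. sw (g' k p) (M (T k l) (S (T l j))))"
      by (intro sum.cong refl) (simp add: sweedler2_mul[OF g'] mult_matrix_sweedler[OF T bil] k)
    also have "\<dots> = sw (g' k p) (\<Sum>l\<in>I. M (T k l) (S (T l j)))"
      by (rule linear_form_sum[OF linear_sweedler2[OF g'], symmetric])
    also have "\<dots> = (if k = j then g' k p (unit H) (unit H) else 0)"
      using linear_form_zero[OF linear_sweedler2[OF g']]
      by (auto simp: ant k ij sweedler2_unit[OF g'])
    finally show "(\<Sum>l\<in>I. \<Sum>q\<in>I. sw (\<lambda>z1 z2. g' k p (M (T k q) z1) (M (T q l) z2)) (S (T l j))) =
        (if k = j then g' k p (unit H) (unit H) else 0)" .
  qed
  also have "\<dots> = (\<Sum>p\<in>I. g' j p (unit H) (unit H))"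
    using fin ij by (subst sum.swap) simp
  also have "\<dots> = (\<Sum>p\<in>I. g (S (T p j)) (S (T i p)))" by (simp add: g'_def unit_right)
  finally show ?thesis using 1 by simp
qed

lemma counit_antipode:
  assumes T: "mult_matrix H I T" and ij: "i \<in> I" "j \<in> I"
  shows "\<epsilon> (S (T i j)) = (if i = j then 1 else 0)"
proof -
  have "\<epsilon> (\<Sum>l\<in>I. M (S (T i l)) (T l j)) = (\<Sum>l\<in>I. \<epsilon> (S (T i l)) * (if l = j then 1 else 0))"
    unfolding linear_form_sum[OF linear_counit]
    by (intro sum.cong refl) (simp add: counit_mul mult_matrix_counit[OF T] ij)
  also have "\<dots> = \<epsilon> (S (T i j))" by (rule sum_delta_left(4)[OF mult_matrix_finite[OF T] ij(2)])
  finally show ?thesis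
    using linear_form_zero[OF linear_counit]
    by (auto simp: mult_matrix_antipode[OF T ij] counit_unit split: if_splits)
qed

lemma mult_matrix_dual:
  assumes T: "mult_matrix H I T"
  shows "mult_matrix H I (dual_matrix H T)"
  unfolding mult_matrix_def dual_matrix_def
  by (auto simp: mult_matrix_finite[OF T] counit_antipode[OF T] sweedler2_antipode[OF T])

text \<open>
  The dual matrix is multiplicative, and by commutativity the transpose of \<open>T\<close> is its inverse.
\<close>

lemma antipode_antipode:
  assumes T: "mult_matrix H I T" and ij: "i \<in> I" "j \<in> I"
  shows "S (S (T i j)) = T i j"
proof -
  have "S (dual_matrix H T j i) = T i j"
  proof (rule antipode_unique[OF mult_matrix_dual[OF T] _ ij(2,1), of "\<lambda>i j. T j i"])
    fix i j assume ij: "i \<in> I" "j \<in> I"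
    have "(\<Sum>l\<in>I. M (T l i) (dual_matrix H T l j)) = (\<Sum>l\<in>I. M (S (T j l)) (T l i))"
      unfolding dual_matrix_def by (simp only: mul_commute)
    then show "(\<Sum>l\<in>I. M (T l i) (dual_matrix H T l j)) = (if i = j then unit H else 0)"
      by (auto simp: mult_matrix_antipode[OF T] ij)
  qed
  then show ?thesis by (simp add: dual_matrix_def)
qed

lemma mult_matrix_tensor:
  assumes T: "mult_matrix H I T" and T': "mult_matrix H I' T'"
  shows "mult_matrix H (I \<times> I') (tensor_matrix H T T')"
  unfolding mult_matrix_def
proof (intro conjI ballI allI impI)
  show "finite (I \<times> I')" using T T' by (simp add: mult_matrix_def)
  fix p q assume pq: "p \<in> I \<times> I'" "q \<in> I \<times> I'"
  show "\<epsilon> (tensor_matrix H T T' p q) = (if p = q then 1 else 0)"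
    using pq by (auto simp: tensor_matrix_def counit_mul mult_matrix_counit[OF T] mult_matrix_counit[OF T'] prod_eq_iff)
  fix g assume g: "bilinear_form H g"
  note l = bilinear_formD[OF g]
  have bil1: "bilinear_form H (\<lambda>a1 a2. sw (\<lambda>b1 b2. g (M a1 b1) (M a2 b2)) z)" for z
    unfolding bilinear_form_iff by (intro conjI allI linear_sweedler2_param linear_mul l)
  have bil2: "bilinear_form H (\<lambda>b1 b2. g (M a1 b1) (M a2 b2))" for a1 a2
    unfolding bilinear_form_iff by (intro conjI allI linear_mul l)
  show "sw g (tensor_matrix H T T' p q) =
      (\<Sum>r\<in>I \<times> I'. g (tensor_matrix H T T' p r) (tensor_matrix H T T' r q))"
  proof -
    have mem: "fst p \<in> I" "fst q \<in> I" "snd p \<in> I'" "snd q \<in> I'" using pq by auto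
    have "sw g (tensor_matrix H T T' p q) = (\<Sum>l\<in>I.
        sw (\<lambda>b1 b2. g (M (T (fst p) l) b1) (M (T l (fst q)) b2)) (T' (snd p) (snd q)))"
      unfolding tensor_matrix_def sweedler2_mul[OF g] by (rule mult_matrix_sweedler[OF T bil1 mem(1,2)])
    also have "\<dots> = (\<Sum>l\<in>I. \<Sum>r\<in>I'. g (M (T (fst p) l) (T' (snd p) r)) (M (T l (fst q)) (T' r (snd q))))"
      by (simp only: mult_matrix_sweedler[OF T' bil2 mem(3,4)])
    also have "\<dots> = (\<Sum>r\<in>I \<times> I'. g (tensor_matrix H T T' p r) (tensor_matrix H T T' r q))"
      by (simp only: sum.cartesian_product case_prod_unfold tensor_matrix_def)
    finally show ?thesis .
  qed
qed

text \<open>By commutativity the entrywise products of \<open>S(T)\<close> and \<open>S(T')\<close> form an inverse of the tensor matrix.\<close>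

lemma antipode_mul:
  assumes T: "mult_matrix H I T" and T': "mult_matrix H I' T'"
    and "i \<in> I" "j \<in> I" "m \<in> I'" "n \<in> I'"
  shows "S (M (T i j) (T' m n)) = M (S (T i j)) (S (T' m n))"
proof -
  have fin: "finite I" "finite I'" using T T' by (simp_all add: mult_matrix_def)
  have "S (tensor_matrix H T T' (i, m) (j, n)) = (\<lambda>p q. M (S (T (fst p) (fst q))) (S (T' (snd p) (snd q)))) (i, m) (j, n)"
  proof (rule antipode_unique[OF mult_matrix_tensor[OF T T']])
    fix p q assume pq: "p \<in> I \<times> I'" "q \<in> I \<times> I'"
    have "(\<Sum>r\<in>I \<times> I'. M (M (S (T (fst p) (fst r))) (S (T' (snd p) (snd r)))) (tensor_matrix H T T' r q)) =
        (\<Sum>l\<in>I. \<Sum>r\<in>I'. M (M (S (T (fst p) l)) (T l (fst q))) (M (S (T' (snd p) r)) (T' r (snd q))))"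
      unfolding sum.cartesian_product case_prod_unfold tensor_matrix_def
      by (intro sum.cong refl) (simp only: mul_assoc mul_left_commute)
    also have "\<dots> = M (\<Sum>l\<in>I. M (S (T (fst p) l)) (T l (fst q))) (\<Sum>r\<in>I'. M (S (T' (snd p) r)) (T' r (snd q)))"
      unfolding mul_sum by (rule sum.swap)
    also have "\<dots> = (if p = q then unit H else 0)"
      using pq by (auto simp: mult_matrix_antipode[OF T] mult_matrix_antipode[OF T'] unit_left mul_zero prod_eq_iff)
    finally show "(\<Sum>r\<in>I \<times> I'. M (M (S (T (fst p) (fst r))) (S (T' (snd p) (snd r)))) (tensor_matrix H T T' r q)) =
        (if p = q then unit H else 0)" .
  qed (use assms in auto)
  then show ?thesis by (simp add: tensor_matrix_def)
qed

end

section \<open>The Drinfeld element of a twist\<close>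

locale hopf_twist = commutative_hopf_algebra H
  for H :: "('k::field_char_0, 'b::ab_group_add) hopf" +
  fixes J :: "'b \<Rightarrow> 'b \<Rightarrow> 'k"
  assumes cocycle: "hopf_2_cocycle H J"
begin

definition K :: "'b \<Rightarrow> 'b \<Rightarrow> 'k" where
  "K = convolution_inverse H J"

text \<open>
  The functionals \<open>q(a) = J(S(a\<^sub>1), a\<^sub>2)\<close> and \<open>q'(a) = K(a\<^sub>1, S(a\<^sub>2))\<close> are convolution inverse to each other; the twisted
  antipode is \<open>q' * S * q\<close>.  The functional \<open>u\<close> is the Drinfeld element of the triangular structure
  that the twist induces on the dual algebra.
\<close>

definition q :: "'b \<Rightarrow> 'k" where
  "q a = sw (\<lambda>x y. J (S x) y) a"

definition q' :: "'b \<Rightarrow> 'k" where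
  "q' a = sw (\<lambda>x y. K x (S y)) a"

definition u :: "'b \<Rightarrow> 'k" where
  "u a = sw (\<lambda>x y. q' x * q (S y)) a"

lemma J_bilinear: "bilinear_form H J"
  using cocycle by (simp add: hopf_2_cocycle_def)

lemma K_inverse: "is_convolution_inverse H J K"
  unfolding K_def by (rule convolution_inverse[OF cocycle])

lemma K_bilinear: "bilinear_form H K"
  using K_inverse by (simp add: is_convolution_inverse_def)

lemmas J_linear = bilinear_formD[OF J_bilinear]
lemmas K_linear = bilinear_formD[OF K_bilinear]

lemma J_unit: "J a (unit H) = \<epsilon> a" "J (unit H) a = \<epsilon> a"
  using cocycle by (simp_all add: hopf_2_cocycle_def)

lemma bilinear_q: "bilinear_form H (\<lambda>x y. J (S x) y)"
  unfolding bilinear_form_iff by (intro conjI allI linear_antipode[of "\<lambda>x. J x _"] J_linear)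

lemma bilinear_q': "bilinear_form H (\<lambda>x y. K x (S y))"
  unfolding bilinear_form_iff by (intro conjI allI linear_antipode[of "K _"] K_linear)

lemma linear_q: "linear_form H q"
  unfolding q_def by (rule linear_sweedler2[OF bilinear_q])

lemma linear_q': "linear_form H q'"
  unfolding q'_def by (rule linear_sweedler2[OF bilinear_q'])

lemma bilinear_u: "bilinear_form H (\<lambda>x y. q' x * q (S y))"
  unfolding bilinear_form_iff
  by (intro conjI allI linear_mult_left linear_mult_right linear_q' linear_antipode linear_q)

lemma linear_u: "linear_form H u"
  unfolding u_def by (rule linear_sweedler2[OF bilinear_u])

context
  fixes I :: "'i set" and T :: "'i \<Rightarrow> 'i \<Rightarrow> 'b"
  assumes T: "mult_matrix H I T"
begin

lemma q_matrix: "i \<in> I \<Longrightarrow> j \<in> I \<Longrightarrow> q (T i j) = (\<Sum>l\<in>I. J (S (T i l)) (T l j))"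
  unfolding q_def by (rule mult_matrix_sweedler[OF T bilinear_q])

lemma q'_matrix: "i \<in> I \<Longrightarrow> j \<in> I \<Longrightarrow> q' (T i j) = (\<Sum>l\<in>I. K (T i l) (S (T l j)))"
  unfolding q'_def by (rule mult_matrix_sweedler[OF T bilinear_q'])

lemma u_matrix: "i \<in> I \<Longrightarrow> j \<in> I \<Longrightarrow> u (T i j) = (\<Sum>l\<in>I. q' (T i l) * q (S (T l j)))"
  unfolding u_def by (rule mult_matrix_sweedler[OF T bilinear_u])

end

lemma q_S_matrix:
  assumes T: "mult_matrix H I T" and ij: "i \<in> I" "j \<in> I"
  shows "q (S (T i j)) = (\<Sum>l\<in>I. J (T l j) (S (T i l)))"
proof -
  have "q (dual_matrix H T j i) = (\<Sum>l\<in>I. J (S (dual_matrix H T j l)) (dual_matrix H T l i))"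
    by (rule q_matrix[OF mult_matrix_dual[OF T] ij(2,1)])
  then show ?thesis using ij by (simp add: dual_matrix_def antipode_antipode[OF T])
qed

lemma convolution_matrix:
  assumes T: "mult_matrix H I T" and T': "mult_matrix H I' T'"
    and f: "bilinear_form H f" and g: "bilinear_form H g"
    and ij: "i \<in> I" "j \<in> I" "m \<in> I'" "n \<in> I'"
  shows "convolution H f g (T i j) (T' m n) = (\<Sum>p\<in>I \<times> I'. f (T i (fst p)) (T' m (snd p)) * g (T (fst p) j) (T' (snd p) n))"
proof -
  note l = bilinear_formD[OF f] bilinear_formD[OF g]
  have b1: "bilinear_form H (\<lambda>a1 a2. sw (\<lambda>b1 b2. f a1 b1 * g a2 b2) (T' m n))"
    unfolding bilinear_form_iff by (intro conjI allI linear_sweedler2_param linear_mult_left linear_mult_right l)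
  have b2: "bilinear_form H (\<lambda>b1 b2. f a1 b1 * g a2 b2)" for a1 a2
    unfolding bilinear_form_iff by (intro conjI allI linear_mult_left linear_mult_right l)
  show ?thesis
    unfolding convolution_def mult_matrix_sweedler[OF T b1 ij(1,2)]
    unfolding mult_matrix_sweedler[OF T' b2 ij(3,4)] sum_times fst_conv snd_conv ..
qed

lemma JK_matrix:
  assumes T: "mult_matrix H I T" and T': "mult_matrix H I' T'"
    and ps: "p \<in> I \<times> I'" "s \<in> I \<times> I'"
  shows "(\<Sum>r\<in>I \<times> I'. J (T (fst p) (fst r)) (T' (snd p) (snd r)) * K (T (fst r) (fst s)) (T' (snd r) (snd s))) =
      (if p = s then 1 else 0)"
    and "(\<Sum>r\<in>I \<times> I'. K (T (fst p) (fst r)) (T' (snd p) (snd r)) * J (T (fst r) (fst s)) (T' (snd r) (snd s))) =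
      (if p = s then 1 else 0)"
proof -
  have mem: "fst p \<in> I" "fst s \<in> I" "snd p \<in> I'" "snd s \<in> I'" using ps by auto
  have one: "convolution_one H (T (fst p) (fst s)) (T' (snd p) (snd s)) = (if p = s then 1 else 0)"
    by (auto simp: convolution_one_def mult_matrix_counit[OF T] mult_matrix_counit[OF T'] mem prod_eq_iff)
  show "(\<Sum>r\<in>I \<times> I'. J (T (fst p) (fst r)) (T' (snd p) (snd r)) * K (T (fst r) (fst s)) (T' (snd r) (snd s))) =
      (if p = s then 1 else 0)"
    using convolution_matrix[OF T T' J_bilinear K_bilinear mem] K_inverse one
    by (simp add: is_convolution_inverse_def)
  show "(\<Sum>r\<in>I \<times> I'. K (T (fst p) (fst r)) (T' (snd p) (snd r)) * J (T (fst r) (fst s)) (T' (snd r) (snd s))) =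
      (if p = s then 1 else 0)"
    using convolution_matrix[OF T T' K_bilinear J_bilinear mem] K_inverse one
    by (simp add: is_convolution_inverse_def)
qed

lemma cocycle_matrix:
  assumes T: "mult_matrix H I T" and T': "mult_matrix H I' T'" and T'': "mult_matrix H I'' T''"
    and mem: "i \<in> I" "j \<in> I" "a \<in> I'" "b \<in> I'" "m \<in> I''" "n \<in> I''"
  shows "(\<Sum>p\<in>I \<times> I'. J (M (T i (fst p)) (T' a (snd p))) (T'' m n) * J (T (fst p) j) (T' (snd p) b)) =
    (\<Sum>p\<in>I' \<times> I''. J (T i j) (M (T' a (fst p)) (T'' m (snd p))) * J (T' (fst p) b) (T'' (snd p) n))"
proof -
  let ?f = "\<lambda>a1 a2 b1 b2. J (M a1 b1) (T'' m n) * J a2 b2"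
  let ?g = "\<lambda>b1 b2 c1 c2. J (T i j) (M b1 c1) * J b2 c2"
  have f1: "bilinear_form H (\<lambda>a1 a2. sw (?f a1 a2) (T' a b))"
    unfolding bilinear_form_iff
    by (intro conjI allI linear_sweedler2_param linear_mult_left linear_mult_right linear_mul[of "\<lambda>x. J x _"] J_linear)
  have f2: "bilinear_form H (?f a1 a2)" for a1 a2
    unfolding bilinear_form_iff
    by (intro conjI allI linear_mult_left linear_mult_right linear_mul[of "\<lambda>x. J x _"] J_linear)
  have g1: "bilinear_form H (\<lambda>b1 b2. sw (?g b1 b2) (T'' m n))"
    unfolding bilinear_form_iff
    by (intro conjI allI linear_sweedler2_param linear_mult_left linear_mult_right linear_mul[of "J _"] J_linear)
  have g2: "bilinear_form H (?g b1 b2)" for b1 b2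
    unfolding bilinear_form_iff
    by (intro conjI allI linear_mult_left linear_mult_right linear_mul[of "J _"] J_linear)
  have "sw (\<lambda>a1 a2. sw (?f a1 a2) (T' a b)) (T i j) = sw (\<lambda>b1 b2. sw (?g b1 b2) (T'' m n)) (T' a b)"
    using cocycle unfolding hopf_2_cocycle_def by blast
  then show ?thesis
    unfolding mult_matrix_sweedler[OF T f1 mem(1,2)] mult_matrix_sweedler[OF T' g1 mem(3,4)]
    unfolding mult_matrix_sweedler[OF T' f2 mem(3,4)] mult_matrix_sweedler[OF T'' g2 mem(5,6)]
      sum_times fst_conv snd_conv .
qed

text \<open>The antipode axiom under a linear form, in the shapes that the cocycle identity produces.\<close>

lemma contract_left:
  assumes T: "mult_matrix H I T" and f: "linear_form H f" and "k \<in> I" "l \<in> I"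
  shows "(\<Sum>i\<in>I. f (M (M (S (T k i)) (T i l)) x)) = (if k = l then f x else 0)"
proof -
  have "(\<Sum>i\<in>I. f (M (M (S (T k i)) (T i l)) x)) = f (M (\<Sum>i\<in>I. M (S (T k i)) (T i l)) x)"
    by (simp add: mul_sum linear_form_sum[OF f])
  then show ?thesis using assms by (simp add: mult_matrix_antipode[OF T] unit_left mul_zero linear_form_zero[OF f])
qed

lemma contract_right:
  assumes T: "mult_matrix H I T" and f: "linear_form H f" and "k \<in> I" "l \<in> I"
  shows "(\<Sum>i\<in>I. f (M (T k i) (S (T i l)))) = (if k = l then f (unit H) else 0)"
  using assms by (simp add: linear_form_sum[OF f, symmetric] mult_matrix_antipode[OF T] linear_form_zero[OF f])

lemma contract_left_unit:
  assumes T: "mult_matrix H I T" and f: "linear_form H f" and "k \<in> I" "l \<in> I"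
  shows "(\<Sum>i\<in>I. f (M (S (T k i)) (T i l))) = (if k = l then f (unit H) else 0)"
  using contract_left[OF assms, of "unit H"] by (simp add: unit_right)

text \<open>
  The cocycle identity for \<open>(S(T), T, S(T))\<close>, with its rightmost factor moved to the other side as \<open>K\<close> and then
  contracted twice.
\<close>

lemma q_q'_matrix:
  fixes T :: "'i \<Rightarrow> 'i \<Rightarrow> 'b"
  assumes T: "mult_matrix H I T" and jm: "j \<in> I" "m \<in> I"
  shows "(\<Sum>b\<in>I. q (T j b) * q' (T b m)) = (if j = m then 1 else 0)"
proof -
  have fin: "finite I" by (rule mult_matrix_finite[OF T])
  let ?Y = "dual_matrix H T"
  have Y: "mult_matrix H I ?Y" by (rule mult_matrix_dual[OF T])
  define f where "f i s p = J (M (?Y i (fst p)) (T i (snd p))) (?Y m (snd s))" for i and s p :: "'i \<times> 'i"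
  define g where "g s p = J (?Y (fst p) j) (T (snd p) (fst s))" for s p :: "'i \<times> 'i"
  define h where "h s e = K (T (fst s) e) (?Y (snd s) e)" for s :: "'i \<times> 'i" and e
  \<comment> \<open>to be summed over \<open>i\<close>, which contracts \<open>S(T)\<close> with \<open>T\<close> in \<open>f\<close>, and over \<open>e\<close>, which contracts the right-hand side\<close>
  have step: "(\<Sum>s\<in>I \<times> I. (\<Sum>p\<in>I \<times> I. f i s p * g s p) * h s e) = J (?Y i j) (M (T i e) (?Y m e))"
    if ie: "i \<in> I" "e \<in> I" for i e
  proof -
    have "(\<Sum>s\<in>I \<times> I. (\<Sum>p\<in>I \<times> I. f i s p * g s p) * h s e) =
       (\<Sum>s\<in>I \<times> I. (\<Sum>p\<in>I \<times> I. J (?Y i j) (M (T i (fst p)) (?Y m (snd p))) * J (T (fst p) (fst s)) (?Y (snd p) (snd s))) * h s e)"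
    proof (rule sum.cong[OF refl])
      fix s assume "s \<in> I \<times> I"
      then have "fst s \<in> I" "snd s \<in> I" by auto
      from cocycle_matrix[OF Y T Y ie(1) jm(1) ie(1) this(1) jm(2) this(2)]
      show "(\<Sum>p\<in>I \<times> I. f i s p * g s p) * h s e = (\<Sum>p\<in>I \<times> I. J (?Y i j) (M (T i (fst p)) (?Y m (snd p))) *
          J (T (fst p) (fst s)) (?Y (snd p) (snd s))) * h s e"
        unfolding f_def g_def by simp
    qed
    also have "\<dots> = (\<Sum>p\<in>I \<times> I. J (?Y i j) (M (T i (fst p)) (?Y m (snd p))) *
        (\<Sum>s\<in>I \<times> I. J (T (fst p) (fst s)) (?Y (snd p) (snd s)) * h s e))"
      unfolding sum_distrib_left sum_distrib_right mult.assoc by (rule sum.swap)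
    also have "\<dots> = (\<Sum>p\<in>I \<times> I. J (?Y i j) (M (T i (fst p)) (?Y m (snd p))) * (if p = (e, e) then 1 else 0))"
      unfolding h_def using JK_matrix(1)[OF T Y, of _ "(e, e)"] ie by (intro sum.cong refl) simp
    also have "\<dots> = J (?Y i j) (M (T i e) (?Y m e))"
      by (subst sum_delta_left(4)[of "I \<times> I" "(e, e)"]) (use fin ie in auto)
    finally show ?thesis .
  qed
  have "(\<Sum>i\<in>I. \<Sum>e\<in>I. \<Sum>s\<in>I \<times> I. (\<Sum>p\<in>I \<times> I. f i s p * g s p) * h s e) =
      (\<Sum>i\<in>I. \<Sum>e\<in>I. J (?Y i j) (M (T i e) (S (T e m))))"
    by (intro sum.cong refl) (simp add: step dual_matrix_def)
  also have "\<dots> = (\<Sum>i\<in>I. if i = m then J (?Y i j) (unit H) else 0)"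
    by (intro sum.cong refl) (simp add: contract_right[OF T J_linear(2)] jm)
  also have "\<dots> = (if j = m then 1 else 0)"
    using fin jm by (auto simp: J_unit mult_matrix_counit[OF Y])
  finally have R: "(\<Sum>i\<in>I. \<Sum>e\<in>I. \<Sum>s\<in>I \<times> I. (\<Sum>p\<in>I \<times> I. f i s p * g s p) * h s e) = (if j = m then 1 else 0)" .
  have "(\<Sum>i\<in>I. \<Sum>e\<in>I. \<Sum>s\<in>I \<times> I. (\<Sum>p\<in>I \<times> I. f i s p * g s p) * h s e) =
      (\<Sum>i\<in>I. \<Sum>s\<in>I \<times> I. \<Sum>e\<in>I. (\<Sum>p\<in>I \<times> I. f i s p * g s p) * h s e)"
    by (rule sum.cong[OF refl], rule sum.swap)
  also have "\<dots> = (\<Sum>s\<in>I \<times> I. \<Sum>i\<in>I. (\<Sum>p\<in>I \<times> I. f i s p * g s p) * (\<Sum>e\<in>I. h s e))"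
    unfolding sum_distrib_left by (rule sum.swap)
  also have "\<dots> = (\<Sum>s\<in>I \<times> I. (\<Sum>p\<in>I \<times> I. (\<Sum>i\<in>I. f i s p) * g s p) * (\<Sum>e\<in>I. h s e))"
  proof -
    have "(\<Sum>i\<in>I. \<Sum>p\<in>I \<times> I. f i s p * g s p) = (\<Sum>p\<in>I \<times> I. (\<Sum>i\<in>I. f i s p) * g s p)" for s
      unfolding sum_distrib_right by (rule sum.swap)
    then show ?thesis unfolding sum_distrib_right[of _ I, symmetric] by (simp only:)
  qed
  also have "\<dots> = (\<Sum>s\<in>I \<times> I. (if m = snd s then q (T j (fst s)) else 0) * q' (T (fst s) (snd s)))"
  proof (rule sum.cong[OF refl])
    fix s assume "s \<in> I \<times> I"
    then have s: "fst s \<in> I" "snd s \<in> I" by auto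
    have f: "(\<Sum>i\<in>I. f i s p) = (if fst p = snd p then (if m = snd s then 1 else 0) else 0)" if "p \<in> I \<times> I" for p
      using that s jm contract_left_unit[OF T J_linear(1), of "fst p" "snd p"]
      by (auto simp: f_def dual_matrix_def J_unit counit_antipode[OF T])
    have "(\<Sum>p\<in>I \<times> I. (\<Sum>i\<in>I. f i s p) * g s p) = (\<Sum>p\<in>I \<times> I. (if fst p = snd p then (if m = snd s then 1 else 0) else 0) * g s p)"
      by (intro sum.cong refl) (simp only: f)
    also have "\<dots> = (\<Sum>a\<in>I. \<Sum>b\<in>I. if a = b then (if m = snd s then 1 else 0) * g s (a, b) else 0)"
      unfolding sum_times by (intro sum.cong refl) simp
    also have "\<dots> = (\<Sum>a\<in>I. (if m = snd s then 1 else 0) * g s (a, a))"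
      using fin by simp
    also have "\<dots> = (if m = snd s then q (T j (fst s)) else 0)"
      using s jm by (simp add: q_matrix[OF T] g_def dual_matrix_def)
    finally have "(\<Sum>p\<in>I \<times> I. (\<Sum>i\<in>I. f i s p) * g s p) = (if m = snd s then q (T j (fst s)) else 0)" .
    moreover have "(\<Sum>e\<in>I. h s e) = q' (T (fst s) (snd s))"
      using s by (simp add: q'_matrix[OF T] h_def dual_matrix_def)
    ultimately show "(\<Sum>p\<in>I \<times> I. (\<Sum>i\<in>I. f i s p) * g s p) * (\<Sum>e\<in>I. h s e) =
      (if m = snd s then q (T j (fst s)) else 0) * q' (T (fst s) (snd s))" by simp
  qed
  also have "\<dots> = (\<Sum>b\<in>I. \<Sum>n\<in>I. if m = n then q (T j b) * q' (T b n) else 0)"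
    unfolding sum_times by (intro sum.cong refl) simp
  also have "\<dots> = (\<Sum>b\<in>I. q (T j b) * q' (T b m))" using fin jm by simp
  finally show ?thesis using R by simp
qed

lemma q'_q_matrix:
  assumes T: "mult_matrix H I T" and jm: "j \<in> I" "m \<in> I"
  shows "(\<Sum>b\<in>I. q' (T j b) * q (T b m)) = (if j = m then 1 else 0)"
proof -
  have fin: "finite I" by (rule mult_matrix_finite[OF T])
  let ?A = "restrict_mat I (\<lambda>i j. q (T i j))" and ?B = "restrict_mat I (\<lambda>i j. q' (T i j))"
  have "mm I ?A ?B = idm I"
    by (rule matrices_eqI[OF mm_matrices[OF restrict_mat_matrices restrict_mat_matrices] idm_matrices])
       (simp add: mm_restrict q_q'_matrix[OF T] idm_def)
  then have "mm I ?B ?A = idm I"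
    by (rule left_inverse_of_right_inverse[OF fin restrict_mat_matrices restrict_mat_matrices])
  then have "mm I ?B ?A j m = idm I j m" by simp
  then show ?thesis using jm by (simp add: mm_restrict idm_def)
qed

lemma q_u_matrix:
  assumes T: "mult_matrix H I T" and ij: "i \<in> I" "j \<in> I"
  shows "(\<Sum>l\<in>I. q (T i l) * u (T l j)) = q (S (T i j))"
proof -
  have fin: "finite I" by (rule mult_matrix_finite[OF T])
  have "(\<Sum>l\<in>I. q (T i l) * u (T l j)) = (\<Sum>l\<in>I. \<Sum>r\<in>I. q (T i l) * q' (T l r) * q (S (T r j)))"
    using ij by (simp add: u_matrix[OF T] sum_distrib_left mult.assoc)
  also have "\<dots> = (\<Sum>r\<in>I. (\<Sum>l\<in>I. q (T i l) * q' (T l r)) * q (S (T r j)))"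
    unfolding sum_distrib_right by (rule sum.swap)
  also have "\<dots> = (\<Sum>r\<in>I. (if i = r then 1 else 0) * q (S (T r j)))"
    by (intro sum.cong refl) (simp only: q_q'_matrix[OF T ij(1)])
  also have "\<dots> = q (S (T i j))" by (rule sum_delta_left(1)[OF fin ij(1)])
  finally show ?thesis .
qed

text \<open>
  In the dual algebra this reads \<open>(S \<otimes> S)(J\<^sub>2\<^sub>1) * \<Delta>(q) * J = q \<otimes> q\<close>.  It follows from two applications of the cocycle
  identity, each of which produces a contraction of \<open>S(T)\<close> with \<open>T\<close>.
\<close>

lemma comultiplication_q:
  assumes T: "mult_matrix H I T" and T': "mult_matrix H I' T'"
    and mem: "i \<in> I" "j \<in> I" "m \<in> I'" "n \<in> I'"
  shows "(\<Sum>p\<in>I \<times> I'. J (S (T' m (snd p))) (S (T i (fst p))) *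
      (\<Sum>s\<in>I \<times> I'. q (tensor_matrix H T T' p s) * J (T (fst s) j) (T' (snd s) n))) = q (T i j) * q (T' m n)"
proof -
  let ?P = "I \<times> I'" and ?W = "tensor_matrix H T T'" and ?X = "dual_matrix H T'" and ?Y = "dual_matrix H T"
  have fin: "finite I" "finite I'" using T T' by (simp_all add: mult_matrix_def)
  have W: "mult_matrix H ?P ?W" by (rule mult_matrix_tensor[OF T T'])
  have X: "mult_matrix H I' ?X" and Y: "mult_matrix H I ?Y" by (intro mult_matrix_dual T T')+
  define A where "A p = J (S (T' m (snd p))) (S (T i (fst p)))" for p
  define G where "G p r s = J (M (S (T (fst p) (fst r))) (S (T' (snd p) (snd r)))) (?W r s)" for p r s
  define jj where "jj s = J (T (fst s) j) (T' (snd s) n)" for s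
  define B where "B l v s = J (S (T i l)) (M (T l (fst s)) (T' v (snd s)))" for l v s
  \<comment> \<open>the left-hand side is a sum of \<open>A p * G p r s * jj s\<close>; sum over \<open>p\<close> by the cocycle identity for \<open>(S(T'), S(T), W)\<close>,\<close>
  \<comment> \<open>then over \<open>r\<close> by contraction, and over \<open>s\<close> by the cocycle identity for \<open>(S(T), T, T')\<close>\<close>
  have DQ: "q (?W p s) = (\<Sum>r\<in>?P. G p r s)" if "p \<in> ?P" "s \<in> ?P" for p s
    unfolding q_matrix[OF W that] G_def using that
    by (intro sum.cong refl arg_cong2[where f = J])
       (auto simp: tensor_matrix_def antipode_mul[OF T T'])
  have first: "(\<Sum>p\<in>?P. A p * G p r s) =
      (\<Sum>t\<in>I \<times> ?P. J (S (T' m (snd r))) (M (S (T (fst t) (fst r))) (?W r (snd t))) * J (S (T i (fst t))) (?W (snd t) s))"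
    if rs: "r \<in> ?P" "s \<in> ?P" for r s
  proof -
    have r: "fst r \<in> I" "snd r \<in> I'" using rs by auto
    have "(\<Sum>p\<in>?P. A p * G p r s) =
       (\<Sum>p\<in>I' \<times> I. J (S (T' m (fst p))) (S (T i (snd p))) * J (M (S (T (snd p) (fst r))) (S (T' (fst p) (snd r)))) (?W r s))"
      unfolding A_def G_def by (rule sum_times_swap)
    also have "\<dots> = (\<Sum>p\<in>I' \<times> I. J (M (?X (snd r) (fst p)) (?Y (fst r) (snd p))) (?W r s) * J (?X (fst p) m) (?Y (snd p) i))"
      unfolding dual_matrix_def by (intro sum.cong refl) (metis mul_commute mult.commute)
    also have "\<dots> = (\<Sum>t\<in>I \<times> ?P. J (?X (snd r) m) (M (?Y (fst r) (fst t)) (?W r (snd t))) * J (?Y (fst t) i) (?W (snd t) s))"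
      by (rule cocycle_matrix[OF X Y W r(2) mem(3) r(1) mem(1) rs])
    finally show ?thesis by (simp only: dual_matrix_def)
  qed
  have second: "(\<Sum>r\<in>?P. \<Sum>p\<in>?P. A p * G p r s) = (\<Sum>v\<in>I'. q (T' m v) * (\<Sum>l\<in>I. B l v s))" if s: "s \<in> ?P" for s
  proof -
    have inner: "(\<Sum>r\<in>?P. J (S (T' m (snd r))) (M (S (T l (fst r))) (?W r w))) =
        (if l = fst w then q (T' m (snd w)) else 0)" if lw: "l \<in> I" "w \<in> ?P" for l w
    proof -
      have w: "fst w \<in> I" "snd w \<in> I'" using lw by auto
      have "(\<Sum>r\<in>?P. J (S (T' m (snd r))) (M (S (T l (fst r))) (?W r w))) =
          (\<Sum>b\<in>I'. \<Sum>a\<in>I. J (S (T' m b)) (M (M (S (T l a)) (T a (fst w))) (T' b (snd w))))"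
        unfolding sum_times tensor_matrix_def fst_conv snd_conv mul_assoc by (rule sum.swap)
      also have "\<dots> = (\<Sum>b\<in>I'. if l = fst w then J (S (T' m b)) (T' b (snd w)) else 0)"
        by (intro sum.cong refl contract_left[OF T J_linear(2) lw(1) w(1)])
      also have "\<dots> = (if l = fst w then q (T' m (snd w)) else 0)"
        by (simp add: q_matrix[OF T' mem(3) w(2)])
      finally show ?thesis .
    qed
    have "(\<Sum>r\<in>?P. \<Sum>p\<in>?P. A p * G p r s) = (\<Sum>r\<in>?P. \<Sum>t\<in>I \<times> ?P.
        J (S (T' m (snd r))) (M (S (T (fst t) (fst r))) (?W r (snd t))) * J (S (T i (fst t))) (?W (snd t) s))"
      by (intro sum.cong refl first s)
    also have "\<dots> = (\<Sum>t\<in>I \<times> ?P. (\<Sum>r\<in>?P. J (S (T' m (snd r))) (M (S (T (fst t) (fst r))) (?W r (snd t)))) *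
        J (S (T i (fst t))) (?W (snd t) s))"
      unfolding sum_distrib_right by (rule sum.swap)
    also have "\<dots> = (\<Sum>t\<in>I \<times> ?P. (if fst t = fst (snd t) then q (T' m (snd (snd t))) else 0) *
        J (S (T i (fst t))) (?W (snd t) s))"
      by (intro sum.cong refl) (use inner in auto)
    also have "\<dots> = (\<Sum>l\<in>I. \<Sum>a\<in>I. \<Sum>v\<in>I'. if l = a then q (T' m v) * B a v s else 0)"
      unfolding sum_times by (intro sum.cong refl) (simp add: B_def tensor_matrix_def)
    also have "\<dots> = (\<Sum>l\<in>I. \<Sum>v\<in>I'. \<Sum>a\<in>I. if l = a then q (T' m v) * B a v s else 0)"
      by (rule sum.cong[OF refl], rule sum.swap)
    also have "\<dots> = (\<Sum>l\<in>I. \<Sum>v\<in>I'. q (T' m v) * B l v s)" using fin by simp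
    also have "\<dots> = (\<Sum>v\<in>I'. q (T' m v) * (\<Sum>l\<in>I. B l v s))"
      unfolding sum_distrib_left by (rule sum.swap)
    finally show ?thesis .
  qed
  have third: "(\<Sum>l\<in>I. \<Sum>s\<in>?P. B l v s * jj s) = (if v = n then q (T i j) else 0)" if v: "v \<in> I'" for v
  proof -
    have "(\<Sum>l\<in>I. \<Sum>s\<in>?P. B l v s * jj s) =
        (\<Sum>l\<in>I. \<Sum>p\<in>I \<times> I. J (M (?Y l (fst p)) (T l (snd p))) (T' v n) * J (?Y (fst p) i) (T (snd p) j))"
    proof (rule sum.cong[OF refl])
      fix l assume l: "l \<in> I"
      show "(\<Sum>s\<in>?P. B l v s * jj s) = (\<Sum>p\<in>I \<times> I. J (M (?Y l (fst p)) (T l (snd p))) (T' v n) * J (?Y (fst p) i) (T (snd p) j))"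
        using cocycle_matrix[OF Y T T' l mem(1) l mem(2) v mem(4), symmetric] unfolding B_def jj_def dual_matrix_def .
    qed
    also have "\<dots> = (\<Sum>p\<in>I \<times> I. (\<Sum>l\<in>I. J (M (S (T (fst p) l)) (T l (snd p))) (T' v n)) * J (S (T i (fst p))) (T (snd p) j))"
      unfolding sum_distrib_right dual_matrix_def by (rule sum.swap)
    also have "\<dots> = (\<Sum>p\<in>I \<times> I. (if fst p = snd p then (if v = n then 1 else 0) else 0) * J (S (T i (fst p))) (T (snd p) j))"
    proof (rule sum.cong[OF refl])
      fix p assume "p \<in> I \<times> I"
      then have "fst p \<in> I" "snd p \<in> I" by auto
      from contract_left_unit[OF T J_linear(1) this, of "T' v n"]
      show "(\<Sum>l\<in>I. J (M (S (T (fst p) l)) (T l (snd p))) (T' v n)) * J (S (T i (fst p))) (T (snd p) j) =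
          (if fst p = snd p then (if v = n then 1 else 0) else 0) * J (S (T i (fst p))) (T (snd p) j)"
        by (simp add: J_unit mult_matrix_counit[OF T' v mem(4)])
    qed
    also have "\<dots> = (\<Sum>a\<in>I. \<Sum>b\<in>I. if a = b then (if v = n then 1 else 0) * J (S (T i a)) (T b j) else 0)"
      unfolding sum_times by (intro sum.cong refl) simp
    also have "\<dots> = (\<Sum>a\<in>I. (if v = n then 1 else 0) * J (S (T i a)) (T a j))" using fin by simp
    also have "\<dots> = (if v = n then q (T i j) else 0)" by (simp add: q_matrix[OF T mem(1,2)])
    finally show ?thesis .
  qed
  have "(\<Sum>p\<in>?P. A p * (\<Sum>s\<in>?P. q (?W p s) * jj s)) = (\<Sum>p\<in>?P. \<Sum>s\<in>?P. (\<Sum>r\<in>?P. A p * G p r s) * jj s)"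
  proof (rule sum.cong[OF refl])
    fix p assume p: "p \<in> ?P"
    have "A p * (q (?W p s) * jj s) = (\<Sum>r\<in>?P. A p * G p r s) * jj s" if "s \<in> ?P" for s
      by (simp only: DQ[OF p that] sum_distrib_left[symmetric] mult.assoc)
    then show "A p * (\<Sum>s\<in>?P. q (?W p s) * jj s) = (\<Sum>s\<in>?P. (\<Sum>r\<in>?P. A p * G p r s) * jj s)"
      unfolding sum_distrib_left[of "A p" "\<lambda>s. q (?W p s) * jj s"] by (intro sum.cong refl)
  qed
  also have "\<dots> = (\<Sum>s\<in>?P. (\<Sum>p\<in>?P. \<Sum>r\<in>?P. A p * G p r s) * jj s)"
    unfolding sum_distrib_right by (rule sum.swap)
  also have "\<dots> = (\<Sum>s\<in>?P. (\<Sum>v\<in>I'. q (T' m v) * (\<Sum>l\<in>I. B l v s)) * jj s)"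
  proof (rule sum.cong[OF refl])
    fix s assume s: "s \<in> ?P"
    have "(\<Sum>p\<in>?P. \<Sum>r\<in>?P. A p * G p r s) = (\<Sum>r\<in>?P. \<Sum>p\<in>?P. A p * G p r s)" by (rule sum.swap)
    then show "(\<Sum>p\<in>?P. \<Sum>r\<in>?P. A p * G p r s) * jj s = (\<Sum>v\<in>I'. q (T' m v) * (\<Sum>l\<in>I. B l v s)) * jj s"
      by (simp only: second[OF s])
  qed
  also have "\<dots> = (\<Sum>v\<in>I'. \<Sum>s\<in>?P. q (T' m v) * ((\<Sum>l\<in>I. B l v s) * jj s))"
    unfolding sum_distrib_right[of _ I'] mult.assoc by (rule sum.swap)
  also have "\<dots> = (\<Sum>v\<in>I'. q (T' m v) * (\<Sum>l\<in>I. \<Sum>s\<in>?P. B l v s * jj s))"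
  proof (rule sum.cong[OF refl])
    fix v
    have "(\<Sum>s\<in>?P. (\<Sum>l\<in>I. B l v s) * jj s) = (\<Sum>l\<in>I. \<Sum>s\<in>?P. B l v s * jj s)"
      unfolding sum_distrib_right by (rule sum.swap)
    then show "(\<Sum>s\<in>?P. q (T' m v) * ((\<Sum>l\<in>I. B l v s) * jj s)) = q (T' m v) * (\<Sum>l\<in>I. \<Sum>s\<in>?P. B l v s * jj s)"
      by (simp only: sum_distrib_left[symmetric])
  qed
  also have "\<dots> = (\<Sum>v\<in>I'. q (T' m v) * (if v = n then q (T i j) else 0))"
    by (intro sum.cong refl) (simp only: third)
  also have "\<dots> = q (T i j) * q (T' m n)"
    using fin mem by (simp add: if_distrib[of "\<lambda>x. _ * x"] cong: if_cong)
  finally show ?thesis by (simp only: A_def jj_def)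
qed

text \<open>
  The same identity for the dual matrices has the same outer factor, so that \<open>u = q' * (q \<circ> S)\<close> satisfies
  \<open>\<Delta>(u) * J = J * (u \<otimes> u)\<close>: it is a character of the twisted algebra.
\<close>

lemma u_grouplike:
  fixes T :: "'i \<Rightarrow> 'i \<Rightarrow> 'b" and T' :: "'j \<Rightarrow> 'j \<Rightarrow> 'b"
  assumes T: "mult_matrix H I T" and T': "mult_matrix H I' T'"
    and ps: "p \<in> I \<times> I'" "s \<in> I \<times> I'"
  shows "(\<Sum>r\<in>I \<times> I'. u (tensor_matrix H T T' p r) * J (T (fst r) (fst s)) (T' (snd r) (snd s))) =
    (\<Sum>r\<in>I \<times> I'. J (T (fst p) (fst r)) (T' (snd p) (snd r)) * (u (T (fst r) (fst s)) * u (T' (snd r) (snd s))))"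
proof -
  let ?P = "I \<times> I'" and ?W = "tensor_matrix H T T'" and ?X = "dual_matrix H T'" and ?Y = "dual_matrix H T"
  have fin: "finite I" "finite I'" using T T' by (simp_all add: mult_matrix_def)
  then have finP: "finite ?P" by simp
  have W: "mult_matrix H ?P ?W" by (rule mult_matrix_tensor[OF T T'])
  have X: "mult_matrix H I' ?X" and Y: "mult_matrix H I ?Y" by (intro mult_matrix_dual T T')+
  define R :: "('i \<times> 'j \<Rightarrow> 'i \<times> 'j \<Rightarrow> 'k) \<Rightarrow> 'i \<times> 'j \<Rightarrow> 'i \<times> 'j \<Rightarrow> 'k" where "R = restrict_mat ?P"
  define A where "A = R (\<lambda>s p. J (S (T' (snd s) (snd p))) (S (T (fst s) (fst p))))"
  define DQ where "DQ = R (\<lambda>p s. q (?W p s))"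
  define DS where "DS = R (\<lambda>p s. q (S (?W p s)))"
  define DU where "DU = R (\<lambda>p s. u (?W p s))"
  define Jm where "Jm = R (\<lambda>p s. J (T (fst p) (fst s)) (T' (snd p) (snd s)))"
  define Km where "Km = R (\<lambda>p s. K (T (fst p) (fst s)) (T' (snd p) (snd s)))"
  define Q where "Q = R (\<lambda>p s. q (T (fst p) (fst s)) * q (T' (snd p) (snd s)))"
  define Q' where "Q' = R (\<lambda>p s. q' (T (fst p) (fst s)) * q' (T' (snd p) (snd s)))"
  define QS where "QS = R (\<lambda>p s. q (S (T (fst p) (fst s))) * q (S (T' (snd p) (snd s))))"
  define UU where "UU = R (\<lambda>p s. u (T (fst p) (fst s)) * u (T' (snd p) (snd s)))"
  note defs = A_def DQ_def DS_def DU_def Jm_def Km_def Q_def Q'_def QS_def UU_def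
  have mat: "R f \<in> matrices ?P" for f unfolding R_def by (rule restrict_mat_matrices)
  have entry: "mm ?P (R f) (R g) a b = (\<Sum>l\<in>?P. f a l * g l b)" if "a \<in> ?P" "b \<in> ?P" for f g a b
    unfolding R_def by (rule mm_restrict[OF that])
  have Rin: "R f a b = f a b" if "a \<in> ?P" "b \<in> ?P" for f a b
    unfolding R_def by (rule restrict_mat_in[OF that])
  have eqI: "mm ?P (R f) (R g) = R h"
    if "\<And>a b. a \<in> ?P \<Longrightarrow> b \<in> ?P \<Longrightarrow> (\<Sum>l\<in>?P. f a l * g l b) = h a b" for f g h
    by (rule matrices_eqI[OF mm_matrices[OF mat mat] mat]) (simp add: entry Rin that)
  have id: "idm ?P = R (\<lambda>a b. if a = b then 1 else 0)"
    by (auto simp: R_def idm_def restrict_mat_def fun_eq_iff)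
  have split: "(\<Sum>l\<in>?P. (f (fst a) (fst l) * f' (snd a) (snd l)) * (g (fst l) (fst b) * g' (snd l) (snd b))) =
      (\<Sum>l\<in>I. f (fst a) l * g l (fst b)) * (\<Sum>l\<in>I'. f' (snd a) l * g' l (snd b))"
    for f g :: "'i \<Rightarrow> 'i \<Rightarrow> 'k" and f' g' :: "'j \<Rightarrow> 'j \<Rightarrow> 'k" and a b
    unfolding sum_times fst_conv snd_conv sum_product by (intro sum.cong refl) (simp only: ac_simps)
  have JK: "mm ?P Jm Km = idm ?P" "mm ?P Km Jm = idm ?P"
    unfolding defs id using JK_matrix[OF T T'] by (intro eqI; simp)+
  have Q'Q: "mm ?P Q' Q = idm ?P"
    unfolding defs id
  proof (rule eqI)
    fix a b assume "a \<in> ?P" "b \<in> ?P"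
    then have mem: "fst a \<in> I" "fst b \<in> I" "snd a \<in> I'" "snd b \<in> I'" by auto
    show "(\<Sum>l\<in>?P. q' (T (fst a) (fst l)) * q' (T' (snd a) (snd l)) * (q (T (fst l) (fst b)) * q (T' (snd l) (snd b)))) =
        (if a = b then 1 else 0)"
      unfolding split[where f = "\<lambda>x y. q' (T x y)" and f' = "\<lambda>x y. q' (T' x y)" and g = "\<lambda>x y. q (T x y)" and g' = "\<lambda>x y. q (T' x y)"]
        q'_q_matrix[OF T mem(1,2)] q'_q_matrix[OF T' mem(3,4)]
      by (simp add: prod_eq_iff)
  qed
  have QUU: "mm ?P Q UU = QS"
    unfolding defs
  proof (rule eqI)
    fix a b assume "a \<in> ?P" "b \<in> ?P"
    then have mem: "fst a \<in> I" "fst b \<in> I" "snd a \<in> I'" "snd b \<in> I'" by auto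
    show "(\<Sum>l\<in>?P. q (T (fst a) (fst l)) * q (T' (snd a) (snd l)) * (u (T (fst l) (fst b)) * u (T' (snd l) (snd b)))) =
        q (S (T (fst a) (fst b))) * q (S (T' (snd a) (snd b)))"
      unfolding split[where f = "\<lambda>x y. q (T x y)" and f' = "\<lambda>x y. q (T' x y)" and g = "\<lambda>x y. u (T x y)" and g' = "\<lambda>x y. u (T' x y)"]
        q_u_matrix[OF T mem(1,2)] q_u_matrix[OF T' mem(3,4)] ..
  qed
  have DQU: "mm ?P DQ DU = DS"
    unfolding defs by (rule eqI) (rule q_u_matrix[OF W])
  have first: "mm ?P A (mm ?P DQ Jm) = Q"
  proof (rule matrices_eqI)
    show "mm ?P A (mm ?P DQ Jm) \<in> matrices ?P" "Q \<in> matrices ?P" unfolding defs by (intro mm_matrices mat)+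
    fix a b assume ab: "a \<in> ?P" "b \<in> ?P"
    then have mem: "fst a \<in> I" "fst b \<in> I" "snd a \<in> I'" "snd b \<in> I'" by auto
    have "mm ?P A (mm ?P DQ Jm) a b = (\<Sum>p\<in>?P. J (S (T' (snd a) (snd p))) (S (T (fst a) (fst p))) *
      (\<Sum>s\<in>?P. q (?W p s) * J (T (fst s) (fst b)) (T' (snd s) (snd b))))"
      unfolding mm_def[of _ A] by (intro sum.cong refl) (simp add: A_def DQ_def Jm_def entry Rin ab)
    also have "\<dots> = Q a b" unfolding Q_def Rin[OF ab] by (rule comultiplication_q[OF T T' mem])
    finally show "mm ?P A (mm ?P DQ Jm) a b = Q a b" .
  qed
  have second: "mm ?P A (mm ?P DS Jm) = QS"
  proof (rule matrices_eqI)
    show "mm ?P A (mm ?P DS Jm) \<in> matrices ?P" "QS \<in> matrices ?P" unfolding defs by (intro mm_matrices mat)+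
    fix a b assume ab: "a \<in> ?P" "b \<in> ?P"
    then have mem: "fst a \<in> I" "fst b \<in> I" "snd a \<in> I'" "snd b \<in> I'" by auto
    have W': "tensor_matrix H ?X ?Y (snd p, fst p) (snd s, fst s) = S (?W s p)" if "s \<in> ?P" "p \<in> ?P" for p s
      using that by (auto simp: tensor_matrix_def dual_matrix_def antipode_mul[OF T T'] mul_commute)
    have "(\<Sum>p\<in>I' \<times> I. J (S (?Y (fst b) (snd p))) (S (?X (snd b) (fst p))) *
        (\<Sum>s\<in>I' \<times> I. q (tensor_matrix H ?X ?Y p s) * J (?X (fst s) (snd a)) (?Y (snd s) (fst a)))) =
        q (?X (snd b) (snd a)) * q (?Y (fst b) (fst a))"
      by (rule comultiplication_q[OF X Y mem(4,3,2,1)])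
    also have "(\<Sum>p\<in>I' \<times> I. J (S (?Y (fst b) (snd p))) (S (?X (snd b) (fst p))) *
        (\<Sum>s\<in>I' \<times> I. q (tensor_matrix H ?X ?Y p s) * J (?X (fst s) (snd a)) (?Y (snd s) (fst a)))) =
      (\<Sum>p\<in>?P. J (S (?Y (fst b) (fst p))) (S (?X (snd b) (snd p))) *
        (\<Sum>s\<in>?P. q (tensor_matrix H ?X ?Y (snd p, fst p) (snd s, fst s)) * J (?X (snd s) (snd a)) (?Y (fst s) (fst a))))"
      using sum_times_swap[of "\<lambda>x y. J (S (?Y (fst b) y)) (S (?X (snd b) x)) *
          (\<Sum>s\<in>I' \<times> I. q (tensor_matrix H ?X ?Y (x, y) s) * J (?X (fst s) (snd a)) (?Y (snd s) (fst a)))" I' I]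
        sum_times_swap[of "\<lambda>x' y'. q (tensor_matrix H ?X ?Y (_, _) (x', y')) * J (?X x' (snd a)) (?Y y' (fst a))" I' I]
      by simp
    also have "\<dots> = (\<Sum>p\<in>?P. J (T (fst p) (fst b)) (T' (snd p) (snd b)) *
        (\<Sum>s\<in>?P. q (S (?W s p)) * J (S (T' (snd a) (snd s))) (S (T (fst a) (fst s)))))"
    proof (rule sum.cong[OF refl])
      fix p assume p: "p \<in> ?P"
      then have pm: "fst p \<in> I" "snd p \<in> I'" by auto
      have "(\<Sum>s\<in>?P. q (tensor_matrix H ?X ?Y (snd p, fst p) (snd s, fst s)) * J (?X (snd s) (snd a)) (?Y (fst s) (fst a))) =
          (\<Sum>s\<in>?P. q (S (?W s p)) * J (S (T' (snd a) (snd s))) (S (T (fst a) (fst s))))"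
        by (intro sum.cong refl) (simp add: W' p dual_matrix_def)
      then show "J (S (?Y (fst b) (fst p))) (S (?X (snd b) (snd p))) *
          (\<Sum>s\<in>?P. q (tensor_matrix H ?X ?Y (snd p, fst p) (snd s, fst s)) * J (?X (snd s) (snd a)) (?Y (fst s) (fst a))) =
          J (T (fst p) (fst b)) (T' (snd p) (snd b)) *
          (\<Sum>s\<in>?P. q (S (?W s p)) * J (S (T' (snd a) (snd s))) (S (T (fst a) (fst s))))"
        by (simp add: dual_matrix_def antipode_antipode[OF T pm(1) mem(2)] antipode_antipode[OF T' pm(2) mem(4)])
    qed
    also have "\<dots> = mm ?P (mm ?P A DS) Jm a b"
      unfolding mm_def[of _ _ Jm]
      by (intro sum.cong refl) (simp add: A_def DS_def Jm_def entry Rin ab ac_simps)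
    also have "\<dots> = mm ?P A (mm ?P DS Jm) a b" by (simp only: mm_assoc)
    finally show "mm ?P A (mm ?P DS Jm) a b = QS a b" using ab by (simp add: QS_def Rin dual_matrix_def mult.commute)
  qed
  have Jmat: "Jm \<in> matrices ?P" and UUmat: "UU \<in> matrices ?P" and DUmat: "DU \<in> matrices ?P"
    unfolding defs by (intro mat)+
  \<comment> \<open>\<open>A * DQ\<close> is a product of invertible matrices and can be cancelled\<close>
  have ADQ: "mm ?P A DQ = mm ?P Q Km"
  proof -
    have "mm ?P Q Km = mm ?P (mm ?P A DQ) (mm ?P Jm Km)" unfolding first[symmetric] by (simp only: mm_assoc)
    also have "\<dots> = mm ?P A DQ" unfolding JK
      by (rule mm_idm_right[OF finP mm_matrices]) (unfold defs, (rule mat)+)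
    finally show ?thesis by simp
  qed
  have inv: "mm ?P (mm ?P Jm Q') (mm ?P (mm ?P A DQ) Z) = Z" if "Z \<in> matrices ?P" for Z
  proof -
    have KZ: "mm ?P Km Z \<in> matrices ?P" unfolding Km_def by (rule mm_matrices[OF mat that])
    have "mm ?P (mm ?P Jm Q') (mm ?P (mm ?P A DQ) Z) = mm ?P Jm (mm ?P (mm ?P Q' Q) (mm ?P Km Z))"
      unfolding ADQ by (simp only: mm_assoc)
    also have "\<dots> = mm ?P (mm ?P Jm Km) Z" unfolding Q'Q
      by (simp only: mm_idm_left[OF finP KZ] mm_assoc)
    also have "\<dots> = Z" unfolding JK by (rule mm_idm_left[OF finP that])
    finally show ?thesis .
  qed
  have "mm ?P (mm ?P A DQ) (mm ?P Jm UU) = mm ?P (mm ?P A (mm ?P DQ Jm)) UU" by (simp only: mm_assoc)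
  also have "\<dots> = mm ?P A (mm ?P DS Jm)" unfolding first QUU second ..
  also have "\<dots> = mm ?P (mm ?P A DQ) (mm ?P DU Jm)" unfolding DQU[symmetric] by (simp only: mm_assoc)
  finally have "mm ?P Jm UU = mm ?P DU Jm"
    using inv[OF mm_matrices[OF Jmat UUmat]] inv[OF mm_matrices[OF DUmat Jmat]] by metis
  then have "mm ?P DU Jm p s = mm ?P Jm UU p s" by simp
  then show ?thesis by (simp add: DU_def Jm_def UU_def entry ps)
qed

text \<open>
  For an element \<open>\<chi> = \<Sum>i. W i (\<pi> i)\<close> with \<open>\<pi>\<close> a symmetry of \<open>W\<close>, the coproduct of \<open>\<chi>\<close> is cocommutative.  Moving the last
  tensor factor to the front turns \<open>u(\<chi>)\<close> into \<open>(J * K)(\<chi>\<^sub>1, S(\<chi>\<^sub>2)) = \<epsilon>(\<chi>)\<close>.  This is the equality of the quantum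
  and the ordinary trace.
\<close>

lemma u_trace:
  assumes W: "mult_matrix H I W" and \<pi>: "bij_betw \<pi> I I"
    and sym: "\<And>i j. i \<in> I \<Longrightarrow> j \<in> I \<Longrightarrow> W (\<pi> i) (\<pi> j) = W i j"
  shows "(\<Sum>i\<in>I. u (W i (\<pi> i))) = of_nat (card {i\<in>I. \<pi> i = i})"
proof -
  have fin: "finite I" by (rule mult_matrix_finite[OF W])
  have \<pi>I: "\<pi> i \<in> I" if "i \<in> I" for i using \<pi> that by (auto simp: bij_betw_def)
  let ?Y = "dual_matrix H W"
  have Y: "mult_matrix H I ?Y" by (rule mult_matrix_dual[OF W])
  have "(\<Sum>i\<in>I. u (W i (\<pi> i))) = (\<Sum>i\<in>I. \<Sum>c\<in>I. (\<Sum>b\<in>I. K (W i b) (?Y c b)) * (\<Sum>d\<in>I. J (W d i) (?Y (\<pi> d) c)))"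
  proof (intro sum.cong refl)
    fix i assume i: "i \<in> I"
    have "q (S (W c (\<pi> i))) = (\<Sum>d\<in>I. J (W d i) (?Y (\<pi> d) c))" if c: "c \<in> I" for c
    proof -
      have "q (S (W c (\<pi> i))) = (\<Sum>d\<in>I. J (W d (\<pi> i)) (S (W c d)))" by (rule q_S_matrix[OF W c \<pi>I[OF i]])
      also have "\<dots> = (\<Sum>d\<in>I. J (W (\<pi> d) (\<pi> i)) (S (W c (\<pi> d))))"
        by (rule sum.reindex_bij_betw[OF \<pi>, symmetric])
      finally show ?thesis by (simp add: sym i dual_matrix_def)
    qed
    then show "u (W i (\<pi> i)) = (\<Sum>c\<in>I. (\<Sum>b\<in>I. K (W i b) (?Y c b)) * (\<Sum>d\<in>I. J (W d i) (?Y (\<pi> d) c)))"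
      by (simp add: u_matrix[OF W i \<pi>I[OF i]] q'_matrix[OF W i] dual_matrix_def)
  qed
  also have "\<dots> = (\<Sum>r\<in>I \<times> I. \<Sum>t\<in>I \<times> I. J (W (snd t) (fst r)) (?Y (\<pi> (snd t)) (snd r)) * K (W (fst r) (fst t)) (?Y (snd r) (fst t)))"
    unfolding sum_times sum_product fst_conv snd_conv by (simp only: mult.commute[of "K _ _"])
  also have "\<dots> = (\<Sum>t\<in>I \<times> I. \<Sum>r\<in>I \<times> I. J (W (snd t) (fst r)) (?Y (\<pi> (snd t)) (snd r)) * K (W (fst r) (fst t)) (?Y (snd r) (fst t)))"
    by (rule sum.swap)
  also have "\<dots> = (\<Sum>t\<in>I \<times> I. if (snd t, \<pi> (snd t)) = (fst t, fst t) then 1 else 0)"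
  proof (rule sum.cong[OF refl])
    fix t assume "t \<in> I \<times> I"
    then have "(snd t, \<pi> (snd t)) \<in> I \<times> I" "(fst t, fst t) \<in> I \<times> I" using \<pi>I by auto
    from JK_matrix(1)[OF W Y this]
    show "(\<Sum>r\<in>I \<times> I. J (W (snd t) (fst r)) (?Y (\<pi> (snd t)) (snd r)) * K (W (fst r) (fst t)) (?Y (snd r) (fst t))) =
        (if (snd t, \<pi> (snd t)) = (fst t, fst t) then 1 else 0)" by simp
  qed
  also have "\<dots> = (\<Sum>b\<in>I. \<Sum>d\<in>I. if d = b then (if \<pi> b = b then 1 else 0) else 0)"
    unfolding sum_times by (intro sum.cong refl) auto
  also have "\<dots> = (\<Sum>b\<in>I. if \<pi> b = b then 1 else 0)" using fin by simp
  also have "\<dots> = of_nat (card {i\<in>I. \<pi> i = i})"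
    using fin by (simp add: sum.If_cases Int_def)
  finally show ?thesis .
qed

end

section \<open>The square of the twisted antipode\<close>

text \<open>Take the last nonzero vector among the \<open>(N ^^ i) a\<close>.\<close>

lemma nilpotent_kernel_vector:
  fixes N :: "'b \<Rightarrow> 'b::zero"
  assumes "(N ^^ m) a = 0" "a \<noteq> 0" "P a" "\<And>b. P b \<Longrightarrow> P (N b)"
  shows "\<exists>b. b \<noteq> 0 \<and> P b \<and> N b = 0"
  using assms(1-3)
proof (induction m arbitrary: a)
  case (Suc m)
  show ?case
  proof (cases "N a = 0")
    case False
    have "(N ^^ m) (N a) = 0" using Suc.prems(1) by (simp add: funpow_swap1)
    then show ?thesis using Suc.IH False assms(4)[OF Suc.prems(3)] by blast
  qed (use Suc.prems in blast)
qed simp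

context hopf_twist
begin

abbreviation "tS \<equiv> antipode (twist H J)"

lemma linear_form_twisted_antipode:
  assumes \<phi>: "linear_form H \<phi>"
  shows "\<phi> (tS a) = sw (\<lambda>a1. sw (\<lambda>a2. sw (\<lambda>a3. sw (\<lambda>a4 a5. K a1 (S a2) * J (S a4) a5 * \<phi> (S a3))))) a"
proof -
  have "tS a = sweedler2 H (scal H) (\<lambda>a1. sweedler2 H (scal H) (\<lambda>a2. sweedler2 H (scal H) (\<lambda>a3.
      sweedler2 H (scal H) (\<lambda>a4 a5. scal H (K a1 (S a2) * J (S a4) a5) (S a3))))) a"
    by (simp add: twist_def sweedler5_def sweedler4_def sweedler3_def K_def)
  then show ?thesis by (simp only: sweedler2_image[OF \<phi>] linear_form_scal(1)[OF \<phi>])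
qed

lemma twisted_antipode_bilinear:
  assumes \<phi>: "linear_form H \<phi>"
  shows "bilinear_form H (\<lambda>a4 a5. K a1 (S a2) * J (S a4) a5 * \<phi> (S a3))"
    and "bilinear_form H (\<lambda>a3. sw (\<lambda>a4 a5. K a1 (S a2) * J (S a4) a5 * \<phi> (S a3)))"
    and "bilinear_form H (\<lambda>a2. sw (\<lambda>a3. sw (\<lambda>a4 a5. K a1 (S a2) * J (S a4) a5 * \<phi> (S a3))))"
    and "bilinear_form H (\<lambda>a1. sw (\<lambda>a2. sw (\<lambda>a3. sw (\<lambda>a4 a5. K a1 (S a2) * J (S a4) a5 * \<phi> (S a3)))))"
proof -
  note b = bilinear_formD[OF bilinear_q] bilinear_formD[OF bilinear_q'] linear_antipode[OF \<phi>]
  show 1: "bilinear_form H (\<lambda>a4 a5. K a1 (S a2) * J (S a4) a5 * \<phi> (S a3))" for a1 a2 a3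
    unfolding bilinear_form_iff by (intro conjI allI linear_mult_left linear_mult_right b)
  show 2: "bilinear_form H (\<lambda>a3. sw (\<lambda>a4 a5. K a1 (S a2) * J (S a4) a5 * \<phi> (S a3)))" for a1 a2
    unfolding bilinear_form_iff
    by (intro conjI allI linear_sweedler2_param linear_sweedler2 1) (intro linear_mult_left linear_mult_right b)
  show 3: "bilinear_form H (\<lambda>a2. sw (\<lambda>a3. sw (\<lambda>a4 a5. K a1 (S a2) * J (S a4) a5 * \<phi> (S a3))))" for a1
    unfolding bilinear_form_iff
    by (intro conjI allI linear_sweedler2_param linear_sweedler2 2) (intro linear_mult_left linear_mult_right b)
  show "bilinear_form H (\<lambda>a1. sw (\<lambda>a2. sw (\<lambda>a3. sw (\<lambda>a4 a5. K a1 (S a2) * J (S a4) a5 * \<phi> (S a3)))))"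
    unfolding bilinear_form_iff
    by (intro conjI allI linear_sweedler2_param linear_sweedler2 3) (intro linear_mult_left linear_mult_right b)
qed

lemma tS_add: "tS (x + y) = tS x + tS y" and tS_scal: "tS (scal H c x) = scal H c (tS x)"
proof -
  have lin: "linear_form H (\<lambda>a. \<phi> (tS a))" if "linear_form H \<phi>" for \<phi>
    unfolding linear_form_twisted_antipode[OF that] by (rule linear_sweedler2[OF twisted_antipode_bilinear(4)[OF that]])
  show "tS (x + y) = tS x + tS y"
    by (rule linear_forms_separate) (simp add: linear_form_scal lin[THEN linear_form_scal(2)])
  show "tS (scal H c x) = scal H c (tS x)"
    by (rule linear_forms_separate) (simp add: linear_form_scal lin[THEN linear_form_scal(1)])
qed

lemma tS_sum: "tS (\<Sum>l\<in>F. g l) = (\<Sum>l\<in>F. tS (g l))"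
proof -
  have "tS 0 = 0" using tS_scal[of 0 0] by simp
  then show ?thesis by (induction F rule: infinite_finite_induct) (simp_all add: tS_add)
qed

lemma twisted_antipode_matrix:
  assumes T: "mult_matrix H I T" and ij: "i \<in> I" "j \<in> I"
  shows "tS (T i j) = (\<Sum>b\<in>I. \<Sum>c\<in>I. scal H (q' (T i b) * q (T c j)) (S (T b c)))"
proof (rule linear_forms_separate)
  fix \<phi> assume \<phi>: "linear_form H \<phi>"
  note bil = twisted_antipode_bilinear[OF \<phi>]
  have "\<phi> (tS (T i j)) = (\<Sum>a\<in>I. \<Sum>b\<in>I. \<Sum>c\<in>I. \<Sum>d\<in>I.
      K (T i a) (S (T a b)) * J (S (T c d)) (T d j) * \<phi> (S (T b c)))"
    unfolding linear_form_twisted_antipode[OF \<phi>] mult_matrix_sweedler[OF T bil(4) ij]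
    by (intro sum.cong refl) (simp add: ij mult_matrix_sweedler[OF T bil(1)] mult_matrix_sweedler[OF T bil(2)]
        mult_matrix_sweedler[OF T bil(3)] cong: sum.cong)
  also have "\<dots> = (\<Sum>b\<in>I. \<Sum>a\<in>I. \<Sum>c\<in>I. \<Sum>d\<in>I.
      K (T i a) (S (T a b)) * J (S (T c d)) (T d j) * \<phi> (S (T b c)))" by (rule sum.swap)
  also have "\<dots> = (\<Sum>b\<in>I. \<Sum>c\<in>I. \<Sum>a\<in>I. \<Sum>d\<in>I.
      K (T i a) (S (T a b)) * J (S (T c d)) (T d j) * \<phi> (S (T b c)))" by (rule sum.cong[OF refl], rule sum.swap)
  also have "\<dots> = (\<Sum>b\<in>I. \<Sum>c\<in>I. q' (T i b) * q (T c j) * \<phi> (S (T b c)))"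
    by (intro sum.cong refl) (simp only: q_matrix[OF T] q'_matrix[OF T] ij sum_product, simp only: sum_distrib_right)
  also have "\<dots> = \<phi> (\<Sum>b\<in>I. \<Sum>c\<in>I. scal H (q' (T i b) * q (T c j)) (S (T b c)))"
    by (simp add: linear_form_sum[OF \<phi>] linear_form_scal(1)[OF \<phi>])
  finally show "\<phi> (tS (T i j)) = \<phi> (\<Sum>b\<in>I. \<Sum>c\<in>I. scal H (q' (T i b) * q (T c j)) (S (T b c)))" .
qed

definition u_inv :: "'i set \<Rightarrow> ('i \<Rightarrow> 'i \<Rightarrow> 'b) \<Rightarrow> 'i \<Rightarrow> 'i \<Rightarrow> 'k" where
  "u_inv I T i j = (\<Sum>c\<in>I. q' (S (T i c)) * q (T c j))"

text \<open>The square of the twisted antipode is conjugation by \<open>u\<close>, because the antipode \<open>S\<close> is an involution.\<close>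

lemma twisted_antipode_square_matrix:
  assumes T: "mult_matrix H I T" and ij: "i \<in> I" "j \<in> I"
  shows "tS (tS (T i j)) = (\<Sum>r\<in>I. \<Sum>p\<in>I. scal H (u (T i r) * u_inv I T p j) (T r p))"
proof -
  let ?Y = "dual_matrix H T"
  have Y: "mult_matrix H I ?Y" by (rule mult_matrix_dual[OF T])
  have tSS: "tS (S (T b c)) = (\<Sum>r\<in>I. \<Sum>p\<in>I. scal H (q' (S (T p c)) * q (S (T b r))) (T r p))"
    if bc: "b \<in> I" "c \<in> I" for b c
  proof -
    have "tS (?Y c b) = (\<Sum>p\<in>I. \<Sum>r\<in>I. scal H (q' (?Y c p) * q (?Y r b)) (S (?Y p r)))"
      by (rule twisted_antipode_matrix[OF Y bc(2,1)])
    also have "\<dots> = (\<Sum>p\<in>I. \<Sum>r\<in>I. scal H (q' (S (T p c)) * q (S (T b r))) (T r p))"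
      by (intro sum.cong refl) (simp add: dual_matrix_def antipode_antipode[OF T])
    finally show ?thesis unfolding dual_matrix_def by (rule trans[OF _ sum.swap])
  qed
  have "tS (tS (T i j)) = (\<Sum>b\<in>I. \<Sum>c\<in>I. \<Sum>r\<in>I. \<Sum>p\<in>I.
      scal H (q' (T i b) * q (T c j) * (q' (S (T p c)) * q (S (T b r)))) (T r p))"
    by (simp add: twisted_antipode_matrix[OF T ij] tS_sum tS_scal tSS V.scale_sum_right)
  also have "\<dots> = (\<Sum>t\<in>I \<times> I. \<Sum>w\<in>I \<times> I.
      scal H (q' (T i (fst t)) * q (T (snd t) j) * (q' (S (T (snd w) (snd t))) * q (S (T (fst t) (fst w))))) (T (fst w) (snd w)))"
    by (simp add: sum_times)
  also have "\<dots> = (\<Sum>w\<in>I \<times> I. \<Sum>t\<in>I \<times> I.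
      scal H (q' (T i (fst t)) * q (T (snd t) j) * (q' (S (T (snd w) (snd t))) * q (S (T (fst t) (fst w))))) (T (fst w) (snd w)))"
    by (rule sum.swap)
  also have "\<dots> = (\<Sum>w\<in>I \<times> I. scal H (u (T i (fst w)) * u_inv I T (snd w) j) (T (fst w) (snd w)))"
  proof (rule sum.cong[OF refl])
    fix w assume "w \<in> I \<times> I"
    then have w: "fst w \<in> I" "snd w \<in> I" by auto
    have "u (T i (fst w)) * u_inv I T (snd w) j = (\<Sum>b\<in>I. \<Sum>c\<in>I. q' (T i b) * q (S (T b (fst w))) *
        (q' (S (T (snd w) c)) * q (T c j)))"
      unfolding u_matrix[OF T ij(1) w(1)] u_inv_def by (rule sum_product)
    also have "\<dots> = (\<Sum>t\<in>I \<times> I. q' (T i (fst t)) * q (T (snd t) j) * (q' (S (T (snd w) (snd t))) * q (S (T (fst t) (fst w)))))"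
      unfolding sum_times by (intro sum.cong refl) simp
    finally show "(\<Sum>t\<in>I \<times> I. scal H (q' (T i (fst t)) * q (T (snd t) j) *
        (q' (S (T (snd w) (snd t))) * q (S (T (fst t) (fst w))))) (T (fst w) (snd w))) =
        scal H (u (T i (fst w)) * u_inv I T (snd w) j) (T (fst w) (snd w))"
      by (simp only: V.scale_sum_left)
  qed
  finally show ?thesis by (simp add: sum_times)
qed

lemma u_inv_u:
  assumes T: "mult_matrix H I T" and ij: "i \<in> I" "j \<in> I"
  shows "(\<Sum>l\<in>I. u_inv I T i l * u (T l j)) = (if i = j then 1 else 0)"
proof -
  have "(\<Sum>l\<in>I. u_inv I T i l * u (T l j)) = (\<Sum>c\<in>I. q' (S (T i c)) * (\<Sum>l\<in>I. q (T c l) * u (T l j)))"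
    unfolding u_inv_def sum_distrib_left sum_distrib_right mult.assoc by (rule sum.swap)
  also have "\<dots> = (\<Sum>c\<in>I. q (dual_matrix H T j c) * q' (dual_matrix H T c i))"
    using ij by (intro sum.cong refl) (simp add: q_u_matrix[OF T] dual_matrix_def mult.commute)
  also have "\<dots> = (if i = j then 1 else 0)"
    using q_q'_matrix[OF mult_matrix_dual[OF T] ij(2,1)] by auto
  finally show ?thesis .
qed

text \<open>
  Left and right translation by \<open>u\<close> are commuting operators on the span of the entries of \<open>T\<close>, unipotent together
  with the matrix \<open>u(T)\<close>, and the twisted antipode squared takes the right translate to the left translate.  On a
  common fixed vector of the two translations in an eigenspace it is therefore the identity.
\<close>

lemma twisted_antipode_square_eigenvalue:
  fixes T :: "'i \<Rightarrow> 'i \<Rightarrow> 'b"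
  assumes T: "mult_matrix H I T"
    and nil: "mpow I (restrict_mat I (\<lambda>i j. u (T i j)) - idm I) m = 0"
    and v: "v \<in> V.span ((\<lambda>p. T (fst p) (snd p)) ` (I \<times> I))" "v \<noteq> 0" "tS (tS v) = scal H c v"
  shows "c = 1"
proof -
  have fin: "finite I" by (rule mult_matrix_finite[OF T])
  let ?E = "(\<lambda>p. T (fst p) (snd p)) ` (I \<times> I)"
  let ?W = "V.span ?E"
  define F where "F a = tS (tS a)" for a
  define L where "L = sweedler2 H (scal H) (\<lambda>x y. scal H (u x) y)"
  define R where "R = sweedler2 H (scal H) (\<lambda>x y. scal H (u y) x)"
  define N where "N = restrict_mat I (\<lambda>i j. u (T i j)) - idm I"
  have N: "N \<in> matrices I"
    unfolding N_def by (rule matricesI) (auto simp: restrict_mat_def idm_def)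
  have u_scal: "u (x + y) = u x + u y" "u (scal H a x) = a * u x" for x y a
    using linear_u by (auto simp: vlinear_iff)
  have bilL: "bilinear_map (scal H) (scal H) (\<lambda>x y. scal H (u x) y)"
    and bilR: "bilinear_map (scal H) (scal H) (\<lambda>x y. scal H (u y) x)"
    by (auto simp: bilinear_map_def vlinear_iff vector_space u_scal V.scale_left_distrib V.scale_right_distrib mult.commute)
  have linL: "linear_operator H L" and linR: "linear_operator H R"
    unfolding L_def R_def by (intro sweedler2_linear bilL bilR)+
  have linF: "linear_operator H F"
    by (auto simp: vlinear_iff F_def tS_add tS_scal vector_space)
  have comp: "linear_operator H (\<lambda>a. f (g a))"
    if "linear_operator H f" "linear_operator H g" for f g
    using that by (auto simp: vlinear_iff)
  have minus: "linear_operator H (\<lambda>a. f a - a)"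
    if "linear_operator H f" for f
    using that by (auto simp: vlinear_iff algebra_simps V.scale_right_diff_distrib)
  have pow: "linear_operator H (f ^^ n)"
    if "linear_operator H f" for f n
    by (induction n) (use that in \<open>auto simp: vlinear_iff vector_space\<close>)
  have zero: "linear_operator H (\<lambda>a. 0)"
    by (auto simp: vlinear_iff vector_space)
  have linsum: "f (\<Sum>l\<in>G. g l) = (\<Sum>l\<in>G. f (g l))" "f (scal H a x) = scal H a (f x)" "f (x + y) = f x + f y"
    if "linear_operator H f" for f G and g :: "'i \<Rightarrow> 'b" and a x y
  proof -
    interpret f: Vector_Spaces.linear "scal H" "scal H" f by (rule that)
    show "f (\<Sum>l\<in>G. g l) = (\<Sum>l\<in>G. f (g l))" "f (scal H a x) = scal H a (f x)" "f (x + y) = f x + f y"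
      by (rule f.sum f.scale f.add)+
  qed
  have eq_on: "f a = g a"
    if "linear_operator H f" "linear_operator H g"
      "\<And>i j. i \<in> I \<Longrightarrow> j \<in> I \<Longrightarrow> f (T i j) = g (T i j)" "a \<in> ?W" for f g a
    using that(4)
  proof (rule V.span_induct_alt)
    show "f 0 = g 0" using linsum(2)[OF that(1), of 0 0] linsum(2)[OF that(2), of 0 0] by simp
    fix c x y assume "x \<in> ?E" "f y = g y"
    then show "f (scal H c x + y) = g (scal H c x + y)"
      using that(3) by (auto simp: linsum[OF that(1)] linsum[OF that(2)])
  qed
  have closed: "f a \<in> ?W"
    if "linear_operator H f" "\<And>i j. i \<in> I \<Longrightarrow> j \<in> I \<Longrightarrow> f (T i j) \<in> ?W" "a \<in> ?W" for f a
    using that(3)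
  proof (rule V.span_induct_alt)
    show "f 0 \<in> ?W" using linsum(2)[OF that(1), of 0 0] by (simp add: V.span_zero)
    fix c x y assume "x \<in> ?E" "f y \<in> ?W"
    then show "f (scal H c x + y) \<in> ?W"
      using that(2) by (auto simp: linsum[OF that(1)] intro!: V.span_add V.span_scale)
  qed
  have TW: "T i j \<in> ?W" if "i \<in> I" "j \<in> I" for i j
    using that by (intro V.span_base) force
  have LT: "L (T i j) = (\<Sum>l\<in>I. scal H (u (T i l)) (T l j))" if "i \<in> I" "j \<in> I" for i j
    unfolding L_def by (rule mult_matrix_sweedler_vector[OF T bilL that])
  have RT: "R (T i j) = (\<Sum>l\<in>I. scal H (u (T l j)) (T i l))" if "i \<in> I" "j \<in> I" for i j
    unfolding R_def by (rule mult_matrix_sweedler_vector[OF T bilR that])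
  have FT: "F (T i j) = (\<Sum>r\<in>I. \<Sum>p\<in>I. scal H (u (T i r) * u_inv I T p j) (T r p))" if "i \<in> I" "j \<in> I" for i j
    unfolding F_def by (rule twisted_antipode_square_matrix[OF T that])
  have LW: "L a \<in> ?W" and RW: "R a \<in> ?W" if "a \<in> ?W" for a
    by (rule closed[OF linL _ that], simp add: LT, intro V.span_sum V.span_scale TW, assumption+)
       (rule closed[OF linR _ that], simp add: RT, intro V.span_sum V.span_scale TW, assumption+)
  have LR: "L (R a) = R (L a)" if "a \<in> ?W" for a
  proof (rule eq_on[OF comp[OF linL linR] comp[OF linR linL] _ that])
    fix i j assume ij: "i \<in> I" "j \<in> I"
    have "L (R (T i j)) = (\<Sum>l\<in>I. \<Sum>k\<in>I. scal H (u (T l j) * u (T i k)) (T k l))"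
      by (simp add: RT ij linsum[OF linL] LT V.scale_sum_right)
    also have "\<dots> = (\<Sum>k\<in>I. \<Sum>l\<in>I. scal H (u (T i k) * u (T l j)) (T k l))"
      by (subst sum.swap) (simp only: mult.commute)
    also have "\<dots> = R (L (T i j))"
      by (simp add: LT ij linsum[OF linR] RT V.scale_sum_right)
    finally show "L (R (T i j)) = R (L (T i j))" .
  qed
  have FR: "F (R a) = L a" if "a \<in> ?W" for a
  proof (rule eq_on[OF comp[OF linF linR] linL _ that])
    fix i j assume ij: "i \<in> I" "j \<in> I"
    have "F (R (T i j)) = (\<Sum>l\<in>I. \<Sum>w\<in>I \<times> I. scal H (u (T l j) * (u (T i (fst w)) * u_inv I T (snd w) l)) (T (fst w) (snd w)))"
      by (simp add: RT ij linsum[OF linF] FT V.scale_sum_right sum_times)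
    also have "\<dots> = (\<Sum>w\<in>I \<times> I. scal H (u (T i (fst w)) * (\<Sum>l\<in>I. u_inv I T (snd w) l * u (T l j))) (T (fst w) (snd w)))"
      by (subst sum.swap) (simp add: V.scale_sum_left sum_distrib_left ac_simps)
    also have "\<dots> = (\<Sum>r\<in>I. \<Sum>p\<in>I. if p = j then scal H (u (T i r)) (T r p) else 0)"
      unfolding sum_times by (intro sum.cong refl) (simp add: u_inv_u[OF T _ ij(2)])
    also have "\<dots> = L (T i j)" using fin ij by (simp add: LT)
    finally show "F (R (T i j)) = L (T i j)" .
  qed
  have FL: "F (L a) = L (F a)" if "a \<in> ?W" for a
  proof (rule eq_on[OF comp[OF linF linL] comp[OF linL linF] _ that])
    fix i j assume ij: "i \<in> I" "j \<in> I"
    have "F (L (T i j)) = (\<Sum>l\<in>I. \<Sum>r\<in>I. \<Sum>p\<in>I. scal H (u (T i l) * (u (T l r) * u_inv I T p j)) (T r p))"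
      by (simp add: LT ij linsum[OF linF] FT V.scale_sum_right)
    also have "\<dots> = (\<Sum>l\<in>I. \<Sum>p\<in>I. \<Sum>r\<in>I. scal H (u (T i l) * u_inv I T p j * u (T l r)) (T r p))"
      by (rule sum.cong[OF refl], subst sum.swap) (simp only: ac_simps)
    also have "\<dots> = L (F (T i j))"
      by (simp add: FT ij linsum[OF linL] LT V.scale_sum_right)
    finally show "F (L (T i j)) = L (F (T i j))" .
  qed
  have NL: "((\<lambda>a. L a - a) ^^ n) (T i j) = (\<Sum>l\<in>I. scal H (mpow I N n i l) (T l j))"
    if ij: "i \<in> I" "j \<in> I" for i j n
  proof (induction n)
    case 0
    have "(\<Sum>l\<in>I. scal H (idm I i l) (T l j)) = (\<Sum>l\<in>I. if i = l then T l j else 0)"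
      by (intro sum.cong refl) (simp add: idm_def)
    then show ?case using fin ij by simp
  next
    case (Suc n)
    have one: "L (T l j) - T l j = (\<Sum>k\<in>I. scal H (N l k) (T k j))" if l: "l \<in> I" for l
    proof -
      have "(\<Sum>k\<in>I. scal H (N l k) (T k j)) = (\<Sum>k\<in>I. scal H (u (T l k)) (T k j) - (if l = k then T k j else 0))"
        by (intro sum.cong refl) (simp add: N_def restrict_mat_def idm_def V.scale_left_diff_distrib l)
      then show ?thesis using fin l ij by (simp add: sum_subtractf LT)
    qed
    have "((\<lambda>a. L a - a) ^^ Suc n) (T i j) = (\<Sum>l\<in>I. scal H (mpow I N n i l) (\<Sum>k\<in>I. scal H (N l k) (T k j)))"
      using Suc by (simp add: linsum[OF minus[OF linL]] one)
    also have "\<dots> = (\<Sum>k\<in>I. scal H (mm I (mpow I N n) N i k) (T k j))"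
      unfolding V.scale_sum_right V.scale_scale mm_def V.scale_sum_left by (rule sum.swap)
    also have "mm I (mpow I N n) N = mpow I N (Suc n)"
      using mpow_add[OF fin N, of n 1] mm_idm_right[OF fin N] by simp
    finally show ?case .
  qed
  have NR: "((\<lambda>a. R a - a) ^^ n) (T i j) = (\<Sum>l\<in>I. scal H (mpow I N n l j) (T i l))"
    if ij: "i \<in> I" "j \<in> I" for i j n
  proof (induction n)
    case 0
    have "(\<Sum>l\<in>I. scal H (idm I l j) (T i l)) = (\<Sum>l\<in>I. if l = j then T i l else 0)"
      by (intro sum.cong refl) (simp add: idm_def)
    then show ?case using fin ij by simp
  next
    case (Suc n)
    have one: "R (T i l) - T i l = (\<Sum>k\<in>I. scal H (N k l) (T i k))" if l: "l \<in> I" for l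
    proof -
      have "(\<Sum>k\<in>I. scal H (N k l) (T i k)) = (\<Sum>k\<in>I. scal H (u (T k l)) (T i k) - (if k = l then T i k else 0))"
        by (intro sum.cong refl) (simp add: N_def restrict_mat_def idm_def V.scale_left_diff_distrib l)
      then show ?thesis using fin l ij by (simp add: sum_subtractf RT)
    qed
    have "((\<lambda>a. R a - a) ^^ Suc n) (T i j) = (\<Sum>l\<in>I. scal H (mpow I N n l j) (\<Sum>k\<in>I. scal H (N k l) (T i k)))"
      using Suc by (simp add: linsum[OF minus[OF linR]] one)
    also have "\<dots> = (\<Sum>k\<in>I. scal H (mm I N (mpow I N n) k j) (T i k))"
      unfolding V.scale_sum_right V.scale_scale mm_def V.scale_sum_left mult.commute[of "mpow I N n _ j"] by (rule sum.swap)
    finally show ?case by simp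
  qed
  have nilL: "((\<lambda>a. L a - a) ^^ m) a = 0" and nilR: "((\<lambda>a. R a - a) ^^ m) a = 0" if "a \<in> ?W" for a
    using eq_on[OF pow[OF minus[OF linL]] zero _ that, of m] eq_on[OF pow[OF minus[OF linR]] zero _ that, of m] nil
    by (simp_all add: NL NR N_def)
  have "\<exists>b. b \<noteq> 0 \<and> (b \<in> ?W \<and> F b = scal H c b) \<and> L b - b = 0"
  proof (rule nilpotent_kernel_vector[OF nilL[OF v(1)] v(2)])
    show "v \<in> ?W \<and> F v = scal H c v" using v by (simp add: F_def)
    show "L b - b \<in> ?W \<and> F (L b - b) = scal H c (L b - b)" if "b \<in> ?W \<and> F b = scal H c b" for b
    proof
      show "L b - b \<in> ?W" using that LW by (auto intro: V.span_diff)
      have "F (L b - b) = F (L b) - F b" using linsum(3)[OF linF, of "L b - b" b] by (simp add: algebra_simps)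
      then show "F (L b - b) = scal H c (L b - b)"
        using that by (simp add: FL linsum[OF linL] V.scale_right_diff_distrib)
    qed
  qed
  then obtain b where b: "b \<noteq> 0" "b \<in> ?W" "F b = scal H c b" "L b = b" by auto
  have "\<exists>b. b \<noteq> 0 \<and> (b \<in> ?W \<and> F b = scal H c b \<and> L b = b) \<and> R b - b = 0"
  proof (rule nilpotent_kernel_vector[OF nilR[OF b(2)] b(1)])
    show "b \<in> ?W \<and> F b = scal H c b \<and> L b = b" using b by simp
    show "R d - d \<in> ?W \<and> F (R d - d) = scal H c (R d - d) \<and> L (R d - d) = R d - d"
      if d: "d \<in> ?W \<and> F d = scal H c d \<and> L d = d" for d
    proof (intro conjI)
      show "R d - d \<in> ?W" using d RW by (auto intro: V.span_diff)
      have FRd: "F (R d) = scal H c (R d)"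
      proof -
        have RF: "F (R a) = R (F a)" if "a \<in> ?W" for a
        proof (rule eq_on[OF comp[OF linF linR] comp[OF linR linF] _ that])
          fix i j assume ij: "i \<in> I" "j \<in> I"
          have "R (F (T i j)) = (\<Sum>r\<in>I. \<Sum>p\<in>I. \<Sum>l\<in>I. scal H (u (T i r) * (u_inv I T p j * u (T l p))) (T r l))"
            by (simp add: FT ij linsum[OF linR] RT V.scale_sum_right mult.assoc)
          also have "\<dots> = (\<Sum>r\<in>I. \<Sum>l\<in>I. scal H (u (T i r) * (\<Sum>p\<in>I. u (T l p) * u_inv I T p j)) (T r l))"
            unfolding sum_distrib_left V.scale_sum_left by (rule sum.cong[OF refl], subst sum.swap) (simp only: ac_simps)
          also have "\<dots> = (\<Sum>r\<in>I. \<Sum>l\<in>I. if l = j then scal H (u (T i r)) (T r l) else 0)"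
          proof (intro sum.cong refl)
            fix r l assume rl: "r \<in> I" "l \<in> I"
            let ?A = "restrict_mat I (u_inv I T)" and ?B = "restrict_mat I (\<lambda>i j. u (T i j))"
            have "mm I ?A ?B = idm I"
              by (rule matrices_eqI[OF mm_matrices[OF restrict_mat_matrices restrict_mat_matrices] idm_matrices])
                 (simp add: mm_restrict u_inv_u[OF T] idm_def)
            then have "mm I ?B ?A = idm I"
              by (rule left_inverse_of_right_inverse[OF fin restrict_mat_matrices restrict_mat_matrices])
            then have "mm I ?B ?A l j = idm I l j" by simp
            then have "(\<Sum>p\<in>I. u (T l p) * u_inv I T p j) = (if l = j then 1 else 0)"
              using ij rl by (simp add: mm_restrict idm_def)
            then show "scal H (u (T i r) * (\<Sum>p\<in>I. u (T l p) * u_inv I T p j)) (T r l) =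
                (if l = j then scal H (u (T i r)) (T r l) else 0)" by simp
          qed
          also have "\<dots> = L (T i j)" using fin ij by (simp add: LT)
          also have "\<dots> = F (R (T i j))" using FR[OF TW[OF ij]] by simp
          finally show "F (R (T i j)) = R (F (T i j))" by simp
        qed
        show ?thesis using d by (simp add: RF linsum[OF linR])
      qed
      have "F (R d - d) = F (R d) - F d" using linsum(3)[OF linF, of "R d - d" d] by (simp add: algebra_simps)
      then show "F (R d - d) = scal H c (R d - d)" using d by (simp add: FRd V.scale_right_diff_distrib)
      have "L (R d - d) = L (R d) - L d" using linsum(3)[OF linL, of "R d - d" d] by (simp add: algebra_simps)
      then show "L (R d - d) = R d - d" using d by (simp add: LR)
    qed
  qed
  then obtain d where d: "d \<noteq> 0" "d \<in> ?W" "F d = scal H c d" "L d = d" "R d = d" by auto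
  have "scal H c d = d" using FR[OF d(2)] d by simp
  then have "scal H (c - 1) d = 0" by (simp add: V.scale_left_diff_distrib)
  then show ?thesis using d(1) by simp
qed

end

section \<open>Tensor powers and power traces\<close>

definition lists_over :: "'i set \<Rightarrow> nat \<Rightarrow> 'i list set" where
  "lists_over I n = {xs. set xs \<subseteq> I \<and> length xs = n}"

lemma finite_lists_over: "finite I \<Longrightarrow> finite (lists_over I n)"
  unfolding lists_over_def by (rule finite_lists_length_eq)

lemma lists_over_0: "lists_over I 0 = {[]}"
  by (auto simp: lists_over_def)

lemma bij_lists_over_Suc: "bij_betw (\<lambda>xs. (hd xs, tl xs)) (lists_over I (Suc n)) (I \<times> lists_over I n)"
  by (rule bij_betw_byWitness[where f' = "\<lambda>p. fst p # snd p"])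
     (auto simp: lists_over_def length_Suc_conv)

lemma sum_lists_over_Suc:
  "(\<Sum>xs\<in>lists_over I (Suc n). f xs) = (\<Sum>p\<in>I \<times> lists_over I n. f (fst p # snd p))"
proof -
  have "(\<Sum>p\<in>I \<times> lists_over I n. f (fst p # snd p)) = (\<Sum>xs\<in>lists_over I (Suc n). f (hd xs # tl xs))"
    using sum.reindex_bij_betw[OF bij_lists_over_Suc[of I n], of "\<lambda>p. f (fst p # snd p)"] by simp
  also have "\<dots> = (\<Sum>xs\<in>lists_over I (Suc n). f xs)"
    by (rule sum.cong[OF refl]) (auto simp: lists_over_def length_Suc_conv)
  finally show ?thesis by simp
qed

lemma rotate1_lists_over: "xs \<in> lists_over I n \<Longrightarrow> rotate1 xs \<in> lists_over I n"
  by (simp add: lists_over_def)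

lemma bij_rotate1_lists_over:
  assumes "finite I"
  shows "bij_betw rotate1 (lists_over I n) (lists_over I n)"
proof -
  have "rotate1 ` lists_over I n \<subseteq> lists_over I n" using rotate1_lists_over by blast
  moreover have "inj_on rotate1 (lists_over I n)" using inj_rotate1 by (rule inj_on_subset) simp
  ultimately show ?thesis using endo_inj_surj[OF finite_lists_over[OF assms]] by (auto simp: bij_betw_def)
qed

lemma bij_rotate_lists_over:
  assumes "finite I"
  shows "bij_betw (rotate i) (lists_over I n) (lists_over I n)"
proof (induction i)
  case (Suc i)
  from bij_betw_trans[OF this bij_rotate1_lists_over[OF assms]] show ?case by (simp add: rotate_def comp_def)
qed (simp add: rotate_def bij_betw_def)

lemma rotate_lists_over: "xs \<in> lists_over I n \<Longrightarrow> rotate i xs \<in> lists_over I n"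
  by (simp add: lists_over_def)

lemma rotate1_fixed:
  assumes "rotate1 xs = xs" "xs \<noteq> []"
  shows "xs = replicate (length xs) (hd xs)"
proof -
  obtain x ys where xs: "xs = x # ys" using assms(2) by (cases xs) auto
  have "ys @ [x] = x # ys \<Longrightarrow> ys = replicate (length ys) x" for ys
    by (induction ys) auto
  then show ?thesis using assms(1) xs by simp
qed

lemma card_rotate1_fixed:
  assumes "finite I" "n \<ge> 1"
  shows "card {xs \<in> lists_over I n. rotate1 xs = xs} = card I"
proof -
  have "{xs \<in> lists_over I n. rotate1 xs = xs} = replicate n ` I"
  proof (intro equalityI subsetI)
    fix xs assume "xs \<in> {xs \<in> lists_over I n. rotate1 xs = xs}"
    then have xs: "set xs \<subseteq> I" "length xs = n" "rotate1 xs = xs" by (auto simp: lists_over_def)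
    then have "xs \<noteq> []" using assms by auto
    then show "xs \<in> replicate n ` I" using rotate1_fixed[OF xs(3)] xs by (intro image_eqI[of _ _ "hd xs"]) auto
  next
    fix xs assume "xs \<in> replicate n ` I"
    then obtain x where "x \<in> I" "xs = replicate n x" by auto
    moreover have "rotate1 (replicate n x) = replicate n x"
      by (cases n) (simp_all add: replicate_append_same)
    ultimately show "xs \<in> {xs \<in> lists_over I n. rotate1 xs = xs}" by (auto simp: lists_over_def)
  qed
  moreover have "inj_on (replicate n) I" using assms(2) by (auto simp: inj_on_def replicate_eq_replicate)
  ultimately show ?thesis by (simp add: card_image)
qed

text \<open>Entries of the tensor power of a scalar matrix.\<close>

primrec power_entry :: "('i \<Rightarrow> 'i \<Rightarrow> 'k::comm_ring_1) \<Rightarrow> 'i list \<Rightarrow> 'i list \<Rightarrow> 'k" where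
  "power_entry U [] ys = 1"
| "power_entry U (x # xs) ys = U x (hd ys) * power_entry U xs (tl ys)"

primrec tensor_power ::
    "('k::field, 'b) hopf \<Rightarrow> ('i \<Rightarrow> 'i \<Rightarrow> 'b) \<Rightarrow> 'i list \<Rightarrow> 'i list \<Rightarrow> 'b" where
  "tensor_power H T [] ys = unit H"
| "tensor_power H T (x # xs) ys = mul H (T x (hd ys)) (tensor_power H T xs (tl ys))"

text \<open>
  The matrix on the \<open>n\<close>-th tensor power that identifies the twisted with the untwisted tensor product of \<open>n\<close> copies of a
  comodule, \<open>J\<^sub>n\<^sub>+\<^sub>1 = (id \<otimes> \<Delta>\<^sub>n)(J) * (1 \<otimes> J\<^sub>n)\<close>.
\<close>

primrec iterated_cocycle ::
    "('k::field, 'b) hopf \<Rightarrow> ('b \<Rightarrow> 'b \<Rightarrow> 'k) \<Rightarrow> 'i set \<Rightarrow> ('i \<Rightarrow> 'i \<Rightarrow> 'b) \<Rightarrow> nat \<Rightarrow> 'i list \<Rightarrow> 'i list \<Rightarrow> 'k" where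
  "iterated_cocycle H J I T 0 xs ys = 1"
| "iterated_cocycle H J I T (Suc n) xs ys = (\<Sum>zs\<in>lists_over I n.
     J (T (hd xs) (hd ys)) (tensor_power H T (tl xs) zs) * iterated_cocycle H J I T n zs (tl ys))"

text \<open>The average of \<open>J\<^sub>n\<close> over the rotations of tensor factors, up to the factor \<open>n\<close>.\<close>

definition cyclic_cocycle ::
    "('k::field, 'b) hopf \<Rightarrow> ('b \<Rightarrow> 'b \<Rightarrow> 'k) \<Rightarrow> 'i set \<Rightarrow> ('i \<Rightarrow> 'i \<Rightarrow> 'b) \<Rightarrow> nat \<Rightarrow> 'i list \<Rightarrow> 'i list \<Rightarrow> 'k" where
  "cyclic_cocycle H J I T n xs ys = (\<Sum>i<n. iterated_cocycle H J I T n (rotate i xs) (rotate i ys))"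

lemma power_entry_snoc:
  "length xs = length ys \<Longrightarrow> power_entry U (xs @ [x]) (ys @ [y]) = power_entry U xs ys * U x y"
  by (induction xs ys rule: list_induct2) (simp_all add: mult.assoc)

lemma power_entry_rotate1:
  "length xs = length ys \<Longrightarrow> power_entry U (rotate1 xs) (rotate1 ys) = power_entry U xs ys"
  by (cases xs; cases ys) (simp_all add: power_entry_snoc mult.commute)

lemma power_entry_rotate:
  "length xs = length ys \<Longrightarrow> power_entry U (rotate i xs) (rotate i ys) = power_entry U xs ys"
  by (induction i) (simp_all add: power_entry_rotate1)

lemma sum_power_entry_path:
  assumes fin: "finite I" and U: "U \<in> matrices I" and xy: "x \<in> I" "y \<in> I"
  shows "(\<Sum>zs\<in>lists_over I n. power_entry U (x # zs) (zs @ [y])) = mpow I U (Suc n) x y"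
  using xy(1)
proof (induction n arbitrary: x)
  case 0
  then show ?case using mm_idm_right[OF fin U] by (simp add: lists_over_0)
next
  case (Suc n)
  have "(\<Sum>zs\<in>lists_over I (Suc n). power_entry U (x # zs) (zs @ [y])) =
      (\<Sum>z\<in>I. U x z * (\<Sum>zs\<in>lists_over I n. power_entry U (z # zs) (zs @ [y])))"
    by (simp add: sum_lists_over_Suc sum_times sum_distrib_left)
  also have "\<dots> = (\<Sum>z\<in>I. U x z * mpow I U (Suc n) z y)"
    by (intro sum.cong refl) (simp only: Suc.IH)
  finally show ?case by (simp add: mm_def[of I U "mm I U (mpow I U n)"])
qed

text \<open>The trace of \<open>U\<close> composed with a cyclic permutation on the tensor power is a power trace.\<close>

lemma sum_power_entry_cycle:
  assumes fin: "finite I" and U: "U \<in> matrices I" and n: "n \<ge> 1"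
  shows "(\<Sum>xs\<in>lists_over I n. power_entry U xs (rotate1 xs)) = tr I (mpow I U n)"
proof -
  obtain m where m: "n = Suc m" using n by (cases n) auto
  have "(\<Sum>xs\<in>lists_over I n. power_entry U xs (rotate1 xs)) =
      (\<Sum>x\<in>I. \<Sum>zs\<in>lists_over I m. power_entry U (x # zs) (zs @ [x]))"
    unfolding m sum_lists_over_Suc sum_times by simp
  also have "\<dots> = (\<Sum>x\<in>I. mpow I U n x x)"
    unfolding m by (intro sum.cong refl sum_power_entry_path[OF fin U])
  finally show ?thesis by (simp add: tr_def)
qed

lemma mult_matrix_cong:
  assumes "mult_matrix H I T" "\<And>i j. i \<in> I \<Longrightarrow> j \<in> I \<Longrightarrow> T' i j = T i j"
  shows "mult_matrix H I T'"
  using assms by (simp add: mult_matrix_def)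

context commutative_hopf_algebra
begin

lemma tensor_power_snoc:
  "length xs = length ys \<Longrightarrow>
     tensor_power H T (xs @ [x]) (ys @ [y]) = M (tensor_power H T xs ys) (T x y)"
  by (induction xs ys rule: list_induct2) (simp_all add: mul_assoc unit_left unit_right)

lemma tensor_power_rotate1:
  "length xs = length ys \<Longrightarrow> tensor_power H T (rotate1 xs) (rotate1 ys) = tensor_power H T xs ys"
  by (cases xs; cases ys) (simp_all add: tensor_power_snoc mul_commute)

lemma tensor_power_rotate:
  "length xs = length ys \<Longrightarrow> tensor_power H T (rotate i xs) (rotate i ys) = tensor_power H T xs ys"
  by (induction i) (simp_all add: tensor_power_rotate1)

lemma mult_matrix_tensor_power:
  assumes T: "mult_matrix H I T"
  shows "mult_matrix H (lists_over I n) (tensor_power H T)"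
proof (induction n)
  case 0
  show ?case by (simp add: mult_matrix_def lists_over_0 counit_unit sweedler2_unit)
next
  case (Suc n)
  show ?case
    by (rule mult_matrix_cong[OF mult_matrix_reindex[OF mult_matrix_tensor[OF T Suc] bij_lists_over_Suc]])
       (auto simp: tensor_matrix_def lists_over_def length_Suc_conv)
qed

end

lemma iterated_cocycle_trivial:
  assumes T: "commutative_hopf_algebra H" "mult_matrix H I T" and mem: "xs \<in> lists_over I n" "ys \<in> lists_over I n"
  shows "iterated_cocycle H (convolution_one H) I T n xs ys = (if xs = ys then 1 else 0)"
  using mem
proof (induction n arbitrary: xs ys)
  case (Suc n)
  interpret commutative_hopf_algebra H by (rule T(1))
  have fin: "finite (lists_over I n)" by (rule finite_lists_over[OF mult_matrix_finite[OF T(2)]])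
  obtain x xs' y ys' where l: "xs = x # xs'" "ys = y # ys'" "x \<in> I" "y \<in> I" "xs' \<in> lists_over I n" "ys' \<in> lists_over I n"
    using Suc.prems by (auto simp: lists_over_def length_Suc_conv)
  have "iterated_cocycle H (convolution_one H) I T (Suc n) xs ys =
      (\<Sum>zs\<in>lists_over I n. (if x = y then 1 else 0) * (if xs' = zs then 1 else 0) * (if zs = ys' then 1 else 0))"
    unfolding l iterated_cocycle.simps list.sel
    by (intro sum.cong refl) (simp add: convolution_one_def Suc.IH l mult_matrix_counit[OF T(2)]
        mult_matrix_counit[OF mult_matrix_tensor_power[OF T(2), of n]])
  also have "\<dots> = (\<Sum>zs\<in>lists_over I n. if zs = ys' then (if xs = ys then 1 else 0) else 0)"
    by (intro sum.cong refl) (auto simp: l)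
  also have "\<dots> = (if xs = ys then 1 else 0)" using fin l by simp
  finally show ?case .
qed (simp add: lists_over_0)

context hopf_twist
begin

text \<open>
  Induction on \<open>n\<close>, with \<open>\<Delta>(u) * J = J * (u \<otimes> u)\<close> for \<open>T\<close> and its \<open>n\<close>-th tensor power.
\<close>

lemma iterated_cocycle_intertwines:
  assumes T: "mult_matrix H I T" and mem: "xs \<in> lists_over I n" "zs \<in> lists_over I n"
  shows "(\<Sum>ys\<in>lists_over I n. u (tensor_power H T xs ys) * iterated_cocycle H J I T n ys zs) =
    (\<Sum>ys\<in>lists_over I n. iterated_cocycle H J I T n xs ys * power_entry (\<lambda>i j. u (T i j)) ys zs)"
  using mem
proof (induction n arbitrary: xs zs)
  case 0
  have "(\<Sum>xs\<in>lists_over I 0. u (tensor_power H T xs (id xs))) = of_nat (card {xs \<in> lists_over I 0. id xs = xs})"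
    by (rule u_trace[OF mult_matrix_tensor_power[OF T] bij_betw_id]) simp
  then have "u (unit H) = 1" by (simp add: lists_over_0)
  then show ?case using 0 by (simp add: lists_over_0)
next
  case (Suc n)
  let ?L = "lists_over I n" and ?P = "tensor_power H T" and ?j = "iterated_cocycle H J I T n"
  let ?U = "\<lambda>i j. u (T i j)"
  have P: "mult_matrix H ?L ?P" by (rule mult_matrix_tensor_power[OF T])
  obtain x xs' z zs' where l: "xs = x # xs'" "zs = z # zs'" "x \<in> I" "z \<in> I" "xs' \<in> ?L" "zs' \<in> ?L"
    using Suc.prems by (auto simp: lists_over_def length_Suc_conv)
  have "(\<Sum>ys\<in>lists_over I (Suc n). u (?P xs ys) * iterated_cocycle H J I T (Suc n) ys zs) =
      (\<Sum>p\<in>I \<times> ?L. \<Sum>ws\<in>?L. u (tensor_matrix H T ?P (x, xs') p) * J (T (fst p) z) (?P (snd p) ws) * ?j ws zs')"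
    by (simp add: sum_lists_over_Suc l tensor_matrix_def sum_distrib_left mult.assoc)
  also have "\<dots> = (\<Sum>ws\<in>?L. (\<Sum>p\<in>I \<times> ?L. u (tensor_matrix H T ?P (x, xs') p) * J (T (fst p) z) (?P (snd p) ws)) * ?j ws zs')"
    unfolding sum_distrib_right by (rule sum.swap)
  also have "\<dots> = (\<Sum>ws\<in>?L. (\<Sum>p\<in>I \<times> ?L. J (T x (fst p)) (?P xs' (snd p)) * (u (T (fst p) z) * u (?P (snd p) ws))) * ?j ws zs')"
  proof (rule sum.cong[OF refl])
    fix ws assume "ws \<in> ?L"
    then have m: "(x, xs') \<in> I \<times> ?L" "(z, ws) \<in> I \<times> ?L" using l by auto
    show "(\<Sum>p\<in>I \<times> ?L. u (tensor_matrix H T ?P (x, xs') p) * J (T (fst p) z) (?P (snd p) ws)) * ?j ws zs' =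
        (\<Sum>p\<in>I \<times> ?L. J (T x (fst p)) (?P xs' (snd p)) * (u (T (fst p) z) * u (?P (snd p) ws))) * ?j ws zs'"
      using u_grouplike[OF T P m] by simp
  qed
  also have "\<dots> = (\<Sum>p\<in>I \<times> ?L. J (T x (fst p)) (?P xs' (snd p)) * u (T (fst p) z) * (\<Sum>ws\<in>?L. u (?P (snd p) ws) * ?j ws zs'))"
    unfolding sum_distrib_right sum_distrib_left by (subst sum.swap) (simp only: mult.assoc)
  also have "\<dots> = (\<Sum>p\<in>I \<times> ?L. J (T x (fst p)) (?P xs' (snd p)) * u (T (fst p) z) * (\<Sum>ws\<in>?L. ?j (snd p) ws * power_entry ?U ws zs'))"
    by (rule sum.cong[OF refl]) (use Suc.IH l in auto)
  also have "\<dots> = (\<Sum>y\<in>I. \<Sum>ws\<in>?L. (\<Sum>r\<in>?L. J (T x y) (?P xs' r) * ?j r ws) * (u (T y z) * power_entry ?U ws zs'))"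
    unfolding sum_times fst_conv snd_conv sum_distrib_right sum_distrib_left
    by (rule sum.cong[OF refl], subst sum.swap) (simp only: ac_simps)
  also have "\<dots> = (\<Sum>ys\<in>lists_over I (Suc n). iterated_cocycle H J I T (Suc n) xs ys * power_entry ?U ys zs)"
    by (simp add: sum_lists_over_Suc sum_times l)
  finally show ?case .
qed

lemma cyclic_cocycle_rotate1:
  assumes "xs \<in> lists_over I n" "ys \<in> lists_over I n"
  shows "cyclic_cocycle H J I T n (rotate1 xs) (rotate1 ys) = cyclic_cocycle H J I T n xs ys"
proof -
  define f where "f i = iterated_cocycle H J I T n (rotate i xs) (rotate i ys)" for i
  have len: "length xs = n" "length ys = n" using assms by (auto simp: lists_over_def)
  have "f n = f 0" unfolding f_def using len by simp
  moreover have "(\<Sum>i<Suc n. f i) = f 0 + (\<Sum>i<n. f (Suc i))" by (rule sum.lessThan_Suc_shift)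
  ultimately have "(\<Sum>i<n. f (Suc i)) = (\<Sum>i<n. f i)" by simp
  moreover have "rotate i (rotate1 zs) = rotate (Suc i) zs" for i and zs :: "'a list"
    by (simp add: rotate_def funpow_swap1)
  ultimately show ?thesis by (simp add: cyclic_cocycle_def f_def)
qed

text \<open>
  The two operators intertwined by \<open>J\<^sub>n\<close> commute with cyclic permutations, because the algebra is commutative, so that
  the average over the rotations of \<open>J\<^sub>n\<close> intertwines them as well.
\<close>

lemma cyclic_cocycle_intertwines:
  assumes T: "mult_matrix H I T" and mem: "xs \<in> lists_over I n" "zs \<in> lists_over I n"
  shows "(\<Sum>ys\<in>lists_over I n. u (tensor_power H T xs ys) * cyclic_cocycle H J I T n ys zs) =
    (\<Sum>ys\<in>lists_over I n. cyclic_cocycle H J I T n xs ys * power_entry (\<lambda>i j. u (T i j)) ys zs)"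
proof -
  let ?L = "lists_over I n" and ?P = "tensor_power H T" and ?j = "iterated_cocycle H J I T n"
  let ?U = "\<lambda>i j. u (T i j)"
  have fin: "finite I" by (rule mult_matrix_finite[OF T])
  have len: "length a = n" if "a \<in> ?L" for a using that by (simp add: lists_over_def)
  have reindex: "(\<Sum>ys\<in>?L. f (rotate i ys)) = (\<Sum>ys\<in>?L. f ys)" for f :: "_ \<Rightarrow> 'k" and i
    by (rule sum.reindex_bij_betw[OF bij_rotate_lists_over[OF fin]])
  have "(\<Sum>ys\<in>?L. u (?P xs ys) * cyclic_cocycle H J I T n ys zs) =
      (\<Sum>i<n. \<Sum>ys\<in>?L. u (?P xs ys) * ?j (rotate i ys) (rotate i zs))"
    unfolding cyclic_cocycle_def sum_distrib_left by (rule sum.swap)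
  also have "\<dots> = (\<Sum>i<n. \<Sum>ys\<in>?L. u (?P (rotate i xs) (rotate i ys)) * ?j (rotate i ys) (rotate i zs))"
    by (intro sum.cong refl) (simp add: tensor_power_rotate len mem)
  also have "\<dots> = (\<Sum>i<n. \<Sum>ys\<in>?L. u (?P (rotate i xs) ys) * ?j ys (rotate i zs))"
    by (rule sum.cong[OF refl]) (rule reindex)
  also have "\<dots> = (\<Sum>i<n. \<Sum>ys\<in>?L. ?j (rotate i xs) ys * power_entry ?U ys (rotate i zs))"
    by (rule sum.cong[OF refl]) (intro iterated_cocycle_intertwines[OF T] rotate_lists_over mem)
  also have "\<dots> = (\<Sum>i<n. \<Sum>ys\<in>?L. ?j (rotate i xs) (rotate i ys) * power_entry ?U (rotate i ys) (rotate i zs))"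
    by (rule sum.cong[OF refl]) (rule reindex[symmetric])
  also have "\<dots> = (\<Sum>i<n. \<Sum>ys\<in>?L. ?j (rotate i xs) (rotate i ys) * power_entry ?U ys zs)"
    by (intro sum.cong refl) (simp add: power_entry_rotate len mem)
  also have "\<dots> = (\<Sum>ys\<in>?L. cyclic_cocycle H J I T n xs ys * power_entry ?U ys zs)"
    unfolding cyclic_cocycle_def sum_distrib_right by (rule sum.swap)
  finally show ?thesis .
qed

text \<open>
  If the average of \<open>J\<^sub>n\<close> is invertible, then \<open>u\<close> on the tensor power of the comodule is conjugate to the tensor power
  of the matrix \<open>u(T)\<close> by a matrix that commutes with the cyclic permutation.  Hence both have the same trace against that
  permutation.
\<close>

lemma power_trace:
  fixes g :: "'i list \<Rightarrow> 'i list \<Rightarrow> 'k" and T :: "'i \<Rightarrow> 'i \<Rightarrow> 'b"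
  assumes T: "mult_matrix H I T" and n: "n \<ge> 1"
    and g: "\<And>xs zs. xs \<in> lists_over I n \<Longrightarrow> zs \<in> lists_over I n \<Longrightarrow>
        (\<Sum>ys\<in>lists_over I n. cyclic_cocycle H J I T n xs ys * g ys zs) = (if xs = zs then 1 else 0)"
      "\<And>xs zs. xs \<in> lists_over I n \<Longrightarrow> zs \<in> lists_over I n \<Longrightarrow>
        (\<Sum>ys\<in>lists_over I n. g xs ys * cyclic_cocycle H J I T n ys zs) = (if xs = zs then 1 else 0)"
  shows "tr I (mpow I (restrict_mat I (\<lambda>i j. u (T i j))) n) = of_nat (card I)"
proof -
  let ?L = "lists_over I n" and ?P = "tensor_power H T" and ?h = "cyclic_cocycle H J I T n"
  let ?U = "\<lambda>i j. u (T i j)"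
  have fin: "finite I" by (rule mult_matrix_finite[OF T])
  have finL: "finite ?L" by (rule finite_lists_over[OF fin])
  have rot: "rotate1 xs \<in> ?L" if "xs \<in> ?L" for xs by (rule rotate1_lists_over[OF that])
  have expand: "u (?P xs ys) = (\<Sum>b\<in>?L. (\<Sum>a\<in>?L. ?h xs a * power_entry ?U a b) * g b ys)"
    if mem: "xs \<in> ?L" "ys \<in> ?L" for xs ys
  proof -
    have "u (?P xs ys) = (\<Sum>a\<in>?L. u (?P xs a) * (if a = ys then 1 else 0))"
      by (rule sum_delta_left(4)[OF finL mem(2), symmetric])
    also have "\<dots> = (\<Sum>a\<in>?L. u (?P xs a) * (\<Sum>b\<in>?L. ?h a b * g b ys))"
      by (intro sum.cong refl) (simp add: g(1) mem)
    also have "\<dots> = (\<Sum>b\<in>?L. (\<Sum>a\<in>?L. u (?P xs a) * ?h a b) * g b ys)"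
      unfolding sum_distrib_left sum_distrib_right mult.assoc by (rule sum.swap)
    also have "\<dots> = (\<Sum>b\<in>?L. (\<Sum>a\<in>?L. ?h xs a * power_entry ?U a b) * g b ys)"
      by (intro sum.cong refl) (simp only: cyclic_cocycle_intertwines[OF T mem(1)])
    finally show ?thesis .
  qed
  have "of_nat (card I) = (\<Sum>xs\<in>?L. u (?P xs (rotate1 xs)))"
  proof -
    have "?P (rotate1 xs) (rotate1 ys) = ?P xs ys" if "xs \<in> ?L" "ys \<in> ?L" for xs ys
      using that by (simp add: tensor_power_rotate1 lists_over_def)
    from u_trace[OF mult_matrix_tensor_power[OF T] bij_rotate1_lists_over[OF fin] this]
    show ?thesis by (simp add: card_rotate1_fixed[OF fin n])
  qed
  also have "\<dots> = (\<Sum>xs\<in>?L. \<Sum>b\<in>?L. \<Sum>a\<in>?L. power_entry ?U a b * (g b (rotate1 xs) * ?h (rotate1 xs) (rotate1 a)))"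
  proof (rule sum.cong[OF refl])
    fix xs assume xs: "xs \<in> ?L"
    have "u (?P xs (rotate1 xs)) = (\<Sum>b\<in>?L. \<Sum>a\<in>?L. power_entry ?U a b * (g b (rotate1 xs) * ?h xs a))"
      unfolding expand[OF xs rot[OF xs]] sum_distrib_right by (simp only: ac_simps)
    also have "\<dots> = (\<Sum>b\<in>?L. \<Sum>a\<in>?L. power_entry ?U a b * (g b (rotate1 xs) * ?h (rotate1 xs) (rotate1 a)))"
      by (intro sum.cong refl) (simp only: cyclic_cocycle_rotate1 xs)
    finally show "u (?P xs (rotate1 xs)) =
        (\<Sum>b\<in>?L. \<Sum>a\<in>?L. power_entry ?U a b * (g b (rotate1 xs) * ?h (rotate1 xs) (rotate1 a)))" .
  qed
  also have "\<dots> = (\<Sum>b\<in>?L. \<Sum>xs\<in>?L. \<Sum>a\<in>?L. power_entry ?U a b * (g b (rotate1 xs) * ?h (rotate1 xs) (rotate1 a)))"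
    by (rule sum.swap)
  also have "\<dots> = (\<Sum>b\<in>?L. \<Sum>a\<in>?L. power_entry ?U a b * (\<Sum>xs\<in>?L. g b (rotate1 xs) * ?h (rotate1 xs) (rotate1 a)))"
    unfolding sum_distrib_left by (rule sum.cong[OF refl], rule sum.swap)
  also have "\<dots> = (\<Sum>b\<in>?L. \<Sum>a\<in>?L. power_entry ?U a b * (if b = rotate1 a then 1 else 0))"
  proof (intro sum.cong refl)
    fix b a assume "b \<in> ?L" "a \<in> ?L"
    moreover have "(\<Sum>xs\<in>?L. g b (rotate1 xs) * ?h (rotate1 xs) (rotate1 a)) = (\<Sum>xs\<in>?L. g b xs * ?h xs (rotate1 a))"
      by (rule sum.reindex_bij_betw[OF bij_rotate1_lists_over[OF fin]])
    ultimately show "power_entry ?U a b * (\<Sum>xs\<in>?L. g b (rotate1 xs) * ?h (rotate1 xs) (rotate1 a)) =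
        power_entry ?U a b * (if b = rotate1 a then 1 else 0)"
      by (simp add: g(2) rot)
  qed
  also have "\<dots> = (\<Sum>a\<in>?L. power_entry ?U a (rotate1 a))"
    by (subst sum.swap, intro sum.cong refl, rule sum_delta_left(4)[OF finL rot])
  also have "\<dots> = (\<Sum>a\<in>?L. power_entry (restrict_mat I ?U) a (rotate1 a))"
  proof (rule sum.cong[OF refl])
    have "set xs \<subseteq> I \<Longrightarrow> set ys \<subseteq> I \<Longrightarrow> power_entry ?U xs ys = power_entry (restrict_mat I ?U) xs ys"
      if "length xs = length ys" for xs ys
      using that by (induction xs ys rule: list_induct2) (simp_all add: restrict_mat_def)
    then show "power_entry ?U a (rotate1 a) = power_entry (restrict_mat I ?U) a (rotate1 a)" if "a \<in> ?L" for a
      using that by (simp add: lists_over_def)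
  qed
  also have "\<dots> = tr I (mpow I (restrict_mat I ?U) n)"
    by (rule sum_power_entry_cycle[OF fin restrict_mat_matrices n])
  finally show ?thesis by simp
qed

end

section \<open>Deformations of the trivial cocycle\<close>

lemma iterated_cocycle_polynomial:
  assumes "\<And>a b. G a b \<in> polynomial_functions n"
  shows "(\<lambda>x. iterated_cocycle H (\<lambda>a b. G a b x) I T m xs ys) \<in> polynomial_functions n"
proof (induction m arbitrary: xs ys)
  case (Suc m)
  then show ?case unfolding iterated_cocycle.simps
    by (intro polynomial_functions_sum polynomial_functions.mult assms)
qed (simp add: polynomial_functions.const)

lemma cyclic_cocycle_polynomial:
  assumes "\<And>a b. G a b \<in> polynomial_functions n"
  shows "(\<lambda>x. cyclic_cocycle H (\<lambda>a b. G a b x) I T m xs ys) \<in> polynomial_functions n"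
  unfolding cyclic_cocycle_def by (intro polynomial_functions_sum iterated_cocycle_polynomial assms)

lemma cyclic_cocycle_trivial:
  assumes H: "commutative_hopf_algebra H" and T: "mult_matrix H I T"
    and mem: "xs \<in> lists_over I m" "ys \<in> lists_over I m"
  shows "cyclic_cocycle H (convolution_one H) I T m xs ys = (if xs = ys then of_nat m else 0)"
proof -
  have "rotate i xs = rotate i ys \<longleftrightarrow> xs = ys" for i
    using bij_rotate_lists_over[OF mult_matrix_finite[OF T], of i m] mem by (auto simp: bij_betw_def inj_on_def)
  then show ?thesis
    by (simp add: cyclic_cocycle_def iterated_cocycle_trivial[OF H T] rotate_lists_over mem)
qed

lemma mpow_polynomial:
  assumes "\<And>i j. (\<lambda>x. A x i j) \<in> polynomial_functions n"
  shows "(\<lambda>x. mpow I (A x) m i j) \<in> polynomial_functions n"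
proof (induction m arbitrary: i j)
  case (Suc m)
  then show ?case unfolding mpow.simps mm_def
    by (intro polynomial_functions_sum polynomial_functions.mult assms)
qed (simp add: polynomial_functions.const)

lemma mpow_smat: "mpow I (smat c A) m = smat (c ^ m) (mpow I A m)"
proof (induction m)
  case 0
  show ?case by (simp add: smat_def)
next
  case (Suc m)
  then show ?case by (simp add: mm_smat_left mm_smat_right) (simp add: smat_def ac_simps)
qed

text \<open>
  At the base point the averaged cocycle is \<open>m\<close> times the identity matrix, so it is invertible on a nonempty open set.
  On that set the power traces of \<open>u(T)\<close> are trivial.  The entries of \<open>u(T)\<close> are rational functions whose denominator
  \<open>det q(T)\<close> has no zeros, so the identity of traces extends to the whole irreducible variety.
\<close>

lemma power_traces_of_deformation:
  fixes H :: "('k::field_char_0, 'b::ab_group_add) hopf" and T :: "'i \<Rightarrow> 'i \<Rightarrow> 'b"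
  assumes H: "commutative_hopf_algebra H" and T: "mult_matrix H I T"
    and X: "irreducible_closed n X" "p \<in> X" "x \<in> X"
    and G: "\<And>a b. G a b \<in> polynomial_functions n"
    and cocycle: "\<And>x. x \<in> X \<Longrightarrow> hopf_2_cocycle H (\<lambda>a b. G a b x)"
    and one: "(\<lambda>a b. G a b p) = convolution_one H"
    and m: "m \<ge> 1"
  shows "tr I (mpow I (restrict_mat I (\<lambda>i j. hopf_twist.u H (\<lambda>a b. G a b x) (T i j))) m) = of_nat (card I)"
proof -
  have fin: "finite I" by (rule mult_matrix_finite[OF T])
  let ?L = "lists_over I m"
  have finL: "finite ?L" by (rule finite_lists_over[OF fin])
  have tw: "hopf_twist H (\<lambda>a b. G a b y)" if "y \<in> X" for y
    using H cocycle[OF that] by (simp add: hopf_twist_def hopf_twist_axioms_def)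
  define U where "U y = restrict_mat I (\<lambda>i j. hopf_twist.u H (\<lambda>a b. G a b y) (T i j))" for y
  define h where "h xs ys y = cyclic_cocycle H (\<lambda>a b. G a b y) I T m xs ys" for xs ys y
  have h_poly: "h xs ys \<in> polynomial_functions n" for xs ys
    using cyclic_cocycle_polynomial[of G n H I T m xs ys] G by (simp add: h_def[abs_def])
  obtain d B where dB: "cramer_inverse n ?L h d B"
    using cramer_inverse_exists[OF finL, of h n] h_poly by blast
  note d = cramer_inverseD(1)[OF dB] and hB = cramer_inverseD(3)[OF dB] and Bh = cramer_inverseD(4)[OF dB]
  have dp: "d p \<noteq> 0"
  proof (rule cramer_inverseD(5)[OF dB, of p "\<lambda>i j. if i = j then 1 / of_nat m else 0"])
    fix i j assume ij: "i \<in> ?L" "j \<in> ?L"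
    have "(\<Sum>l\<in>?L. h i l p * (if l = j then 1 / of_nat m else 0)) = (\<Sum>l\<in>?L. if l = j then h i j p / of_nat m else 0)"
      by (intro sum.cong refl) simp
    also have "\<dots> = h i j p / of_nat m" using finL ij by simp
    also have "\<dots> = (if i = j then 1 else 0)"
      using m by (simp add: h_def one cyclic_cocycle_trivial[OF H T ij])
    finally show "(\<Sum>l\<in>?L. h i l p * (if l = j then 1 / of_nat m else 0)) = (if i = j then 1 else 0)" .
  qed
  have generic: "tr I (mpow I (U y) m) = of_nat (card I)" if y: "y \<in> X" "d y \<noteq> 0" for y
    unfolding U_def
  proof (rule hopf_twist.power_trace[OF tw[OF y(1)] T m, where g = "\<lambda>i j. B i j y / d y"])
    fix xs zs assume L: "xs \<in> ?L" "zs \<in> ?L"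
    show "(\<Sum>ys\<in>?L. cyclic_cocycle H (\<lambda>a b. G a b y) I T m xs ys * (B ys zs y / d y)) = (if xs = zs then 1 else 0)"
      using hB[OF L, of y] y(2) by (simp add: h_def sum_divide_distrib[symmetric])
    show "(\<Sum>ys\<in>?L. B xs ys y / d y * cyclic_cocycle H (\<lambda>a b. G a b y) I T m ys zs) = (if xs = zs then 1 else 0)"
      using Bh[OF L, of y] y(2) by (simp add: h_def sum_divide_distrib[symmetric])
  qed
  define Q where "Q i j y = (\<Sum>l\<in>I. G (antipode H (T i l)) (T l j) y)" for i j y
  define QS where "QS i j y = (\<Sum>l\<in>I. G (T l j) (antipode H (T i l)) y)" for i j y
  have Q_poly: "Q i j \<in> polynomial_functions n" for i j
    unfolding Q_def[abs_def] by (intro polynomial_functions_sum G)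
  obtain e A where eA: "cramer_inverse n I Q e A"
    using cramer_inverse_exists[OF fin, of Q n] Q_poly by blast
  note e = cramer_inverseD(1)[OF eA] and A = cramer_inverseD(2)[OF eA] and AQ = cramer_inverseD(4)[OF eA]
  have ey: "e y \<noteq> 0" if y: "y \<in> X" for y
  proof (rule cramer_inverseD(5)[OF eA, of y "\<lambda>i j. hopf_twist.q' H (\<lambda>a b. G a b y) (T i j)"])
    interpret tw: hopf_twist H "\<lambda>a b. G a b y" by (rule tw[OF y])
    show "(\<Sum>l\<in>I. Q i l y * tw.q' (T l j)) = (if i = j then 1 else 0)" if "i \<in> I" "j \<in> I" for i j
      using tw.q_q'_matrix[OF T that] that by (simp add: Q_def tw.q_matrix[OF T])
  qed
  define W where "W y = restrict_mat I (\<lambda>i j. \<Sum>l\<in>I. A i l y * QS l j y)" for y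
  have WU: "W y = smat (e y) (U y)" if y: "y \<in> X" for y
  proof (intro ext)
    interpret tw: hopf_twist H "\<lambda>a b. G a b y" by (rule tw[OF y])
    fix i j
    show "W y i j = smat (e y) (U y) i j"
    proof (cases "i \<in> I \<and> j \<in> I")
      case True
      then have ij: "i \<in> I" "j \<in> I" by auto
      have "(\<Sum>l\<in>I. A i l y * QS l j y) = (\<Sum>l\<in>I. A i l y * (\<Sum>k\<in>I. Q l k y * tw.u (T k j)))"
        using ij by (intro sum.cong refl)
          (simp add: QS_def Q_def tw.q_S_matrix[OF T, symmetric] tw.q_matrix[OF T, symmetric] tw.q_u_matrix[OF T])
      also have "\<dots> = (\<Sum>k\<in>I. (\<Sum>l\<in>I. A i l y * Q l k y) * tw.u (T k j))"
        unfolding sum_distrib_left sum_distrib_right mult.assoc by (rule sum.swap)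
      also have "\<dots> = (\<Sum>k\<in>I. if k = i then e y * tw.u (T k j) else 0)"
        using ij by (intro sum.cong refl) (simp add: AQ)
      also have "\<dots> = e y * tw.u (T i j)" using fin ij by simp
      finally show ?thesis using ij by (simp add: W_def U_def smat_def restrict_mat_def)
    qed (auto simp: W_def U_def smat_def restrict_mat_def)
  qed
  \<comment> \<open>the identity of traces, multiplied by the denominator \<open>e\<^sup>m\<close>\<close>
  define f where "f y = tr I (mpow I (W y) m) - of_nat (card I) * e y ^ m" for y
  have f: "f y = e y ^ m * (tr I (mpow I (U y) m) - of_nat (card I))" if "y \<in> X" for y
    by (simp add: f_def WU[OF that] mpow_smat tr_smat algebra_simps)
  have "(\<lambda>y. W y i j) \<in> polynomial_functions n" for i j
    unfolding W_def restrict_mat_def QS_def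
    by (cases "i \<in> I \<and> j \<in> I") (auto intro!: polynomial_functions_sum polynomial_functions.mult polynomial_functions.const A G)
  then have "f \<in> polynomial_functions n"
    unfolding f_def tr_def
    by (intro polynomial_functions_diff polynomial_functions_sum mpow_polynomial polynomial_functions.mult
        polynomial_functions.const polynomial_functions_power e)
  then have "(\<forall>y\<in>X. d y = 0) \<or> (\<forall>y\<in>X. f y = 0)"
    using irreducible_no_zero_divisors[OF X(1) d, of f] generic f by fastforce
  then have "f x = 0" using dp X by auto
  then show ?thesis using f[OF X(3)] ey[OF X(3)] by (simp add: U_def)
qed

theorem theorem6p4:
  fixes OG :: "('k::{alg_closed_field, field_char_0}, 'b::ab_group_add) hopf"
    and J :: "'b \<Rightarrow> 'b \<Rightarrow> 'k"
  assumes "commutative_hopf_algebra OG"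
    and "hopf_2_cocycle OG J"
    and "deformation_of_one OG J"
  shows "unipotent_operator (twist OG J) (antipode (twist OG J) \<circ> antipode (twist OG J))"
proof -
  interpret hopf_twist OG J
    using assms by (simp add: hopf_twist_def hopf_twist_axioms_def)
  obtain n X p F x where X: "irreducible_closed n X" "p \<in> X" "x \<in> X"
    and F: "cocycle_family OG n X F" "(\<lambda>a b. F a b p) = convolution_one OG" "J = (\<lambda>a b. F a b x)"
    using assms(3) by (auto simp: deformation_of_one_def irreducible_affine_curve_def smooth_point_of_curve_def)
  have "\<forall>a b. \<exists>g. g \<in> polynomial_functions n \<and> F a b = (\<lambda>y. if y \<in> X then g y else 0)"
    using F(1) unfolding cocycle_family_def regular_functions_def by blast
  then obtain G where G: "\<And>a b. G a b \<in> polynomial_functions n"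
    and FG: "\<And>a b. F a b = (\<lambda>y. if y \<in> X then G a b y else 0)" by metis
  have FG': "(\<lambda>a b. F a b y) = (\<lambda>a b. G a b y)" if "y \<in> X" for y using that by (simp add: FG)
  have cocycleG: "hopf_2_cocycle OG (\<lambda>a b. G a b y)" if "y \<in> X" for y
    using F(1) that by (simp add: cocycle_family_def FG'[symmetric])
  have oneG: "(\<lambda>a b. G a b p) = convolution_one OG" using F(2) FG'[OF X(2)] by simp
  have JG: "J = (\<lambda>a b. G a b x)" using F(3) FG'[OF X(3)] by simp
  show ?thesis unfolding unipotent_operator_def
  proof (intro allI impI)
    fix C assume "subcoalgebra (twist OG J) C \<and> finite_dimensional (twist OG J) C"
    then have C: "subcoalgebra OG C" "finite_dimensional OG C"
      by (simp_all add: subcoalgebra_def finite_dimensional_def twist_def)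
    have subC: "V.subspace C" using C(1) by (simp add: subcoalgebra_def)
    obtain E :: "'b set" and T where T: "mult_matrix OG E T" and TC: "\<And>i j. i \<in> E \<Longrightarrow> j \<in> E \<Longrightarrow> T i j \<in> C"
      and span: "C \<subseteq> V.span ((\<lambda>p. T (fst p) (snd p)) ` (E \<times> E))"
      using subcoalgebra_mult_matrix[OF C] by blast
    have stable: "tS (tS v) \<in> C" if "v \<in> C" for v
    proof -
      have "v \<in> V.span ((\<lambda>p. T (fst p) (snd p)) ` (E \<times> E))" using span that by blast
      then show ?thesis
      proof (rule V.span_induct_alt)
        show "tS (tS 0) \<in> C" using tS_sum[of "\<lambda>_. 0" "{}"] V.subspace_0[OF subC] by simp
        fix c a b assume "a \<in> (\<lambda>p. T (fst p) (snd p)) ` (E \<times> E)" and b: "tS (tS b) \<in> C"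
        then obtain i j where ij: "i \<in> E" "j \<in> E" "a = T i j" by auto
        have "tS (tS (T i j)) \<in> C"
          unfolding twisted_antipode_square_matrix[OF T ij(1,2)]
          by (intro V.subspace_sum[OF subC] V.subspace_scale[OF subC] TC)
        then show "tS (tS (scal OG c a + b)) \<in> C"
          using b by (simp add: tS_add tS_scal ij(3) V.subspace_add[OF subC] V.subspace_scale[OF subC])
      qed
    qed
    have "tr E (mpow E (restrict_mat E (\<lambda>i j. u (T i j))) m) = of_nat (card E)" if "m \<ge> 1" for m
      unfolding JG
      by (rule power_traces_of_deformation[OF assms(1) T X G cocycleG oneG that])
    then obtain m where nil: "mpow E (restrict_mat E (\<lambda>i j. u (T i j)) - idm E) m = 0"
      using unipotent_if_power_traces_trivial[OF mult_matrix_finite[OF T] restrict_mat_matrices] by blast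
    have "c = 1" if "v \<in> C" "v \<noteq> 0" "tS (tS v) = scal OG c v" for c v
      using twisted_antipode_square_eigenvalue[OF T nil _ that(2,3)] span that(1) by blast
    moreover have "scal (twist OG J) = scal OG" by (simp add: twist_def)
    ultimately show "(tS \<circ> tS) ` C \<subseteq> C \<and>
        (\<forall>c. \<forall>v\<in>C. v \<noteq> 0 \<and> (tS \<circ> tS) v = scal (twist OG J) c v \<longrightarrow> c = 1)"
      using stable by auto
  qed
qed

end
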